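(* Let $P$ be a set of $n$ points in the Hamming space $\{0,1\}^d$, let $\ell$ be a positive integer, and let $z$ be a nonnegative integer smaller than $n$. Suppose that there is a set $T\subseteq P$ of $\ell$ centers and a real $r$ such that at least $n-z$ points $p\in P$ satisfy $\min_{t\in T}\mathrm{ham}(t,p)\le r$. Let $\epsilon\in(0,1/2)$. Then in time $\tilde{O}(n^2(\epsilon^{-2}+\ell))$ one can construct (by a randomized algorithm) a set $T'\subseteq P$ of $\ell$ centers such that w.h.p. at least $n-z$ points $p\in P$ satisfy $\min_{t\in T'}\mathrm{ham}(t,p)\le(3+\epsilon)r$.
   Context: $\mathrm{ham}(a,b)$ denotes the Hamming distance, i.e., the number of coordinates in which $a$ and $b$ differ. This concerns the $\ell$-center clustering problem with $z$ outliers in the Hamming space: choose $\ell$ centers so that, after discarding at most $z$ points of $P$ as outliers, the maximum Hamming distance of a remaining point to its nearest center is minimized; a solution is conservative if its centers belong to $P$. W.h.p. means with probability at least $1-1/n^{\beta}$ for any desired constant $\beta\ge1$. $\tilde{O}(\cdot)$ suppresses polylogarithmic factors in $n$.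
   Formalization: The time bound is Õ(max(n²(ε⁻²+ℓ), nd)) on a unit-cost word RAM instead of Õ(n²(ε⁻²+ℓ)): for d much larger than n(ε⁻²+ℓ) the nd input bits cannot all be read and the stated bound fails; for d ≤ n(ε⁻²+ℓ) the two bounds coincide. *)

theory Defs
  imports "HOL-Probability.Probability"
begin

definition hamming_space :: "nat \<Rightarrow> bool list set" where
  "hamming_space d = {p. length p = d}"

definition ham :: "bool list \<Rightarrow> bool list \<Rightarrow> nat" where
  "ham a b = card {i. i < length a \<and> a ! i \<noteq> b ! i}"

text \<open>Meaningful for finite nonempty \<open>T\<close> only.\<close>

definition center_dist :: "bool list set \<Rightarrow> bool list \<Rightarrow> nat" where
  "center_dist T p = Min ((\<lambda>t. ham t p) ` T)"

definition covered :: "bool list set \<Rightarrow> bool list set \<Rightarrow> real \<Rightarrow> bool list set" where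
  "covered P T r = {p \<in> P. real (center_dist T p) \<le> r}"

text \<open>
  Running time is measured on a randomized word RAM with word length \<open>w\<close>, programmed in a small
  structured language. A program is a finite piece of syntax and hence mentions finitely many
  registers and arrays; finitely many arrays can be interleaved in one memory, so having several
  of them changes the running time by a constant factor only. Every arithmetic operation
  truncates its result to \<open>w\<close> bits; in particular all addresses are words.
\<close>

datatype binop = Plus | Monus | Times | Div | Mod | Less | Equal

datatype expr =
    Const nat
  | Reg nat
  | Arr nat expr
  | Bin binop expr expr

datatype instr =
    SetReg nat expr
  | SetArr nat expr expr
  | Random nat
  | Cond expr "instr list" "instr list"
  | Loop expr "instr list"

record memory =
  regs :: "nat \<Rightarrow> nat"
  arrs :: "nat \<Rightarrow> nat \<Rightarrow> nat"

fun apply_binop :: "binop \<Rightarrow> nat \<Rightarrow> nat \<Rightarrow> nat" where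
  "apply_binop Plus x y = x + y"
| "apply_binop Monus x y = x - y"
| "apply_binop Times x y = x * y"
| "apply_binop Div x y = x div y"
| "apply_binop Mod x y = x mod y"
| "apply_binop Less x y = of_bool (x < y)"
| "apply_binop Equal x y = of_bool (x = y)"

fun value_of :: "nat \<Rightarrow> memory \<Rightarrow> expr \<Rightarrow> nat" where
  "value_of w s (Const k) = k mod 2 ^ w"
| "value_of w s (Reg x) = regs s x"
| "value_of w s (Arr a e) = arrs s a (value_of w s e)"
| "value_of w s (Bin f e1 e2) = apply_binop f (value_of w s e1) (value_of w s e2) mod 2 ^ w"

definition set_reg :: "nat \<Rightarrow> nat \<Rightarrow> memory \<Rightarrow> memory" where
  "set_reg x v s = s\<lparr>regs := (regs s)(x := v)\<rparr>"

definition set_arr :: "nat \<Rightarrow> nat \<Rightarrow> nat \<Rightarrow> memory \<Rightarrow> memory" where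
  "set_arr a i v s = s\<lparr>arrs := (arrs s)(a := (arrs s a)(i := v))\<rparr>"

text \<open>
  A configuration consists of the instructions still to be executed and the memory; the machine
  has halted when no instruction is left. One step executes one assignment, draws one uniformly
  random word, or evaluates one condition. The expressions in a fixed program have bounded size,
  so charging one unit per step is the usual unit-cost measure up to a constant factor.
\<close>

type_synonym config = "instr list \<times> memory"

fun step :: "nat \<Rightarrow> config \<Rightarrow> config pmf" where
  "step w ([], s) = return_pmf ([], s)"
| "step w (SetReg x e # is, s) = return_pmf (is, set_reg x (value_of w s e) s)"
| "step w (SetArr a i e # is, s) = return_pmf (is, set_arr a (value_of w s i) (value_of w s e) s)"
| "step w (Random x # is, s) = map_pmf (\<lambda>v. (is, set_reg x v s)) (pmf_of_set {..<2 ^ w})"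
| "step w (Cond b is1 is2 # is, s) =
     return_pmf ((if value_of w s b \<noteq> 0 then is1 else is2) @ is, s)"
| "step w (Loop b body # is, s) =
     return_pmf (if value_of w s b \<noteq> 0 then body @ Loop b body # is else is, s)"

primrec steps :: "nat \<Rightarrow> nat \<Rightarrow> config \<Rightarrow> config pmf" where
  "steps w 0 c = return_pmf c"
| "steps w (Suc t) c = bind_pmf (step w c) (steps w t)"

text \<open>
  The points are given as a list \<open>ps\<close>, one bit per cell of array 0, row by row. Registers 0 to 4
  hold the parameters. The real accuracy parameter is given to the program only through the
  integer \<open>k\<close>, its inverse rounded up.
\<close>

definition input_memory :: "bool list list \<Rightarrow> nat \<Rightarrow> nat \<Rightarrow> nat \<Rightarrow> nat \<Rightarrow> memory" where
  "input_memory ps d l z k =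
     \<lparr>regs = (\<lambda>_. 0)(0 := length ps, 1 := d, 2 := l, 3 := z, 4 := k),
      arrs = (\<lambda>_ _. 0)(0 := (\<lambda>a. of_bool (a < length ps * d \<and> ps ! (a div d) ! (a mod d))))\<rparr>"

text \<open>The centers are output as indices into \<open>ps\<close>, in the first \<open>l\<close> cells of array 1.\<close>

definition output_indices :: "nat \<Rightarrow> config \<Rightarrow> nat set" where
  "output_indices l c = arrs (snd c) 1 ` {..<l}"

definition output_centers :: "bool list list \<Rightarrow> nat \<Rightarrow> config \<Rightarrow> bool list set" where
  "output_centers ps l c = (\<lambda>i. ps ! i) ` output_indices l c"

definition halted_with_output :: "bool list list \<Rightarrow> nat \<Rightarrow> config \<Rightarrow> bool" where
  "halted_with_output ps l c \<longleftrightarrow> fst c = [] \<and> output_indices l c \<subseteq> {..<length ps}"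

text \<open>
  The bound \<open>n\<^sup>2 (1 / eps\<^sup>2 + l)\<close>, except that it is never taken to be smaller than the number
  \<open>n d\<close> of input bits, all of which may have to be read. The two coincide if
  \<open>d \<le> n (1 / eps\<^sup>2 + l)\<close>, in particular if \<open>d \<le> n\<close>.
\<close>

definition time_bound :: "nat \<Rightarrow> nat \<Rightarrow> nat \<Rightarrow> real \<Rightarrow> real" where
  "time_bound n d l eps = max ((real n)\<^sup>2 * (1 / eps\<^sup>2 + real l)) (real n * real d)"

end

theory Submission
  imports Defs
begin

text \<open>
  All pairwise Hamming distances are estimated up to a factor \<open>1 \<plusminus> \<delta>\<close>, where \<open>\<delta> = 1 / (16 k)\<close> and
  \<open>k = \<lceil>1 / eps\<rceil>\<close>, by count sketches (AMS sketches hashed into \<open>m = O(k\<^sup>2)\<close> buckets): one pass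
  over the coordinates computes all sketches of a point, so that sketching takes time \<open>O(n (d + m))\<close> per
  repetition. Adding one coordinate at a time, the squared norm of the sketch of a difference of
  two points is a martingale up to drift, which gives variance at most \<open>2 h\<^sup>2 / m\<close> for two points
  at distance \<open>h\<close>. The median over \<open>O(\<beta> log n)\<close> repetitions is then good for all pairs with the
  required probability, by an exponential moment bound on the number of bad repetitions.

  On the estimated distances runs the greedy algorithm for centers with outliers: repeatedly pick
  the point with the largest number of uncovered points within the current radius, and cover
  everything within about three times that radius. Whenever some \<open>l\<close> balls of the current
  radius contain \<open>n - z\<close> points, so do the enlarged greedy balls. Therefore a binary search over
  the integral radii, which needs no monotonicity of the greedy algorithm, ends at a
  radius that is successful and at most the optimal one. The two-sided error enters through
  \<open>3 ((1 + \<delta>) / (1 - \<delta>))\<^sup>2 \<le> 3 + eps\<close>.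
\<close>

section \<open>Timed total correctness\<close>

text \<open>The time budget dictates the kind of sketch. A dense sketch changes all \<open>m\<close>
  entries for every coordinate and costs about \<open>n d / eps^2\<close>, too much once
  \<open>d\<close> is large. Hashing a coordinate into one signed bucket costs \<open>n d\<close>
  per repetition, and the variance is still of order \<open>h^2 / m\<close>, so \<open>m\<close> of
  order \<open>k^2\<close> suffices. One independent word is drawn per coordinate and repetition,
  and all points share it. Sketches are then linear, and a single table of \<open>R * d\<close>
  words serves all pairs of points. Once the table is fixed the program is deterministic. Hence the
  machine code, apart from the loop that draws the words, is verified in a calculus of point masses,
  and probability enters only through the set of good tables. The output must consist of
  \<open>l\<close> distinct valid indices even for a bad table. Therefore the greedy choice never
  repeats a point, and the search is verified for an arbitrary matrix with entries at most
  \<open>d * d\<close>.\<close>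

lemma steps_add: "steps w (a + b) c = bind_pmf (steps w a c) (steps w b)"
proof (induction a arbitrary: c)
  case (Suc a)
  then have "steps w (a + b) = (\<lambda>x. bind_pmf (steps w a x) (steps w b))"
    by blast
  then show ?case by (simp add: bind_assoc_pmf)
qed (simp add: bind_return_pmf)

lemma steps_halted: "steps w t ([], s) = return_pmf ([], s)"
  by (induction t) (simp_all add: bind_return_pmf)

text \<open>Quantifying over the continuation \<open>rest\<close> lets fragments be composed without
  knowing what follows them. The point mass fixes an exact number of steps, so the times of
  consecutive fragments add.\<close>

definition runs :: "nat \<Rightarrow> instr list \<Rightarrow> memory \<Rightarrow> nat \<Rightarrow> memory \<Rightarrow> bool" where
  "runs w is s t s' \<longleftrightarrow> (\<forall>rest. steps w t (is @ rest, s) = return_pmf (rest, s'))"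

text \<open>The exact step count is hidden behind a bound that can be weakened freely; it is
  recovered from \<open>runs\<close> when the whole program is assembled.\<close>

definition wp :: "nat \<Rightarrow> instr list \<Rightarrow> nat \<Rightarrow> (memory \<Rightarrow> bool) \<Rightarrow> memory \<Rightarrow> bool" where
  "wp w is T Q s \<longleftrightarrow> (\<exists>t s'. t \<le> T \<and> runs w is s t s' \<and> Q s')"

lemma wp_mono:
  assumes "wp w is T Q s" "T \<le> T'" "\<And>s'. Q s' \<Longrightarrow> Q' s'"
  shows "wp w is T' Q' s"
  using assms unfolding wp_def by (meson le_trans)

lemma wp_time: "wp w is T Q s \<Longrightarrow> T \<le> T' \<Longrightarrow> wp w is T' Q s"
  by (erule wp_mono)

lemma wp_Nil: "Q s \<Longrightarrow> wp w [] 0 Q s"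
  unfolding wp_def runs_def by (auto intro!: exI[of _ 0] exI[of _ s])

lemma wp_step:
  assumes "\<And>rest. step w (i # is @ rest, s) = return_pmf (js @ rest, s1)" "wp w js T Q s1"
  shows "wp w (i # is) (Suc T) Q s"
proof -
  from assms(2) obtain t s' where t: "t \<le> T" "runs w js s1 t s'" "Q s'"
    unfolding wp_def by blast
  have "runs w (i # is) s (Suc t) s'"
    using t(2) assms(1) unfolding runs_def by (simp add: bind_return_pmf)
  then show ?thesis
    using t unfolding wp_def by (intro exI[of _ "Suc t"] exI[of _ s']) simp
qed

lemma wp_SetReg:
  "wp w is T Q (set_reg x (value_of w s e) s) \<Longrightarrow> wp w (SetReg x e # is) (Suc T) Q s"
  by (rule wp_step) simp_all

lemma wp_SetArr:
  "wp w is T Q (set_arr a (value_of w s i) (value_of w s e) s) \<Longrightarrow>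
   wp w (SetArr a i e # is) (Suc T) Q s"
  by (rule wp_step) simp_all

lemma wp_append:
  assumes "wp w xs T1 (wp w ys T2 Q) s"
  shows "wp w (xs @ ys) (T1 + T2) Q s"
proof -
  from assms obtain t1 s1 t2 s2 where *: "t1 \<le> T1" "runs w xs s t1 s1"
    "t2 \<le> T2" "runs w ys s1 t2 s2" "Q s2"
    unfolding wp_def by blast
  have "runs w (xs @ ys) s (t1 + t2) s2"
    using *(2,4) unfolding runs_def by (simp add: steps_add bind_return_pmf)
  then show ?thesis
    using * unfolding wp_def by (intro exI[of _ "t1 + t2"] exI[of _ s2]) simp
qed

lemma wp_seq:
  assumes "wp w xs T1 Q1 s" "\<And>s1. Q1 s1 \<Longrightarrow> wp w ys T2 Q s1"
  shows "wp w (xs @ ys) (T1 + T2) Q s"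
  by (rule wp_append, rule wp_mono[OF assms(1)]) (use assms(2) in auto)

lemma wp_Cond:
  assumes "value_of w s b \<noteq> 0 \<Longrightarrow> wp w (xs @ is) T Q s"
    "value_of w s b = 0 \<Longrightarrow> wp w (ys @ is) T Q s"
  shows "wp w (Cond b xs ys # is) (Suc T) Q s"
  by (rule wp_step[where js = "(if value_of w s b \<noteq> 0 then xs else ys) @ is" and ?s1.0 = s])
    (use assms in auto)

text \<open>\<open>I\<close> is indexed by the number of completed iterations. The obligation
  \<open>i < N\<close> under a true guard bounds that number, which yields termination and the time
  bound at once.\<close>

lemma wp_Loop:
  assumes I: "I 0 s"
    and body: "\<And>i s. I i s \<Longrightarrow> value_of w s b \<noteq> 0 \<Longrightarrow> i < N \<and> wp w body T (I (Suc i)) s"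
    and exit: "\<And>i s. i \<le> N \<Longrightarrow> I i s \<Longrightarrow> value_of w s b = 0 \<Longrightarrow> Q s"
  shows "wp w [Loop b body] (1 + N * (T + 1)) Q s"
proof -
  have "wp w [Loop b body] (1 + k * (T + 1)) Q s" if "I i s" "i + k = N" for i k s
    using that
  proof (induction k arbitrary: i s)
    case (Suc k)
    show ?case
    proof (cases "value_of w s b = 0")
      case True
      have "wp w [Loop b body] (Suc 0) Q s"
        by (rule wp_step[where js = "[]" and ?s1.0 = s])
          (use True exit[of i] Suc.prems in \<open>auto intro!: wp_Nil\<close>)
      then show ?thesis
        by (rule wp_time) simp
    next
      case False
      have "wp w (body @ [Loop b body]) (T + (1 + k * (T + 1))) Q s"
        by (rule wp_seq[of _ _ _ "I (Suc i)"])
          (use body[OF Suc.prems(1) False] Suc in auto)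
      then have "wp w [Loop b body] (Suc (T + (1 + k * (T + 1)))) Q s"
        by (intro wp_step[where js = "body @ [Loop b body]" and ?s1.0 = s]) (use False in auto)
      then show ?thesis
        by (rule wp_time) simp
    qed
  next
    case 0
    \<comment> \<open>No iteration is left, so \<open>i = N\<close>, and a true guard would give
      \<open>N < N\<close>.\<close>
    then have "value_of w s b = 0"
      using body by fastforce
    then have "wp w [Loop b body] (Suc 0) Q s"
      using exit 0 by (intro wp_step[where js = "[]" and ?s1.0 = s]) (auto intro: wp_Nil)
    then show ?case by simp
  qed
  from this[of 0 s N] I show ?thesis by simp
qed

definition for_loop :: "nat \<Rightarrow> expr \<Rightarrow> instr list \<Rightarrow> instr list" where
  "for_loop x e body =
     [SetReg x (Const 0),
      Loop (Bin Less (Reg x) e) (body @ [SetReg x (Bin Plus (Reg x) (Const 1))])]"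

lemma regs_set_reg [simp]: "regs (set_reg x v s) = (regs s)(x := v)"
  and arrs_set_reg [simp]: "arrs (set_reg x v s) = arrs s"
  and regs_set_arr [simp]: "regs (set_arr a i v s) = regs s"
  and arrs_set_arr [simp]: "arrs (set_arr a i v s) = (arrs s)(a := (arrs s a)(i := v))"
  by (simp_all add: set_reg_def set_arr_def)

text \<open>The limit \<open>e\<close> is evaluated anew at every test, hence the premise
  \<open>bound\<close>. The body has to establish the next invariant for the memory after the
  increment, and \<open>N < 2 ^ w\<close> keeps the counter from wrapping around.\<close>

lemma wp_for:
  assumes N: "N < 2 ^ w"
    and bound: "\<And>i s. I i s \<Longrightarrow> value_of w s e = N"
    and init: "I 0 (set_reg x 0 s)"
    and body: "\<And>i s. i < N \<Longrightarrow> I i s \<Longrightarrow> regs s x = i \<Longrightarrow>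
      wp w body T (\<lambda>s'. regs s' x = i \<and> I (Suc i) (set_reg x (Suc i) s')) s"
  shows "wp w (for_loop x e body) (2 + N * (T + 2)) (I N) s"
proof -
  have w: "1 mod 2 ^ w = (1::nat)" if "Suc i \<le> N" for i
    using N that by (cases w) auto
  have B: "wp w [Loop (Bin Less (Reg x) e) (body @ [SetReg x (Bin Plus (Reg x) (Const 1))])]
      (1 + N * (T + 1 + 1)) (I N) (set_reg x 0 s)"
  proof (rule wp_Loop[where I = "\<lambda>i s. i \<le> N \<and> regs s x = i \<and> I i s"])
    fix i s assume a: "i \<le> N \<and> regs s x = i \<and> I i s" and b: "value_of w s (Bin Less (Reg x) e) \<noteq> 0"
    then have i: "i < N"
      using bound[of i s] by (cases "i < N") auto
    show "i < N \<and> wp w (body @ [SetReg x (Bin Plus (Reg x) (Const 1))]) (T + 1)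
       (\<lambda>s. Suc i \<le> N \<and> regs s x = Suc i \<and> I (Suc i) s) s"
    proof (intro conjI i wp_seq[OF body[OF i]])
      fix s1 assume s1: "regs s1 x = i \<and> I (Suc i) (set_reg x (Suc i) s1)"
      have "wp w [SetReg x (Bin Plus (Reg x) (Const 1))] (Suc 0)
           (\<lambda>s. Suc i \<le> N \<and> regs s x = Suc i \<and> I (Suc i) s) s1"
        using s1 i N w[of i] by (intro wp_SetReg wp_Nil) auto
      then show "wp w [SetReg x (Bin Plus (Reg x) (Const 1))] 1
           (\<lambda>s. Suc i \<le> N \<and> regs s x = Suc i \<and> I (Suc i) s) s1" by simp
    qed (use a in auto)
  next
    fix i s assume a: "i \<le> N" "i \<le> N \<and> regs s x = i \<and> I i s"
      and b: "value_of w s (Bin Less (Reg x) e) = 0"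
    have "i < N \<Longrightarrow> w \<noteq> 0" using N by (cases w) auto
    then have "\<not> i < N"
      using a b bound[of i s] by (auto split: if_splits)
    then show "I N s" using a by simp
  qed (use init in auto)
  then have "wp w (for_loop x e body) (Suc (1 + N * (T + 1 + 1))) (I N) s"
    unfolding for_loop_def by (intro wp_SetReg) simp
  then show ?thesis by (rule wp_time) simp
qed

text \<open>The law of a table whose cells \<open>a\<close>, ..., \<open>a + N - 1\<close> are
  overwritten by independent uniform words. The recursion exposes the last word, the one to average
  over when a sketch is extended by one coordinate.\<close>

primrec fill :: "nat \<Rightarrow> nat \<Rightarrow> nat \<Rightarrow> (nat \<Rightarrow> nat) \<Rightarrow> (nat \<Rightarrow> nat) pmf" where
  "fill w a 0 f = return_pmf f"
| "fill w a (Suc N) f =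
     bind_pmf (fill w a N f) (\<lambda>g. map_pmf (\<lambda>v. g(a + N := v)) (pmf_of_set {..<2 ^ w}))"

lemma fill_add: "fill w a (M + N) f = bind_pmf (fill w a M f) (fill w (a + M) N)"
  by (induction N) (simp_all add: bind_return_pmf' bind_assoc_pmf add.assoc)

section \<open>Greedy covering\<close>

definition covers :: "(nat \<Rightarrow> nat set) \<Rightarrow> nat set \<Rightarrow> nat set" where
  "covers W C = (\<Union>c\<in>C. W c)"

text \<open>Chosen points are excluded so that \<open>l\<close> rounds give \<open>l\<close>
  distinct centers even when nothing new can be covered. Taking the least maximizer breaks ties as a
  scan does that changes its candidate only upon strict improvement.\<close>

definition greedy_pick :: "nat \<Rightarrow> (nat \<Rightarrow> nat set) \<Rightarrow> (nat \<Rightarrow> nat set) \<Rightarrow> nat set \<Rightarrow> nat" where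
  "greedy_pick n B W C = (LEAST c. c < n \<and> c \<notin> C \<and>
     (\<forall>c'<n. c' \<notin> C \<longrightarrow> card (B c' - covers W C) \<le> card (B c - covers W C)))"

primrec greedy :: "nat \<Rightarrow> (nat \<Rightarrow> nat set) \<Rightarrow> (nat \<Rightarrow> nat set) \<Rightarrow> nat \<Rightarrow> nat set" where
  "greedy n B W 0 = {}"
| "greedy n B W (Suc t) = insert (greedy_pick n B W (greedy n B W t)) (greedy n B W t)"

lemma greedy_pick:
  assumes "C \<subseteq> {..<n}" "card C < n"
  shows "greedy_pick n B W C < n" "greedy_pick n B W C \<notin> C"
    "c < n \<Longrightarrow> c \<notin> C \<Longrightarrow>
     card (B c - covers W C) \<le> card (B (greedy_pick n B W C) - covers W C)"
proof -
  let ?f = "\<lambda>c. card (B c - covers W C)"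
  let ?P = "\<lambda>c. c < n \<and> c \<notin> C \<and> (\<forall>c'<n. c' \<notin> C \<longrightarrow> ?f c' \<le> ?f c)"
  have "{..<n} - C \<noteq> {}"
  proof
    assume "{..<n} - C = {}"
    then have "C = {..<n}" using assms(1) by blast
    with assms(2) show False by simp
  qed
  then have "Max (?f ` ({..<n} - C)) \<in> ?f ` ({..<n} - C)"
    by (intro Max_in) auto
  then obtain c where "c \<in> {..<n} - C" "Max (?f ` ({..<n} - C)) = ?f c" by blast
  moreover have "?f c' \<le> Max (?f ` ({..<n} - C))" if "c' < n" "c' \<notin> C" for c'
    using that by (intro Max_ge) auto
  ultimately have "?P c" by simp
  then have *: "?P (greedy_pick n B W C)"
    unfolding greedy_pick_def by (rule LeastI)
  then show "greedy_pick n B W C < n" "greedy_pick n B W C \<notin> C"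
    "c < n \<Longrightarrow> c \<notin> C \<Longrightarrow> ?f c \<le> ?f (greedy_pick n B W C)" for c by auto
qed

lemma greedy_subset_card:
  assumes "t \<le> n"
  shows "greedy n B W t \<subseteq> {..<n} \<and> card (greedy n B W t) = t"
  using assms
proof (induction t)
  case (Suc t)
  then have IH: "greedy n B W t \<subseteq> {..<n}" "card (greedy n B W t) = t" by auto
  then have "finite (greedy n B W t)" using finite_subset by blast
  with IH Suc.prems greedy_pick(1,2)[OF IH(1), of B W] show ?case by auto
qed auto

text \<open>The invariant charges every greedy center to one optimal ball: a ball it meets, which its
  wide ball then swallows, or else an arbitrary one, which has no more uncovered points.\<close>

lemma greedy_covers_invariant:
  assumes fin: "\<And>c. c < n \<Longrightarrow> finite (W c)"
    and sub: "\<And>c. c < n \<Longrightarrow> B c \<subseteq> W c"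
    and absorb: "\<And>c o'. c < n \<Longrightarrow> o' \<in> Opt \<Longrightarrow> B c \<inter> B o' \<noteq> {} \<Longrightarrow> B o' \<subseteq> W c"
    and O: "Opt \<subseteq> {..<n}" and l: "card Opt = l" "t \<le> l"
  shows "\<exists>S\<subseteq>Opt. card S \<le> l - t \<and>
    card (covers B Opt) \<le> card (covers W (greedy n B W t) \<union> covers B S)"
  using l(2)
proof (induction t)
  case 0
  then show ?case using l by (auto simp: covers_def)
next
  case (Suc t)
  let ?C = "greedy n B W t"
  let ?M = "covers W ?C"
  let ?c = "greedy_pick n B W ?C"
  have "l \<le> n" using O l card_mono[OF _ O] by simp
  then have C: "?C \<subseteq> {..<n}" "card ?C < n" 
    using greedy_subset_card[of t n B W] Suc.prems by auto
  note pick = greedy_pick(1,2)[OF C, of B W] greedy_pick(3)[OF C, of _ B W]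
  from Suc obtain S where S: "S \<subseteq> Opt" "card S \<le> l - t"
    "card (covers B Opt) \<le> card (?M \<union> covers B S)" by auto
  have M': "covers W (greedy n B W (Suc t)) = W ?c \<union> ?M"
    by (auto simp: covers_def)
  have finC: "finite ?C" by (rule finite_subset[OF C(1)]) simp
  have finS: "finite S" by (rule finite_subset[of _ "{..<n}"]) (use S(1) O in auto)
  have finM: "finite ?M"
    unfolding covers_def using finC C by (intro finite_UN_I fin) auto
  have finB: "finite (B c)" if "c < n" for c by (rule finite_subset[OF sub[OF that] fin[OF that]])
  have finBS: "finite (covers B S)"
    unfolding covers_def using finS S(1) O by (intro finite_UN_I finB) auto
  note finW = fin[OF pick(1)]
  have finBS': "finite (covers B (S - X))" for X
    using finite_subset[of "covers B (S - X)" "covers B S"] finBS by (auto simp: covers_def)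
  show ?case
  proof (cases "S = {}")
    case True
    then have "card (?M \<union> covers B S) \<le> card (W ?c \<union> ?M \<union> covers B S)"
      using finM finW True by (intro card_mono) (auto simp: covers_def)
    then show ?thesis using True S M' by (intro exI[of _ "{}"]) auto
  next
    case False
    consider o' where "o' \<in> S" "(B ?c - ?M) \<inter> B o' \<noteq> {}"
      | "\<forall>o'\<in>S. (B ?c - ?M) \<inter> B o' = {}" by blast
    then show ?thesis
    proof cases
      case 1
      then have "B o' \<subseteq> W ?c" using absorb[of ?c o'] pick S by blast
      then have "?M \<union> covers B S \<subseteq> W ?c \<union> ?M \<union> covers B (S - {o'})"
        by (auto simp: covers_def)
      then have "card (?M \<union> covers B S) \<le> card (W ?c \<union> ?M \<union> covers B (S - {o'}))"
        using finM finW finBS' by (intro card_mono) (auto simp: covers_def)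
      moreover have "card (S - {o'}) \<le> l - Suc t"
        using 1 S finS Suc.prems by (simp add: card_Diff_singleton)
      ultimately show ?thesis using S M' by (intro exI[of _ "S - {o'}"]) auto
    next
      case 2
      from False obtain o' where o': "o' \<in> S" by blast
      let ?S = "S - {o'}"
      have on: "o' < n" using o' S O by auto
      have "card (B o' - ?M) \<le> card (B ?c - ?M)"
      \<comment> \<open>Maximality of the pick concerns unchosen points only. A chosen
        \<open>o'\<close> has no uncovered point in its ball, which lies inside its own wide
        ball.\<close>
      proof (cases "o' \<in> ?C")
        case True
        then have "B o' - ?M = {}" using sub[OF on] by (auto simp: covers_def)
        then show ?thesis by (simp only: card.empty)
      qed (use pick on in auto)
      moreover have "card (?M \<union> covers B S) \<le> card (?M \<union> covers B ?S) + card (B o' - ?M)"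
      proof -
        have "?M \<union> covers B S = (?M \<union> covers B ?S) \<union> (B o' - ?M)"
          using o' by (auto simp: covers_def)
        then show ?thesis by (metis card_Un_le)
      qed
      \<comment> \<open>The new points of \<open>B ?c\<close> avoid every ball of \<open>S\<close>
        in this case, so they count in full and make up for giving up \<open>o'\<close>.\<close>
      moreover have "card (?M \<union> covers B ?S) + card (B ?c - ?M)
          = card ((?M \<union> covers B ?S) \<union> (B ?c - ?M))"
        using 2 finM finBS' finB[OF pick(1)]
        by (intro card_Un_disjoint[symmetric]) (auto simp: covers_def)
      moreover have "\<dots> \<le> card (W ?c \<union> ?M \<union> covers B ?S)"
        using finM finW finBS' sub[OF pick(1)]
        by (intro card_mono) (auto simp: covers_def)
      moreover have "card ?S \<le> l - Suc t"
        using o' S finS Suc.prems by (simp add: card_Diff_singleton)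
      ultimately show ?thesis using S M' by (intro exI[of _ ?S]) auto
    qed
  qed
qed

lemma greedy_covers:
  assumes "\<And>c. c < n \<Longrightarrow> finite (W c)"
    and "\<And>c. c < n \<Longrightarrow> B c \<subseteq> W c"
    and "\<And>c o'. c < n \<Longrightarrow> o' \<in> Opt \<Longrightarrow> B c \<inter> B o' \<noteq> {} \<Longrightarrow> B o' \<subseteq> W c"
    and "Opt \<subseteq> {..<n}"
  shows "card (covers B Opt) \<le> card (covers W (greedy n B W (card Opt)))"
proof -
  have "\<exists>S\<subseteq>Opt. card S \<le> card Opt - card Opt \<and>
    card (covers B Opt) \<le> card (covers W (greedy n B W (card Opt)) \<union> covers B S)"
    by (rule greedy_covers_invariant[where n = n]) (fact assms refl le_refl)+
  then obtain S where "S \<subseteq> Opt" "card S \<le> 0"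
    "card (covers B Opt) \<le> card (covers W (greedy n B W (card Opt)) \<union> covers B S)"
    unfolding diff_self_eq_0 by blast
  moreover from this have "S = {}"
    using assms(4) by (metis bot_nat_0.extremum_uniqueI card_0_eq finite_lessThan finite_subset)
  ultimately show ?thesis by (simp add: covers_def)
qed

section \<open>Balls in an approximate metric and the loss in the radius\<close>

definition near :: "nat \<Rightarrow> (nat \<Rightarrow> nat \<Rightarrow> nat) \<Rightarrow> nat \<Rightarrow> nat \<Rightarrow> nat set" where
  "near n E \<rho> c = {q. q < n \<and> E c q < \<rho>}"

text \<open>The factor \<open>3 (16 k + 1) / (16 k - 1) = 3 (1 + \<delta>) / (1 - \<delta>)\<close> with \<open>\<delta> = 1 / (16 k)\<close> is what the
  triangle inequality costs when distances are known up to \<open>1 \<plusminus> \<delta>\<close> only. Since \<open>near\<close> is strict,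
  radius \<open>\<rho>\<close> there is radius \<open>\<rho> - 1\<close> here.\<close>

definition wide :: "nat \<Rightarrow> nat \<Rightarrow> (nat \<Rightarrow> nat \<Rightarrow> nat) \<Rightarrow> nat \<Rightarrow> nat \<Rightarrow> nat set" where
  "wide n k E \<rho> c = {q. q < n \<and> E c q * (16 * k - 1) \<le> 3 * (16 * k + 1) * (\<rho> - 1)}"

abbreviation chosen :: "nat \<Rightarrow> nat \<Rightarrow> (nat \<Rightarrow> nat \<Rightarrow> nat) \<Rightarrow> nat \<Rightarrow> nat \<Rightarrow> nat set" where
  "chosen n k E \<rho> t \<equiv> greedy n (near n E \<rho>) (wide n k E \<rho>) t"

definition covered_num :: "nat \<Rightarrow> nat \<Rightarrow> (nat \<Rightarrow> nat \<Rightarrow> nat) \<Rightarrow> nat \<Rightarrow> nat \<Rightarrow> nat" where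
  "covered_num n k E l \<rho> = card (covers (wide n k E \<rho>) (chosen n k E \<rho> l))"

text \<open>Let the near balls of \<open>c\<close> and \<open>o'\<close> meet in \<open>x\<close>. A
  point near \<open>o'\<close> is reached from \<open>c\<close> via \<open>x\<close> and
  \<open>o'\<close>; with \<open>K = 16 k\<close>, each of the three legs has true length at most
  \<open>(\<rho> - 1) K / (K - 1)\<close>. Returning to estimates costs \<open>(K + 1) / K\<close>.
  The product is the factor in \<open>wide\<close>, so the absorption premise of
  \<open>greedy_covers\<close> holds.\<close>

lemma chosen_success:
  fixes H :: "nat \<Rightarrow> nat \<Rightarrow> real"
  assumes approx: "\<And>p q. p < n \<Longrightarrow> q < n \<Longrightarrow>
      \<bar>real (E p q) - H p q\<bar> * (16 * real k) \<le> H p q"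
    and sym: "\<And>p q. H p q = H q p"
    and tri: "\<And>p q s. p < n \<Longrightarrow> q < n \<Longrightarrow> s < n \<Longrightarrow> H p s \<le> H p q + H q s"
    and k: "k \<ge> 1"
    and O: "Opt \<subseteq> {..<n}"
  shows "card (covers (near n E \<rho>) Opt) \<le> covered_num n k E (card Opt) \<rho>"
  unfolding covered_num_def
proof (rule greedy_covers)
  show "near n E \<rho> c \<subseteq> wide n k E \<rho> c" for c
  proof
    fix q assume q: "q \<in> near n E \<rho> c"
    then have "E c q \<le> \<rho> - 1" by (auto simp: near_def)
    then have "E c q * (16 * k - 1) \<le> (\<rho> - 1) * (3 * (16 * k + 1))"
      by (intro mult_mono) auto
    then show "q \<in> wide n k E \<rho> c" using q by (simp add: near_def wide_def mult.commute)
  qed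
next
  fix c o' assume c: "c < n" and o': "o' \<in> Opt" and ne: "near n E \<rho> c \<inter> near n E \<rho> o' \<noteq> {}"
  then obtain x where x: "x < n" "E c x < \<rho>" "E o' x < \<rho>" by (auto simp: near_def)
  have on: "o' < n" using o' O by auto
  define K where "K = 16 * real k"
  have K: "K \<ge> 16" using k by (simp add: K_def)
  have up: "real (E p q) * K \<le> (K + 1) * H p q" if "p < n" "q < n" for p q
  proof -
    have "(real (E p q) - H p q) * K \<le> \<bar>real (E p q) - H p q\<bar> * K"
      using K by (intro mult_right_mono) auto
    also have "\<dots> \<le> H p q" using approx[OF that] by (simp add: K_def)
    finally show ?thesis by (simp add: algebra_simps)
  qed
  have low: "(K - 1) * H p q \<le> real (E p q) * K" if "p < n" "q < n" for p q
  proof -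
    have "(H p q - real (E p q)) * K \<le> \<bar>real (E p q) - H p q\<bar> * K"
      using K by (intro mult_right_mono) auto
    also have "\<dots> \<le> H p q" using approx[OF that] by (simp add: K_def)
    finally show ?thesis by (simp add: algebra_simps)
  qed
  show "near n E \<rho> o' \<subseteq> wide n k E \<rho> c"
  proof
    fix q assume "q \<in> near n E \<rho> o'"
    then have q: "q < n" "E o' q < \<rho>" by (auto simp: near_def)
    have *: "(K - 1) * H p s \<le> (real \<rho> - 1) * K" if "p < n" "s < n" "E p s < \<rho>" for p s
    proof -
      have "real (E p s) \<le> real \<rho> - 1" using that(3) by linarith
      then have "real (E p s) * K \<le> (real \<rho> - 1) * K" using K by (intro mult_right_mono) auto
      with low[OF that(1,2)] show ?thesis by linarith
    qed
    have "H c q \<le> H c x + H o' x + H o' q"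
      using tri[OF c x(1) q(1)] tri[OF x(1) on q(1)] sym[of x o'] by simp
    then have "(K - 1) * H c q \<le> (K - 1) * (H c x + H o' x + H o' q)"
      using K by (intro mult_left_mono) auto
    also have "\<dots> \<le> 3 * (real \<rho> - 1) * K"
      using *[OF c x(1,2)] *[OF on x(1,3)] *[OF on q] by (simp add: algebra_simps)
    finally have A: "(K - 1) * H c q \<le> 3 * (real \<rho> - 1) * K" .
    have "real (E c q) * K * (K - 1) \<le> (K + 1) * H c q * (K - 1)"
      using up[OF c q(1)] K by (intro mult_right_mono) auto
    also have "\<dots> = (K + 1) * ((K - 1) * H c q)" by simp
    also have "\<dots> \<le> (K + 1) * (3 * (real \<rho> - 1) * K)"
      using A K by (intro mult_left_mono) auto
    finally have "(real (E c q) * (K - 1)) * K \<le> (3 * (K + 1) * (real \<rho> - 1)) * K"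
      by (simp add: algebra_simps)
    then have "real (E c q) * (K - 1) \<le> 3 * (K + 1) * (real \<rho> - 1)"
      using K by (subst (asm) mult_le_cancel_right) auto
    also have "K - 1 = real (16 * k - 1)" using k by (simp add: K_def of_nat_diff)
    also have "K + 1 = real (16 * k + 1)" by (simp add: K_def)
    also have "real \<rho> - 1 = real (\<rho> - 1)" using q by (simp add: of_nat_diff)
    finally have "real (E c q * (16 * k - 1)) \<le> real (3 * (16 * k + 1) * (\<rho> - 1))" by simp
    then show "q \<in> wide n k E \<rho> c" using q unfolding of_nat_le_iff by (simp add: wide_def)
  qed
qed (use O in \<open>auto simp: wide_def\<close>)

text \<open>Three losses multiply, with \<open>K = 16 k\<close>: \<open>K / (K - 1)\<close> from
  estimate to true distance, \<open>3 (K + 1) / (K - 1)\<close> from \<open>wide\<close>, and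
  \<open>(K + 1) / K\<close> from the radius \<open>a\<close> to \<open>r\<close>.\<close>

lemma wide_radius:
  fixes h r eps :: real
  assumes approx: "\<bar>real e - h\<bar> * (16 * real k) \<le> h" and h: "0 \<le> h"
    and e: "e * (16 * k - 1) \<le> 3 * (16 * k + 1) * a"
    and a: "real a * (16 * real k) \<le> (16 * real k + 1) * r"
    and k: "k \<ge> 2" "1 / real k \<le> eps" and r: "0 \<le> r"
  shows "h \<le> (3 + eps) * r"
proof -
  define K where "K = 16 * real k"
  have K: "K \<ge> 32" using k by (simp add: K_def)
  have "(h - real e) * K \<le> \<bar>real e - h\<bar> * K" using K by (intro mult_right_mono) auto
  also have "\<dots> \<le> h" using approx by (simp add: K_def)
  finally have low: "(K - 1) * h \<le> real e * K" by (simp add: algebra_simps)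
  have "real (e * (16 * k - 1)) \<le> real (3 * (16 * k + 1) * a)" using e of_nat_le_iff by blast
  then have e': "real e * (K - 1) \<le> 3 * (K + 1) * real a"
    using k by (simp add: K_def of_nat_diff algebra_simps)
  have "(K - 1)^2 * h \<le> (K - 1) * (real e * K)"
    using mult_left_mono[OF low, of "K - 1"] K by (simp add: power2_eq_square mult.assoc)
  also have "\<dots> = (real e * (K - 1)) * K" by simp
  also have "\<dots> \<le> (3 * (K + 1) * real a) * K" using e' K by (intro mult_right_mono) auto
  also have "\<dots> = 3 * (K + 1) * (real a * K)" by simp
  also have "\<dots> \<le> 3 * (K + 1) * ((K + 1) * r)"
    using a K by (intro mult_left_mono) (auto simp: K_def)
  finally have 1: "(K - 1)^2 * h \<le> 3 * (K + 1)^2 * r" by (simp add: power2_eq_square algebra_simps)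
  \<comment> \<open>Multiplied by \<open>K\<close> this says
    \<open>12 K^2 \<le> 16 (K - 1)^2\<close>, which holds as \<open>K \<ge> 32\<close>. The number
    16 in \<open>\<delta> = 1 / (16 k)\<close> makes the excess \<open>16 / K\<close> equal to
    \<open>1 / k\<close>.\<close>
  have "3 * (K + 1)^2 \<le> (3 + 16 / K) * (K - 1)^2"
  proof -
    have "0 \<le> 4 * K * K - 32 * K + 16" using mult_right_mono[of 32 K K] K by simp
    then have "3 * (K + 1)^2 * K \<le> (3 * K + 16) * (K - 1)^2"
      by (simp add: power2_eq_square algebra_simps)
    then show ?thesis using K by (simp add: field_simps)
  qed
  also have "16 / K \<le> eps" using k by (simp add: K_def)
  finally have "3 * (K + 1)^2 \<le> (3 + eps) * (K - 1)^2" by (simp add: mult_right_mono)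
  then have "3 * (K + 1)^2 * r \<le> (3 + eps) * (K - 1)^2 * r" using r by (intro mult_right_mono)
  with 1 have "(K - 1)^2 * h \<le> (K - 1)^2 * ((3 + eps) * r)" by (simp add: algebra_simps)
  then show ?thesis using K by (subst (asm) mult_le_cancel_left_pos) auto
qed

section \<open>The Hamming distance as a metric\<close>

lemma ham_sym: "length a = length b \<Longrightarrow> ham a b = ham b a"
  unfolding ham_def by (rule arg_cong[of _ _ card]) auto

lemma ham_triangle:
  assumes "length a = length b" "length b = length c"
  shows "ham a c \<le> ham a b + ham b c"
proof -
  have "{i. i < length a \<and> a ! i \<noteq> c ! i} \<subseteq>
    {i. i < length a \<and> a ! i \<noteq> b ! i} \<union> {i. i < length b \<and> b ! i \<noteq> c ! i}"
    using assms by auto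
  then have "ham a c \<le> card ({i. i < length a \<and> a ! i \<noteq> b ! i} \<union> {i. i < length b \<and> b ! i \<noteq> c ! i})"
    unfolding ham_def by (intro card_mono) auto
  also have "\<dots> \<le> ham a b + ham b c" unfolding ham_def by (rule card_Un_le)
  finally show ?thesis .
qed

section \<open>Concentration of count sketches\<close>

lemma finite_set_pmf_fill: "finite (set_pmf (fill w a N f))"
  by (induction N) (auto simp: set_pmf_of_set lessThan_empty_iff)

lemma fill_outside: "g \<in> set_pmf (fill w a N f) \<Longrightarrow> i < a \<or> a + N \<le> i \<Longrightarrow> g i = f i"
  by (induction N arbitrary: g) auto

lemma expectation_bind_finite:
  fixes h :: "_ \<Rightarrow> real"
  assumes "finite (set_pmf p)" "\<And>x. x \<in> set_pmf p \<Longrightarrow> finite (set_pmf (q x))"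
  shows "measure_pmf.expectation (bind_pmf p q) h =
    measure_pmf.expectation p (\<lambda>x. measure_pmf.expectation (q x) h)"
  using assms
  by (subst pmf_expectation_bind[of "set_pmf p"])
    (auto simp: integral_measure_pmf[of "set_pmf p"])

lemma expectation_mono_finite:
  fixes h h' :: "_ \<Rightarrow> real"
  assumes "finite (set_pmf p)" "\<And>x. x \<in> set_pmf p \<Longrightarrow> h x \<le> h' x"
  shows "measure_pmf.expectation p h \<le> measure_pmf.expectation p h'"
  using assms by (intro integral_mono_AE integrable_measure_pmf_finite) (auto simp: AE_measure_pmf_iff)

lemma expectation_cong_pmf:
  fixes h h' :: "_ \<Rightarrow> real"
  assumes "\<And>x. x \<in> set_pmf p \<Longrightarrow> h x = h' x"
  shows "measure_pmf.expectation p h = measure_pmf.expectation p h'"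
  using assms by (intro integral_cong_AE) (auto simp: AE_measure_pmf_iff)

text \<open>As \<open>M\<close> divides the number of words, the words form full periods modulo
  \<open>M\<close> and reduction causes no bias. This is why the number of hash values is a power of
  two.\<close>

lemma expectation_uniform_mod:
  fixes \<phi> :: "nat \<Rightarrow> real"
  assumes "M dvd 2 ^ w"
  shows "measure_pmf.expectation (pmf_of_set {..<2 ^ w}) (\<lambda>v. \<phi> (v mod M)) = (\<Sum>u<M. \<phi> u) / M"
proof -
  from assms obtain q where q: "2 ^ w = q * M" by (metis dvdE mult.commute)
  have pos: "q > 0" "M > 0" using q by (metis mult_eq_0_iff neq0_conv power_not_zero zero_neq_numeral)+
  have "(\<Sum>v<q * M. \<phi> (v mod M)) = (\<Sum>j<q. \<Sum>v = j * M..<j * M + M. \<phi> (v mod M))"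
    by (rule sum.nat_group[symmetric])
  also have "\<dots> = (\<Sum>j<q. \<Sum>u<M. \<phi> u)"
  proof (rule sum.cong[OF refl])
    fix j
    have "(\<Sum>v = 0 + j * M..<M + j * M. \<phi> (v mod M)) = (\<Sum>u = 0..<M. \<phi> ((u + j * M) mod M))"
      by (rule sum.shift_bounds_nat_ivl)
    then show "(\<Sum>v = j * M..<j * M + M. \<phi> (v mod M)) = (\<Sum>u<M. \<phi> u)"
      by (simp add: add.commute atLeast0LessThan)
  qed
  finally have "(\<Sum>v<q * M. \<phi> (v mod M)) = q * (\<Sum>u<M. \<phi> u)" by simp
  moreover have "{..<2 ^ w :: nat} \<noteq> {}" "card {..<2 ^ w :: nat} = q * M" using pos q by (auto simp: lessThan_empty_iff)
  ultimately show ?thesis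
    using pos by (subst integral_pmf_of_set) (auto simp: q)
qed

text \<open>Buckets \<open>b\<close> and \<open>b + m\<close> form a pair: a coordinate hashed to the former counts positively
  and one hashed to the latter negatively. So one hash value in \<open>{..<2 * m}\<close> encodes both the
  bucket and the random sign of a count sketch with \<open>m\<close> buckets.\<close>

definition bucket_sign :: "nat \<Rightarrow> nat \<Rightarrow> nat \<Rightarrow> real" where
  "bucket_sign m b u = of_bool (u = b) - of_bool (u = b + m)"

definition bucket_sum :: "nat \<Rightarrow> (nat \<Rightarrow> real) \<Rightarrow> (nat \<Rightarrow> nat) \<Rightarrow> nat \<Rightarrow> nat \<Rightarrow> nat \<Rightarrow> real" where
  "bucket_sum m x g a N b = (\<Sum>i<N. x i * bucket_sign m b (g (a + i) mod (2 * m)))"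

definition sketch_sq :: "nat \<Rightarrow> (nat \<Rightarrow> real) \<Rightarrow> (nat \<Rightarrow> nat) \<Rightarrow> nat \<Rightarrow> nat \<Rightarrow> real" where
  "sketch_sq m x g a N = (\<Sum>b<m. (bucket_sum m x g a N b)\<^sup>2)"

lemma sum_bucket_sign:
  fixes D :: "nat \<Rightarrow> real"
  assumes "u < 2 * m"
  shows "(\<Sum>b<m. D b * bucket_sign m b u) = (if u < m then D u else - D (u - m))"
proof (cases "u < m")
  case True
  have "(\<Sum>b<m. D b * bucket_sign m b u) = (\<Sum>b<m. if u = b then D b else 0)"
    using True by (intro sum.cong) (auto simp: bucket_sign_def)
  then show ?thesis using True by simp
next
  case False
  have "(\<Sum>b<m. D b * bucket_sign m b u) = (\<Sum>b<m. if u - m = b then - D b else 0)"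
    using False by (intro sum.cong) (auto simp: bucket_sign_def)
  then show ?thesis using False assms by simp
qed

text \<open>A hash value hits exactly one pair, so the square of a coordinate enters the sketch
  without randomness; only cross terms fluctuate.\<close>

lemma sum_bucket_sign_sq:
  assumes "u < 2 * m"
  shows "(\<Sum>b<m. (bucket_sign m b u)\<^sup>2) = 1"
proof -
  have "(\<Sum>b<m. (bucket_sign m b u)\<^sup>2) = (\<Sum>b<m. if (if u < m then u else u - m) = b then 1 else 0)"
    using assms by (intro sum.cong) (auto simp: bucket_sign_def)
  then show ?thesis using assms by auto
qed

lemma sum_lessThan_double:
  fixes m :: nat
  shows "(\<Sum>u<2 * m. \<phi> u :: real) = (\<Sum>b<m. \<phi> b + \<phi> (b + m))"
proof -
  have "(\<Sum>u<2 * m. \<phi> u) = (\<Sum>u = 0..<m. \<phi> u) + (\<Sum>u = m..<2 * m. \<phi> u)"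
    using sum.atLeastLessThan_concat[of 0 m "2 * m" \<phi>] by (simp add: atLeast0LessThan)
  also have "(\<Sum>u = m..<2 * m. \<phi> u) = (\<Sum>b = 0..<m. \<phi> (b + m))"
    using sum.shift_bounds_nat_ivl[of \<phi> 0 m m] by (simp add: mult_2)
  finally show ?thesis by (simp add: sum.distrib atLeast0LessThan)
qed

lemma bucket_sum_cong:
  "(\<And>i. i < N \<Longrightarrow> g (a + i) = g' (a + i)) \<Longrightarrow> bucket_sum m x g a N b = bucket_sum m x g' a N b"
  unfolding bucket_sum_def by (intro sum.cong) auto

lemma sketch_sq_cong:
  "(\<And>i. i < N \<Longrightarrow> g (a + i) = g' (a + i)) \<Longrightarrow> sketch_sq m x g a N = sketch_sq m x g' a N"
  unfolding sketch_sq_def by (intro sum.cong arg_cong[where f = "\<lambda>x. x\<^sup>2"] bucket_sum_cong) auto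

text \<open>The signed content of the pair hit by \<open>u\<close>, which is the coefficient of the
  cross term when a coordinate is added.\<close>

definition bucket_step :: "nat \<Rightarrow> (nat \<Rightarrow> real) \<Rightarrow> (nat \<Rightarrow> nat) \<Rightarrow> nat \<Rightarrow> nat \<Rightarrow> nat \<Rightarrow> real" where
  "bucket_step m x g a N u = (\<Sum>b<m. bucket_sum m x g a N b * bucket_sign m b u)"

lemma sketch_sq_Suc:
  assumes "m > 0"
  shows "sketch_sq m x (g(a + N := v)) a (Suc N) =
    sketch_sq m x g a N + 2 * x N * bucket_step m x g a N (v mod (2 * m)) + (x N)\<^sup>2"
proof -
  let ?u = "v mod (2 * m)"
  have u: "?u < 2 * m" using assms by simp
  have eq: "bucket_sum m x (g(a + N := v)) a N b = bucket_sum m x g a N b" for b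
    by (rule bucket_sum_cong) auto
  have "bucket_sum m x (g(a + N := v)) a (Suc N) b =
      bucket_sum m x g a N b + x N * bucket_sign m b ?u" for b
    using eq[of b] by (simp add: bucket_sum_def)
  then have "sketch_sq m x (g(a + N := v)) a (Suc N) =
      (\<Sum>b<m. (bucket_sum m x g a N b + x N * bucket_sign m b ?u)\<^sup>2)"
    by (simp add: sketch_sq_def)
  also have "\<dots> = (\<Sum>b<m. (bucket_sum m x g a N b)\<^sup>2
      + 2 * x N * (bucket_sum m x g a N b * bucket_sign m b ?u) + (x N)\<^sup>2 * (bucket_sign m b ?u)\<^sup>2)"
    by (intro sum.cong) (auto simp: power2_eq_square algebra_simps)
  also have "\<dots> = sketch_sq m x g a N + 2 * x N * bucket_step m x g a N ?u
      + (x N)\<^sup>2 * (\<Sum>b<m. (bucket_sign m b ?u)\<^sup>2)"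
    by (simp add: sum.distrib sum_distrib_left sketch_sq_def bucket_step_def)
  finally show ?thesis using sum_bucket_sign_sq[OF u] by simp
qed

text \<open>The two hash values of a pair give opposite values: they cancel in the first sum, and
  every squared bucket appears twice in the second.\<close>

lemma bucket_step_moments:
  "(\<Sum>u<2 * m. bucket_step m x g a N u) = 0"
  "(\<Sum>u<2 * m. (bucket_step m x g a N u)\<^sup>2) = 2 * sketch_sq m x g a N"
proof -
  have W: "bucket_step m x g a N u =
      (if u < m then bucket_sum m x g a N u else - bucket_sum m x g a N (u - m))" if "u < 2 * m" for u
    unfolding bucket_step_def using that by (rule sum_bucket_sign)
  show "(\<Sum>u<2 * m. bucket_step m x g a N u) = 0"
    unfolding sum_lessThan_double using W by (intro sum.neutral) auto
  have "(\<Sum>u<2 * m. (bucket_step m x g a N u)\<^sup>2) = (\<Sum>b<m. 2 * (bucket_sum m x g a N b)\<^sup>2)"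
    unfolding sum_lessThan_double using W by (intro sum.cong) auto
  then show "(\<Sum>u<2 * m. (bucket_step m x g a N u)\<^sup>2) = 2 * sketch_sq m x g a N"
    by (simp add: sketch_sq_def sum_distrib_left)
qed

text \<open>Adding \<open>x N\<close> changes the sketch by \<open>(x N)^2\<close> plus a cross term
  of conditional mean 0 and conditional second moment \<open>4 (x N)^2 / m\<close> times the sketch
  so far. The second moment of the error thus grows by \<open>4 (x N)^2 H / m\<close>, while the
  bound \<open>2 H^2 / m\<close> grows by at least as much.\<close>

lemma sketch_moments:
  fixes x :: "nat \<Rightarrow> real"
  assumes m: "m > 0" "2 * m dvd 2 ^ w" and x: "\<And>i. i < N \<Longrightarrow> x i \<in> {-1, 0, 1}"
  defines "H \<equiv> \<lambda>N. \<Sum>i<N. (x i)\<^sup>2"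
  shows "measure_pmf.expectation (fill w a N f) (\<lambda>g. sketch_sq m x g a N) = H N \<and>
    measure_pmf.expectation (fill w a N f) (\<lambda>g. (sketch_sq m x g a N - H N)\<^sup>2) \<le> 2 * (H N)\<^sup>2 / m"
  using x
proof (induction N)
  case 0
  show ?case by (simp add: H_def sketch_sq_def bucket_sum_def)
next
  case (Suc N)
  let ?U = "pmf_of_set {..<2 ^ w :: nat}"
  let ?P = "fill w a N f"
  let ?Y = "\<lambda>g. sketch_sq m x g a N - H N"
  have IH1: "measure_pmf.expectation ?P (\<lambda>g. sketch_sq m x g a N) = H N"
    and IH2: "measure_pmf.expectation ?P (\<lambda>g. (?Y g)\<^sup>2) \<le> 2 * (H N)\<^sup>2 / m"
    using Suc by auto
  have finU: "finite (set_pmf ?U)" by (simp add: set_pmf_of_set lessThan_empty_iff)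
  have int: "integrable (measure_pmf ?P) (h :: _ \<Rightarrow> real)" for h
    by (rule integrable_measure_pmf_finite) (rule finite_set_pmf_fill)
  have HS: "H (Suc N) = H N + (x N)\<^sup>2" by (simp add: H_def)
  have exp: "measure_pmf.expectation (fill w a (Suc N) f) h =
      measure_pmf.expectation ?P (\<lambda>g. measure_pmf.expectation ?U (\<lambda>v. h (g(a + N := v))))" for h :: "_ \<Rightarrow> real"
    by (simp add: expectation_bind_finite finite_set_pmf_fill finU)
  \<comment> \<open>Both moments are quadratic polynomials in the step of the fresh word, so this
    one average serves both.\<close>
  have lin: "measure_pmf.expectation ?U (\<lambda>v. \<alpha> + \<beta> * bucket_step m x g a N (v mod (2 * m))
        + \<gamma> * (bucket_step m x g a N (v mod (2 * m)))\<^sup>2) = \<alpha> + \<gamma> * sketch_sq m x g a N / m" for \<alpha> \<beta> \<gamma> g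
  proof -
    have "measure_pmf.expectation ?U (\<lambda>v. \<alpha> + \<beta> * bucket_step m x g a N (v mod (2 * m))
        + \<gamma> * (bucket_step m x g a N (v mod (2 * m)))\<^sup>2) =
      (\<Sum>u<2 * m. \<alpha> + \<beta> * bucket_step m x g a N u + \<gamma> * (bucket_step m x g a N u)\<^sup>2) / (2 * m)"
      using expectation_uniform_mod[OF m(2),
        of "\<lambda>u. \<alpha> + \<beta> * bucket_step m x g a N u + \<gamma> * (bucket_step m x g a N u)\<^sup>2"] by simp
    also have "(\<Sum>u<2 * m. \<alpha> + \<beta> * bucket_step m x g a N u + \<gamma> * (bucket_step m x g a N u)\<^sup>2)
        = 2 * m * \<alpha> + \<gamma> * (2 * sketch_sq m x g a N)"
      using bucket_step_moments[of m x g a N]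
      by (simp add: sum.distrib flip: sum_distrib_left)
    finally show ?thesis using m by (simp add: field_simps)
  qed
  have "measure_pmf.expectation (fill w a (Suc N) f) (\<lambda>g. sketch_sq m x g a (Suc N)) =
     measure_pmf.expectation ?P (\<lambda>g. sketch_sq m x g a N + (x N)\<^sup>2)"
    unfolding exp sketch_sq_Suc[OF m(1)]
    using lin[of "sketch_sq m x g a N + (x N)\<^sup>2" "2 * x N" g 0 for g] by (simp add: algebra_simps)
  then have 1: "measure_pmf.expectation (fill w a (Suc N) f) (\<lambda>g. sketch_sq m x g a (Suc N)) = H (Suc N)"
    using IH1 HS int by simp
  have inner: "measure_pmf.expectation ?U (\<lambda>v. (sketch_sq m x (g(a + N := v)) a (Suc N) - H (Suc N))\<^sup>2) =
     (?Y g)\<^sup>2 + 4 * (x N)\<^sup>2 / m * sketch_sq m x g a N" for g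
  proof -
    have "(sketch_sq m x (g(a + N := v)) a (Suc N) - H (Suc N))\<^sup>2 =
      (?Y g)\<^sup>2 + (4 * x N * ?Y g) * bucket_step m x g a N (v mod (2 * m))
        + (4 * (x N)\<^sup>2) * (bucket_step m x g a N (v mod (2 * m)))\<^sup>2" for v
      unfolding sketch_sq_Suc[OF m(1)] HS by (simp add: power2_eq_square algebra_simps)
    then show ?thesis using lin by simp
  qed
  have "measure_pmf.expectation (fill w a (Suc N) f) (\<lambda>g. (sketch_sq m x g a (Suc N) - H (Suc N))\<^sup>2) =
     measure_pmf.expectation ?P (\<lambda>g. (?Y g)\<^sup>2) + 4 * (x N)\<^sup>2 / m * H N"
    unfolding exp inner using int IH1 by simp
  also have "\<dots> \<le> 2 * (H N)\<^sup>2 / m + 4 * (x N)\<^sup>2 / m * H N"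
    using IH2 by simp
  also have "2 * (H (Suc N))\<^sup>2 / m =
      2 * (H N)\<^sup>2 / m + 4 * (x N)\<^sup>2 / m * H N + 2 * ((x N)\<^sup>2)\<^sup>2 / m"
    unfolding HS by (simp add: power2_sum add_divide_distrib algebra_simps)
  then have "2 * (H N)\<^sup>2 / m + 4 * (x N)\<^sup>2 / m * H N \<le> 2 * (H (Suc N))\<^sup>2 / m"
    by simp
  finally show ?case using 1 by blast
qed

section \<open>Failure of one repetition and of half of the repetitions\<close>

definition sketch_fails :: "nat \<Rightarrow> nat \<Rightarrow> (nat \<Rightarrow> real) \<Rightarrow> (nat \<Rightarrow> nat) \<Rightarrow> nat \<Rightarrow> nat \<Rightarrow> bool" where
  "sketch_fails k m x g a N \<longleftrightarrow>
     \<not> \<bar>sketch_sq m x g a N - (\<Sum>i<N. (x i)\<^sup>2)\<bar> * (16 * real k) \<le> (\<Sum>i<N. (x i)\<^sup>2)"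

text \<open>Chebyshev's inequality, applied pointwise: the weight is at most
  \<open>1 + c Y^2\<close>, where \<open>c Y^2 \<ge> 15\<close> upon failure. The variance bound
  turns this into \<open>1 + 15 * 2 * (16 k)^2 / m\<close>, and
  \<open>15 * 2 * 256 = 7680\<close>.\<close>

lemma sketch_fails_weight:
  fixes x :: "nat \<Rightarrow> real"
  assumes m: "m > 0" "2 * m dvd 2 ^ w" "7680 * k\<^sup>2 \<le> m"
    and x: "\<And>i. i < N \<Longrightarrow> x i \<in> {-1, 0, 1}"
  shows "measure_pmf.expectation (fill w a N f)
    (\<lambda>g. if sketch_fails k m x g a N then 16 else 1) \<le> (2 :: real)"
proof -
  define h where "h = (\<Sum>i<N. (x i)\<^sup>2)"
  define Y where "Y = (\<lambda>g. sketch_sq m x g a N - h)"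
  have "h \<ge> 0" unfolding h_def by (intro sum_nonneg) auto
  have var: "measure_pmf.expectation (fill w a N f) (\<lambda>g. (Y g)\<^sup>2) \<le> 2 * h\<^sup>2 / m"
    using sketch_moments[OF m(1,2) x, where N = N and a = a and f = f] by (simp add: h_def Y_def)
  have int: "integrable (measure_pmf (fill w a N f)) (h :: _ \<Rightarrow> real)" for h
    by (rule integrable_measure_pmf_finite) (rule finite_set_pmf_fill)
  show ?thesis
  \<comment> \<open>For \<open>h = 0\<close> the difference vector vanishes and the sketch is exact;
    \<open>c\<close> below divides by \<open>h^2\<close>.\<close>
  proof (cases "h = 0")
    case True
    then have x0: "x i = 0" if "i < N" for i
      using that unfolding h_def by (subst (asm) sum_nonneg_eq_0_iff) auto
    then have "sketch_sq m x g a N = 0" for g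
      by (auto simp: sketch_sq_def bucket_sum_def)
    then have "\<not> sketch_fails k m x g a N" for g
      using True by (simp add: sketch_fails_def h_def)
    then show ?thesis by simp
  next
    case False
    with \<open>h \<ge> 0\<close> have h: "h > 0" by simp
    define c where "c = 15 * (16 * real k)\<^sup>2 / h\<^sup>2"
    have c: "c \<ge> 0" by (simp add: c_def)
    have "(if sketch_fails k m x g a N then 16 else 1) \<le> 1 + c * (Y g)\<^sup>2" for g
    proof (cases "sketch_fails k m x g a N")
      case True
      then have "h < \<bar>Y g\<bar> * (16 * real k)" by (simp add: sketch_fails_def h_def Y_def)
      then have "h\<^sup>2 \<le> (\<bar>Y g\<bar> * (16 * real k))\<^sup>2" using h by (intro power_mono) auto
      then show ?thesis using True h by (simp add: c_def field_simps power_mult_distrib)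
    qed (use c in auto)
    then have "measure_pmf.expectation (fill w a N f) (\<lambda>g. if sketch_fails k m x g a N then 16 else 1)
        \<le> measure_pmf.expectation (fill w a N f) (\<lambda>g. 1 + c * (Y g)\<^sup>2)"
      by (intro expectation_mono_finite finite_set_pmf_fill)
    also have "\<dots> = 1 + c * measure_pmf.expectation (fill w a N f) (\<lambda>g. (Y g)\<^sup>2)"
      using int by simp
    also have "\<dots> \<le> 1 + c * (2 * h\<^sup>2 / m)" using var c by (intro add_left_mono mult_left_mono)
    also have "\<dots> = 1 + 7680 * (real k)\<^sup>2 / m" using h m by (simp add: c_def field_simps power2_eq_square)
    also have "\<dots> \<le> 2"
    proof -
      have "real (7680 * k\<^sup>2) \<le> real m" using m(3) of_nat_le_iff by blast
      then show ?thesis using m by (simp add: field_simps)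
    qed
    finally show ?thesis .
  qed
qed

lemma sketch_fails_cong:
  "(\<And>i. i < N \<Longrightarrow> g (a + i) = g' (a + i)) \<Longrightarrow> sketch_fails k m x g a N = sketch_fails k m x g' a N"
  unfolding sketch_fails_def by (subst sketch_sq_cong[of N g a g']) auto

text \<open>The repetitions read disjoint blocks of words. The weight of the last block averages to
  at most 2 whatever the earlier blocks contain, so each repetition contributes a factor 2.\<close>

lemma sketch_fails_weight_prod:
  fixes x :: "nat \<Rightarrow> real"
  assumes m: "m > 0" "2 * m dvd 2 ^ w" "7680 * k\<^sup>2 \<le> m"
    and x: "\<And>i. i < d \<Longrightarrow> x i \<in> {-1, 0, 1}"
  shows "measure_pmf.expectation (fill w 0 (R * d) f)
    (\<lambda>g. \<Prod>j<R. if sketch_fails k m x g (j * d) d then 16 else 1) \<le> (2 :: real) ^ R"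
proof (induction R)
  case (Suc R)
  let ?W = "\<lambda>g j. if sketch_fails k m x g (j * d) d then 16 else 1 :: real"
  let ?P = "fill w 0 (R * d) f"
  have "fill w 0 (Suc R * d) f = bind_pmf ?P (fill w (R * d) d)"
    using fill_add[of w 0 "R * d" d f] by (simp add: add.commute)
  then have "measure_pmf.expectation (fill w 0 (Suc R * d) f) (\<lambda>g. \<Prod>j<Suc R. ?W g j) =
     measure_pmf.expectation ?P (\<lambda>g'. measure_pmf.expectation (fill w (R * d) d g') (\<lambda>g. \<Prod>j<Suc R. ?W g j))"
    by (simp only: expectation_bind_finite finite_set_pmf_fill)
  also have "\<dots> = measure_pmf.expectation ?P
      (\<lambda>g'. (\<Prod>j<R. ?W g' j) * measure_pmf.expectation (fill w (R * d) d g') (\<lambda>g. ?W g R))"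
  proof (rule arg_cong[of _ _ "measure_pmf.expectation ?P"], rule ext)
    fix g'
    have "measure_pmf.expectation (fill w (R * d) d g') (\<lambda>g. \<Prod>j<Suc R. ?W g j) =
      measure_pmf.expectation (fill w (R * d) d g') (\<lambda>g. (\<Prod>j<R. ?W g' j) * ?W g R)"
    proof (rule expectation_cong_pmf)
      fix g assume g: "g \<in> set_pmf (fill w (R * d) d g')"
      have "?W g j = ?W g' j" if "j < R" for j
      proof -
        have "j * d + i < R * d" if "i < d" for i
        proof -
          have "j * d + i < Suc j * d" using that by simp
          also have "\<dots> \<le> R * d" using \<open>j < R\<close> by (intro mult_le_mono1) simp
          finally show ?thesis .
        qed
        then have "sketch_fails k m x g (j * d) d = sketch_fails k m x g' (j * d) d"
          using fill_outside[OF g] by (intro sketch_fails_cong) auto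
        then show ?thesis by simp
      qed
      then show "(\<Prod>j<Suc R. ?W g j) = (\<Prod>j<R. ?W g' j) * ?W g R" by simp
    qed
    then show "measure_pmf.expectation (fill w (R * d) d g') (\<lambda>g. \<Prod>j<Suc R. ?W g j) =
      (\<Prod>j<R. ?W g' j) * measure_pmf.expectation (fill w (R * d) d g') (\<lambda>g. ?W g R)" by simp
  qed
  also have "\<dots> \<le> measure_pmf.expectation ?P (\<lambda>g'. (\<Prod>j<R. ?W g' j) * 2)"
    using sketch_fails_weight[OF m x]
    by (intro expectation_mono_finite finite_set_pmf_fill mult_left_mono prod_nonneg) auto
  also have "\<dots> \<le> 2 ^ R * 2" using Suc by simp
  finally show ?case by simp
qed simp

text \<open>Markov's inequality for the product of weights: if half of the repetitions fail, the
  product is at least \<open>16 ^ (R / 2) = 4 ^ R\<close>, against an expectation of at most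
  \<open>2 ^ R\<close>.\<close>

lemma sketch_fails_majority:
  fixes x :: "nat \<Rightarrow> real"
  assumes m: "m > 0" "2 * m dvd 2 ^ w" "7680 * k\<^sup>2 \<le> m"
    and x: "\<And>i. i < d \<Longrightarrow> x i \<in> {-1, 0, 1}"
  shows "measure_pmf.prob (fill w 0 (R * d) f)
    {g. R \<le> 2 * card {j. j < R \<and> sketch_fails k m x g (j * d) d}} \<le> 1 / 2 ^ R"
    (is "measure_pmf.prob ?P ?A \<le> _")
proof -
  let ?W = "\<lambda>g. \<Prod>j<R. if sketch_fails k m x g (j * d) d then 16 else 1 :: real"
  have W: "?W g = 16 ^ card {j. j < R \<and> sketch_fails k m x g (j * d) d}" for g
    by (subst prod.inter_filter[symmetric]) (auto intro!: arg_cong[of _ _ card])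
  have "measure_pmf.prob ?P ?A = measure_pmf.expectation ?P (indicator ?A)" by simp
  also have "\<dots> \<le> measure_pmf.expectation ?P (\<lambda>g. ?W g / 4 ^ R)"
  proof (intro expectation_mono_finite finite_set_pmf_fill)
    fix g
    show "indicator ?A g \<le> ?W g / 4 ^ R"
    proof (cases "g \<in> ?A")
      case True
      then have "(4::real) ^ R \<le> 4 ^ (2 * card {j. j < R \<and> sketch_fails k m x g (j * d) d})"
        by (intro power_increasing) auto
      also have "\<dots> = ?W g" unfolding W by (simp add: power_mult)
      finally show ?thesis using True by (simp add: field_simps)
    qed (simp add: prod_nonneg)
  qed
  also have "\<dots> \<le> 2 ^ R / 4 ^ R"
    using sketch_fails_weight_prod[OF m x, where R = R and f = f] by (simp add: divide_right_mono)
  also have "\<dots> = 1 / 2 ^ R" by (simp add: field_simps flip: power_mult_distrib)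
  finally show ?thesis .
qed

section \<open>Sketches\<close>

abbreviation plus_expr (infixl "\<^bold>+" 65) where "a \<^bold>+ b \<equiv> Bin Plus a b"
abbreviation monus_expr (infixl "\<^bold>-" 65) where "a \<^bold>- b \<equiv> Bin Monus a b"
abbreviation times_expr (infixl "\<^bold>*" 70) where "a \<^bold>* b \<equiv> Bin Times a b"
abbreviation div_expr (infixl "\<^bold>div" 70) where "a \<^bold>div b \<equiv> Bin Div a b"
abbreviation mod_expr (infixl "\<^bold>mod" 70) where "a \<^bold>mod b \<equiv> Bin Mod a b"
abbreviation less_expr (infix "\<^bold><" 50) where "a \<^bold>< b \<equiv> Bin Less a b"

text \<open>
  Registers 5 to 8 hold \<open>2 * m\<close>, \<open>m\<close>, the number \<open>R\<close> of repetitions and the power of two \<open>G\<close> at which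
  the search starts. Array 2 holds the random words, array 3 the sketches (that of point \<open>p\<close> in
  repetition \<open>j\<close> is row \<open>j * n + p\<close>), array 4 the estimates of one distance, array 5 the distance
  matrix, array 6 the covered and array 7 the chosen points. Registers from 9 on are scratch,
  except that 22, 23 and 24 hold the lower end, the width and the current radius of the search.
\<close>

definition sketch_prog :: "instr list" where
  "sketch_prog =
     for_loop 10 (Reg 7 \<^bold>* Reg 0)
       (for_loop 12 (Reg 1)
         [SetReg 14 (Reg 10 \<^bold>* Reg 5 \<^bold>+ Arr 2 ((Reg 10 \<^bold>div Reg 0) \<^bold>* Reg 1 \<^bold>+ Reg 12) \<^bold>mod Reg 5),
          SetArr 3 (Reg 14) (Arr 3 (Reg 14) \<^bold>+ Arr 0 ((Reg 10 \<^bold>mod Reg 0) \<^bold>* Reg 1 \<^bold>+ Reg 12))])"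

definition cell_expr :: "expr \<Rightarrow> expr \<Rightarrow> expr" where
  "cell_expr p b = Arr 3 ((Reg 11 \<^bold>* Reg 0 \<^bold>+ p) \<^bold>* Reg 5 \<^bold>+ b)"

text \<open>A bucket of the difference of two points is a combination of counts with both signs.
  Moving the subtracted counts to the other side leaves two nonnegative sums, and truncated
  subtraction both ways gives their absolute difference.\<close>

definition est_prog :: "instr list" where
  "est_prog =
     SetReg 15 (Const 0) #
     for_loop 12 (Reg 6)
       [SetReg 13 (cell_expr (Reg 10 \<^bold>div Reg 0) (Reg 12) \<^bold>+ cell_expr (Reg 10 \<^bold>mod Reg 0) (Reg 12 \<^bold>+ Reg 6)),
        SetReg 14 (cell_expr (Reg 10 \<^bold>mod Reg 0) (Reg 12) \<^bold>+ cell_expr (Reg 10 \<^bold>div Reg 0) (Reg 12 \<^bold>+ Reg 6)),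
        SetReg 13 ((Reg 13 \<^bold>- Reg 14) \<^bold>+ (Reg 14 \<^bold>- Reg 13)),
        SetReg 15 (Reg 15 \<^bold>+ Reg 13 \<^bold>* Reg 13)] @
     [SetArr 4 (Reg 11) (Reg 15)]"

text \<open>Counting, for each estimate, the estimates that exceed it takes about \<open>R^2\<close>
  comparisons per pair and avoids sorting; \<open>R\<close> is only logarithmic in \<open>n\<close>.
  Register 16 starts at the cap \<open>d * d\<close>.\<close>

definition median_prog :: "instr list" where
  "median_prog =
     SetReg 16 (Reg 1 \<^bold>* Reg 1) #
     for_loop 11 (Reg 7)
       (SetReg 17 (Const 0) #
        for_loop 12 (Reg 7) [SetReg 17 (Reg 17 \<^bold>+ (Arr 4 (Reg 11) \<^bold>< Arr 4 (Reg 12)))] @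
        [Cond (Reg 17 \<^bold>+ Reg 17 \<^bold>< Reg 7)
           [Cond (Arr 4 (Reg 11) \<^bold>< Reg 16) [SetReg 16 (Arr 4 (Reg 11))] []] []])"

definition dist_prog :: "instr list" where
  "dist_prog =
     for_loop 10 (Reg 0 \<^bold>* Reg 0)
       (for_loop 11 (Reg 7) est_prog @ median_prog @ [SetArr 5 (Reg 10) (Reg 16)])"

lemma index_less: "a < A \<Longrightarrow> b < B \<Longrightarrow> a * B + b < A * (B :: nat)"
proof -
  assume "a < A" "b < B"
  then have "a * B + b < Suc a * B" by simp
  also have "\<dots> \<le> A * B" using \<open>a < A\<close> by (intro mult_le_mono1) simp
  finally show ?thesis .
qed

lemma index_eq_iff:
  assumes b: "b < B" "b' < B"
  shows "a * B + b = a' * B + (b' :: nat) \<longleftrightarrow> a = a' \<and> b = b'"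
proof
  assume eq: "a * B + b = a' * B + b'"
  have "(a * B + b) div B = a" "(a' * B + b') div B = a'" using b by simp_all
  with eq show "a = a' \<and> b = b'" by simp
qed auto

text \<open>The cap \<open>D\<close> bounds the result even if all estimates are bad, as the search needs, and keeps
  \<open>Min\<close> away from the empty set.\<close>

definition low_median :: "(nat \<Rightarrow> nat) \<Rightarrow> nat \<Rightarrow> nat \<Rightarrow> nat" where
  "low_median f D R = Min (insert D {f j | j. j < R \<and> 2 * card {i. i < R \<and> f j < f i} < R})"

lemma low_median_le: "low_median f D R \<le> D"
  unfolding low_median_def by (intro Min_le) auto

text \<open>The table \<open>g\<close> of random words is fixed and arbitrary. The inequalities in
  \<open>bounds\<close> keep intermediate values and addresses from being truncated;
  \<open>d * d < G\<close> puts the top of the search above every estimate.\<close>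

locale ram =
  fixes w n d l z k m R G :: nat and A g :: "nat \<Rightarrow> nat"
  assumes A_le: "\<And>a. A a \<le> 1"
    and word: "16 < (2::nat) ^ w"
    and bounds: "R * n * (2 * m) < 2 ^ w" "R * d < 2 ^ w" "n * n < 2 ^ w" "n * d < 2 ^ w"
      "m * (4 * (d * d)) < 2 ^ w" "R + R < 2 ^ w" "2 * d < 2 ^ w" "3 * (16 * k + 1) * G < 2 ^ w"
      "16 * k * (d * d) < 2 ^ w"
    and pos: "n > 0" "m > 0" "k > 0" "R > 0" "l > 0" "l \<le> n" "d * d < G"
begin

definition params :: "memory \<Rightarrow> bool" where
  "params s \<longleftrightarrow> regs s 0 = n \<and> regs s 1 = d \<and> regs s 2 = l \<and> regs s 3 = z \<and> regs s 4 = k \<and>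
     regs s 5 = 2 * m \<and> regs s 6 = m \<and> regs s 7 = R \<and> regs s 8 = G"

lemma params_regs [simp]:
  assumes "params s"
  shows "regs s 0 = n" "regs s (Suc 0) = d" "regs s 2 = l" "regs s 3 = z" "regs s 4 = k"
    "regs s 5 = 2 * m" "regs s 6 = m" "regs s 7 = R" "regs s 8 = G"
  using assms by (simp_all add: params_def)

lemma params_set [simp]:
  "8 < x \<Longrightarrow> params (set_reg x v s) = params s"
  "params (set_arr a i v s) = params s"
  unfolding params_def by simp_all

lemma literal_mod [simp]: "2 ^ w \<noteq> Suc 0" "(2 :: nat) mod 2 ^ w = 2" "(3 :: nat) mod 2 ^ w = 3"
  "(16 :: nat) mod 2 ^ w = 16" "Suc 0 mod 2 ^ w = Suc 0" "of_bool b mod 2 ^ w = (of_bool b :: nat)"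
proof -
  have "w \<noteq> 0" using word by (cases w) auto
  then show "2 ^ w \<noteq> Suc 0" "(2 :: nat) mod 2 ^ w = 2" "(3 :: nat) mod 2 ^ w = 3"
    "(16 :: nat) mod 2 ^ w = 16" "Suc 0 mod 2 ^ w = Suc 0" "of_bool b mod 2 ^ w = (of_bool b :: nat)"
    using word by auto
qed

definition cell :: "nat \<Rightarrow> nat \<Rightarrow> nat \<Rightarrow> nat" where
  "cell e N u = (\<Sum>i<N. if g ((e div n) * d + i) mod (2 * m) = u then A ((e mod n) * d + i) else 0)"

lemma cell_le: "cell e N u \<le> N"
proof -
  have "cell e N u \<le> (\<Sum>i<N. 1)" unfolding cell_def by (intro sum_mono) (use A_le in auto)
  then show ?thesis by simp
qed

lemma wp_sketch:
  assumes "params s" "arrs s 0 = A" "arrs s 2 = g" "\<And>a. arrs s 3 a = 0"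
  shows "wp w sketch_prog (2 + R * n * (2 + d * 4 + 2))
    (\<lambda>s. params s \<and> (\<forall>e<R * n. \<forall>u<2 * m. arrs s 3 (e * (2 * m) + u) = cell e d u)) s"
proof -
  define I where "I = (\<lambda>e i s. params s \<and> arrs s 0 = A \<and> arrs s 2 = g \<and>
    (\<forall>e'<R * n. \<forall>u<2 * m. arrs s 3 (e' * (2 * m) + u) =
      (if e' < e then cell e' d u else if e' = e then cell e i u else 0)))"
  have Rn: "R * n < 2 ^ w"
    by (rule le_less_trans[OF _ bounds(1)]) (use pos in simp)
  \<comment> \<open>A row not yet begun holds zeros, so \<open>I e d\<close> and
    \<open>I (Suc e) 0\<close> describe the same array.\<close>
  have cell_0: "cell e 0 u = 0" for e u by (simp add: cell_def)
  show ?thesis unfolding sketch_prog_def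
  proof (rule wp_mono[OF wp_for[where N = "R * n" and I = "\<lambda>e. I e 0" and T = "2 + d * (2 + 2)"]])
    show "I 0 0 (set_reg 10 0 s)" using assms by (simp add: I_def cell_def)
  next
    fix e s assume e: "e < R * n" and I: "I e 0 s" and r10: "regs s 10 = e"
    have en: "e div n < R" "e mod n < n" using e pos by (auto simp: less_mult_imp_div_less)
    have a1: "(e div n) * d + i < 2 ^ w" if "i < d" for i
      using index_less[OF en(1) that] bounds(2) by linarith
    have a2: "(e mod n) * d + i < 2 ^ w" if "i < d" for i
      using index_less[OF en(2) that] bounds(4) by linarith
    have a3: "e * (2 * m) + u < 2 ^ w" if "u < 2 * m" for u
      using index_less[OF e that] bounds(1) by linarith
    show "wp w (for_loop 12 (Reg 1)
         [SetReg 14 (Reg 10 \<^bold>* Reg 5 \<^bold>+ Arr 2 ((Reg 10 \<^bold>div Reg 0) \<^bold>* Reg 1 \<^bold>+ Reg 12) \<^bold>mod Reg 5),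
          SetArr 3 (Reg 14) (Arr 3 (Reg 14) \<^bold>+ Arr 0 ((Reg 10 \<^bold>mod Reg 0) \<^bold>* Reg 1 \<^bold>+ Reg 12))])
       (2 + d * (2 + 2)) (\<lambda>s. regs s 10 = e \<and> I (Suc e) 0 (set_reg 10 (Suc e) s)) s"
    proof (rule wp_mono[OF wp_for[where N = d and I = "\<lambda>i s. regs s 10 = e \<and> I e i s" and T = 2]])
      fix i s assume i: "i < d" and Ii: "regs s 10 = e \<and> I e i s" and r12: "regs s 12 = i"
      define u where "u = g ((e div n) * d + i) mod (2 * m)"
      have u: "u < 2 * m" using pos by (simp add: u_def)
      have ed: "(e div n) mod 2 ^ w = e div n" "(e mod n) mod 2 ^ w = e mod n" "u mod 2 ^ w = u"
        using e Rn a3[OF u] div_le_dividend[of e n] mod_less_eq_dividend[of e n]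
        by (simp_all del: div_le_dividend mod_less_eq_dividend)
      note facts = ed[unfolded u_def] a1[OF i] a2[OF i] a3[OF u, unfolded u_def]
      have s1: "cell e i u + A ((e mod n) * d + i) < 2 ^ w"
        using cell_le[of e i u] A_le[of "(e mod n) * d + i"] i bounds(7) by linarith
      have s2: "cell e (Suc i) u' = cell e i u' + (if u' = u then A ((e mod n) * d + i) else 0)" for u'
        by (auto simp: cell_def u_def)
      have 3: "arrs s 3 (e * (2 * m) + u) = cell e i u" "arrs s 0 = A" using Ii u e by (auto simp: I_def)
      show "wp w [SetReg 14 (Reg 10 \<^bold>* Reg 5 \<^bold>+ Arr 2 ((Reg 10 \<^bold>div Reg 0) \<^bold>* Reg 1 \<^bold>+ Reg 12) \<^bold>mod Reg 5),
          SetArr 3 (Reg 14) (Arr 3 (Reg 14) \<^bold>+ Arr 0 ((Reg 10 \<^bold>mod Reg 0) \<^bold>* Reg 1 \<^bold>+ Reg 12))] 2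
          (\<lambda>s'. regs s' 12 = i \<and> regs (set_reg 12 (Suc i) s') 10 = e \<and> I e (Suc i) (set_reg 12 (Suc i) s')) s"
        using Ii r12 u s1 3 facts
        by (intro wp_time[OF wp_SetReg[OF wp_SetArr[OF wp_Nil]]]) (simp_all add: I_def s2 index_eq_iff u_def)
    qed (use I r10 bounds(7) cell_0 in \<open>auto simp: I_def less_Suc_eq\<close>)
  qed (use Rn in \<open>auto simp: I_def cell_def\<close>)
qed

end

section \<open>Distance estimates\<close>

context ram begin

definition sketched :: "memory \<Rightarrow> bool" where
  "sketched s \<longleftrightarrow> (\<forall>e<R * n. \<forall>u<2 * m. arrs s 3 (e * (2 * m) + u) = cell e d u)"

lemma sketched_set [simp]:
  "sketched (set_reg x v s) = sketched s" "a \<noteq> 3 \<Longrightarrow> sketched (set_arr a i v s) = sketched s"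
  unfolding sketched_def by simp_all

definition deviation :: "nat \<Rightarrow> nat \<Rightarrow> nat \<Rightarrow> nat \<Rightarrow> nat" where
  "deviation j p q b =
     ((cell (j * n + p) d b + cell (j * n + q) d (b + m)) - (cell (j * n + q) d b + cell (j * n + p) d (b + m))) +
     ((cell (j * n + q) d b + cell (j * n + p) d (b + m)) - (cell (j * n + p) d b + cell (j * n + q) d (b + m)))"

definition est :: "nat \<Rightarrow> nat \<Rightarrow> nat \<Rightarrow> nat \<Rightarrow> nat" where
  "est N j p q = (\<Sum>b<N. deviation j p q b * deviation j p q b)"

definition dist :: "nat \<Rightarrow> nat \<Rightarrow> nat" where
  "dist p q = low_median (\<lambda>j. est m j p q) (d * d) R"

lemma deviation_le: "deviation j p q b \<le> 2 * d"
  using cell_le[of "j * n + p" d b] cell_le[of "j * n + q" d "b + m"]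
    cell_le[of "j * n + q" d b] cell_le[of "j * n + p" d "b + m"]
  unfolding deviation_def by linarith

lemma deviation_sq_le: "deviation j p q b * deviation j p q b \<le> 4 * (d * d)"
  using mult_le_mono[OF deviation_le deviation_le, of j p q b j p q b] by simp

lemma est_le: "est N j p q \<le> N * (4 * (d * d))"
proof -
  have "est N j p q \<le> (\<Sum>b<N. 4 * (d * d))"
    unfolding est_def by (intro sum_mono deviation_sq_le)
  then show ?thesis by simp
qed

lemma cell_expr_value [simp]:
  assumes "params s" "sketched s" "regs s 11 = j" "j < R" "value_of w s p < n" "value_of w s b < 2 * m"
  shows "value_of w s (cell_expr p b) = cell (j * n + value_of w s p) d (value_of w s b)"
proof -
  have e: "j * n + value_of w s p < R * n"
    using assms by (intro index_less)
  have "(j * n + value_of w s p) * (2 * m) + value_of w s b < 2 ^ w"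
    using index_less[OF e assms(6)] bounds(1) by linarith
  then show ?thesis
    using assms e unfolding sketched_def by (simp add: cell_expr_def mod_simps)
qed

lemma wp_est:
  assumes "params s" "sketched s" "regs s 10 = e" "regs s 11 = j" "e < n * n" "j < R"
  shows "wp w est_prog (4 + m * 6) (\<lambda>s'. params s' \<and> sketched s' \<and> regs s' 10 = e \<and> regs s' 11 = j \<and>
    arrs s' = (arrs s)(4 := (arrs s 4)(j := est m j (e div n) (e mod n)))) s"
proof -
  define p q where "p = e div n" and "q = e mod n"
  have pq: "p < n" "q < n" using assms(5) pos by (auto simp: p_def q_def less_mult_imp_div_less)
  have n: "n < 2 ^ w" using bounds(3) pos by (cases n) auto
  have m2: "2 * m < 2 ^ w"
    by (rule le_less_trans[OF _ bounds(1)]) (use pos in simp)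
  define I where "I = (\<lambda>b s'. params s' \<and> sketched s' \<and> regs s' 10 = e \<and> regs s' 11 = j \<and>
    arrs s' = arrs s \<and> regs s' 15 = est b j p q)"
  show ?thesis unfolding est_prog_def
  proof (rule wp_time, rule wp_SetReg, rule wp_seq)
    show "wp w (for_loop 12 (Reg 6)
       [SetReg 13 (cell_expr (Reg 10 \<^bold>div Reg 0) (Reg 12) \<^bold>+ cell_expr (Reg 10 \<^bold>mod Reg 0) (Reg 12 \<^bold>+ Reg 6)),
        SetReg 14 (cell_expr (Reg 10 \<^bold>mod Reg 0) (Reg 12) \<^bold>+ cell_expr (Reg 10 \<^bold>div Reg 0) (Reg 12 \<^bold>+ Reg 6)),
        SetReg 13 ((Reg 13 \<^bold>- Reg 14) \<^bold>+ (Reg 14 \<^bold>- Reg 13)),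
        SetReg 15 (Reg 15 \<^bold>+ Reg 13 \<^bold>* Reg 13)]) (2 + m * (4 + 2)) (I m)
        (set_reg 15 (value_of w s (Const 0)) s)"
    proof (rule wp_for)
      show "I 0 (set_reg 12 0 (set_reg 15 (value_of w s (Const 0)) s))"
        using assms by (simp add: I_def est_def)
    next
      fix b s' assume b: "b < m" and I: "I b s'" and r12: "regs s' 12 = b"
      have v: "e div n mod 2 ^ w = p" "e mod n mod 2 ^ w = q" "b + m < 2 * m" "b < 2 * m"
        "(b + m) mod 2 ^ w = b + m"
        using less_trans[OF pq(1) n] less_trans[OF pq(2) n] b m2 by (simp_all add: p_def q_def)
      have c: "(cell x d b1 + cell y d b2) mod 2 ^ w = cell x d b1 + cell y d b2" for x y b1 b2
        using cell_le[of x d b1] cell_le[of y d b2] bounds(7) by simp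
      have dv: "((cell (j * n + p) d b + cell (j * n + q) d (b + m)) - (cell (j * n + q) d b + cell (j * n + p) d (b + m))) mod 2 ^ w
         = ((cell (j * n + p) d b + cell (j * n + q) d (b + m)) - (cell (j * n + q) d b + cell (j * n + p) d (b + m)))"
        "((cell (j * n + q) d b + cell (j * n + p) d (b + m)) - (cell (j * n + p) d b + cell (j * n + q) d (b + m))) mod 2 ^ w
         = ((cell (j * n + q) d b + cell (j * n + p) d (b + m)) - (cell (j * n + p) d b + cell (j * n + q) d (b + m)))"
        "deviation j p q b mod 2 ^ w = deviation j p q b"
        using deviation_le[of j p q b] bounds(7) by (auto simp: deviation_def)
      have "est (Suc b) j p q < 2 ^ w"
        using est_le[of "Suc b" j p q] mult_le_mono1[of "Suc b" m "4 * (d * d)"] b bounds(5) by linarith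
      then have ad: "(est b j p q + deviation j p q b * deviation j p q b) mod 2 ^ w = est (Suc b) j p q"
        by (simp add: est_def)
      show "wp w [SetReg 13 (cell_expr (Reg 10 \<^bold>div Reg 0) (Reg 12) \<^bold>+ cell_expr (Reg 10 \<^bold>mod Reg 0) (Reg 12 \<^bold>+ Reg 6)),
        SetReg 14 (cell_expr (Reg 10 \<^bold>mod Reg 0) (Reg 12) \<^bold>+ cell_expr (Reg 10 \<^bold>div Reg 0) (Reg 12 \<^bold>+ Reg 6)),
        SetReg 13 ((Reg 13 \<^bold>- Reg 14) \<^bold>+ (Reg 14 \<^bold>- Reg 13)),
        SetReg 15 (Reg 15 \<^bold>+ Reg 13 \<^bold>* Reg 13)] 4
          (\<lambda>s'. regs s' 12 = b \<and> I (Suc b) (set_reg 12 (Suc b) s')) s'"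
        using I r12 v pq assms(6) ad
        by (intro wp_time[OF wp_SetReg[OF wp_SetReg[OF wp_SetReg[OF wp_SetReg[OF wp_Nil]]]]])
          (simp_all add: I_def c dv deviation_def[symmetric] mod_add_right_eq)
    qed (use m2 in \<open>auto simp: I_def\<close>)
  next
    fix s1 assume "I m s1"
    then show "wp w [SetArr 4 (Reg 11) (Reg 15)] 1 (\<lambda>s'. params s' \<and> sketched s' \<and> regs s' 10 = e \<and> regs s' 11 = j \<and>
      arrs s' = (arrs s)(4 := (arrs s 4)(j := est m j (e div n) (e mod n)))) s1"
      by (auto simp: I_def p_def q_def intro!: wp_time[OF wp_SetArr[OF wp_Nil]])
  qed simp
qed

lemma wp_median:
  assumes "params s" "sketched s" "regs s 10 = e"
  shows "wp w median_prog (3 + R * (8 + R * 3)) (\<lambda>s'. params s' \<and> sketched s' \<and> regs s' 10 = e \<and>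
    arrs s' = arrs s \<and> regs s' 16 = low_median (arrs s 4) (d * d) R) s"
proof -
  let ?f = "arrs s 4"
  let ?P = "\<lambda>j. 2 * card {i. i < R \<and> ?f j < ?f i} < R"
  define Mn where "Mn = (\<lambda>j. Min (insert (d * d) {?f j' | j'. j' < j \<and> ?P j'}))"
  define I where "I = (\<lambda>j s'. params s' \<and> sketched s' \<and> regs s' 10 = e \<and> arrs s' = arrs s \<and>
    regs s' 16 = Mn j)"
  have R: "R < 2 ^ w" using bounds(6) by linarith
  have dd: "d * d < 2 ^ w"
    by (rule le_less_trans[OF _ bounds(5)]) (use pos in simp)
  have I_Suc: "Min (insert (d * d) {?f j' | j'. j' < Suc j \<and> ?P j'}) =
     (if ?P j then min (?f j) (Min (insert (d * d) {?f j' | j'. j' < j \<and> ?P j'}))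
      else Min (insert (d * d) {?f j' | j'. j' < j \<and> ?P j'}))" for j
  proof (cases "?P j")
    case True
    then have "insert (d * d) {?f j' | j'. j' < Suc j \<and> ?P j'} =
      insert (?f j) (insert (d * d) {?f j' | j'. j' < j \<and> ?P j'})"
      by (auto simp: less_Suc_eq)
    then show ?thesis using True by (simp del: insert_iff add: Min_insert)
  next
    case False
    then have "{?f j' | j'. j' < Suc j \<and> ?P j'} = {?f j' | j'. j' < j \<and> ?P j'}"
      by (auto simp: less_Suc_eq)
    then show ?thesis using False by simp
  qed
  then have Mn_Suc: "Mn (Suc j) = (if 2 * card {i. i < R \<and> ?f j < ?f i} < R then min (?f j) (Mn j) else Mn j)" for j
    unfolding Mn_def .
  have Mn_0: "Mn 0 = d * d" by (simp add: Mn_def)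
  have "wp w median_prog (Suc (2 + R * ((Suc ((2 + R * (1 + 2)) + 3)) + 2))) (I R) s"
    unfolding median_prog_def
  proof (rule wp_SetReg, rule wp_for)
    show "I 0 (set_reg 11 0 (set_reg 16 (value_of w s (Reg 1 \<^bold>* Reg 1)) s))"
      using assms dd Mn_0 by (simp add: I_def)
  next
    fix j s' assume j: "j < R" and I: "I j s'" and r11: "regs s' 11 = j"
    define J where "J = (\<lambda>i s'. I j s' \<and> regs s' 11 = j \<and>
      regs s' 17 = card {i'. i' < i \<and> ?f j < ?f i'})"
    show "wp w (SetReg 17 (Const 0) #
        for_loop 12 (Reg 7) [SetReg 17 (Reg 17 \<^bold>+ (Arr 4 (Reg 11) \<^bold>< Arr 4 (Reg 12)))] @
        [Cond (Reg 17 \<^bold>+ Reg 17 \<^bold>< Reg 7)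
           [Cond (Arr 4 (Reg 11) \<^bold>< Reg 16) [SetReg 16 (Arr 4 (Reg 11))] []] []])
        (Suc ((2 + R * (1 + 2)) + 3)) (\<lambda>s'. regs s' 11 = j \<and> I (Suc j) (set_reg 11 (Suc j) s')) s'"
    proof (rule wp_SetReg, rule wp_seq[OF wp_for])
      show "J 0 (set_reg 12 0 (set_reg 17 (value_of w s' (Const 0)) s'))"
        using I r11 by (simp add: J_def I_def)
    next
      fix i s1 assume i: "i < R" and J: "J i s1" and r12: "regs s1 12 = i"
      have "{i'. i' < Suc i \<and> ?f j < ?f i'} = (if ?f j < ?f i then {i} else {}) \<union> {i'. i' < i \<and> ?f j < ?f i'}"
        by (auto simp: less_Suc_eq)
      then have S: "card {i'. i' < Suc i \<and> ?f j < ?f i'} = card {i'. i' < i \<and> ?f j < ?f i'} + of_bool (?f j < ?f i)"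
        by (auto simp: card_insert_if)
      have "card {i'. i' < Suc i \<and> ?f j < ?f i'} \<le> card {..<Suc i}" by (intro card_mono) auto
      then have "card {i'. i' < Suc i \<and> ?f j < ?f i'} < 2 ^ w" using i R by simp
      then show "wp w [SetReg 17 (Reg 17 \<^bold>+ (Arr 4 (Reg 11) \<^bold>< Arr 4 (Reg 12)))] 1
          (\<lambda>s'. regs s' 12 = i \<and> J (Suc i) (set_reg 12 (Suc i) s')) s1"
        using J r12 S by (intro wp_time[OF wp_SetReg[OF wp_Nil]]) (auto simp: J_def I_def)
    next
      fix s1 assume J: "J R s1"
      have "card {i'. i' < R \<and> ?f j < ?f i'} \<le> card {..<R}" by (intro card_mono) auto
      then have c: "(card {i'. i' < R \<and> ?f j < ?f i'} + card {i'. i' < R \<and> ?f j < ?f i'}) mod 2 ^ w =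
          2 * card {i'. i' < R \<and> ?f j < ?f i'}"
        using bounds(6) by simp
      have "wp w [Cond (Reg 17 \<^bold>+ Reg 17 \<^bold>< Reg 7)
           [Cond (Arr 4 (Reg 11) \<^bold>< Reg 16) [SetReg 16 (Arr 4 (Reg 11))] []] []] (Suc (Suc (Suc 0)))
          (\<lambda>s'. regs s' 11 = j \<and> I (Suc j) (set_reg 11 (Suc j) s')) s1"
      proof (rule wp_Cond, unfold append_Nil append_Nil2)
        assume P: "value_of w s1 (Reg 17 \<^bold>+ Reg 17 \<^bold>< Reg 7) \<noteq> 0"
        show "wp w [Cond (Arr 4 (Reg 11) \<^bold>< Reg 16) [SetReg 16 (Arr 4 (Reg 11))] []] (Suc (Suc 0))
          (\<lambda>s'. regs s' 11 = j \<and> I (Suc j) (set_reg 11 (Suc j) s')) s1"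
          by (rule wp_Cond; unfold append_Nil append_Nil2;
              intro wp_SetReg wp_Nil wp_time[OF wp_Nil])
            (use P J c Mn_Suc[of j] in \<open>auto simp: J_def I_def min_def split: if_splits\<close>)
      qed (use J c Mn_Suc[of j] in \<open>auto simp: J_def I_def intro!: wp_time[OF wp_Nil]\<close>)
      then show "wp w [Cond (Reg 17 \<^bold>+ Reg 17 \<^bold>< Reg 7)
           [Cond (Arr 4 (Reg 11) \<^bold>< Reg 16) [SetReg 16 (Arr 4 (Reg 11))] []] []] 3
          (\<lambda>s'. regs s' 11 = j \<and> I (Suc j) (set_reg 11 (Suc j) s')) s1"
        by (simp add: numeral_3_eq_3)
    qed (use R in \<open>auto simp: I_def J_def\<close>)
  qed (use R in \<open>auto simp: I_def\<close>)
  then show ?thesis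
    by (rule wp_mono) (auto simp: I_def Mn_def low_median_def algebra_simps)
qed

end

lemma low_median_cong:
  assumes "\<And>j. j < R \<Longrightarrow> f j = f' j"
  shows "low_median f D R = low_median f' D R"
proof -
  have "{f j | j. j < R \<and> 2 * card {i. i < R \<and> f j < f i} < R} =
        {f' j | j. j < R \<and> 2 * card {i. i < R \<and> f' j < f' i} < R}"
  proof -
    have "{i. i < R \<and> f j < f i} = {i. i < R \<and> f' j < f' i}" if "j < R" for j
      using assms that by auto
    then show ?thesis using assms by (metis (no_types, lifting))
  qed
  then show ?thesis by (simp add: low_median_def)
qed

section \<open>One round of the greedy algorithm on the machine\<close>

definition gain_prog :: "instr list" where
  "gain_prog =
     SetReg 15 (Const 1) #
     for_loop 12 (Reg 0)
       [SetReg 15 (Reg 15 \<^bold>+ (Const 1 \<^bold>- Arr 6 (Reg 12)) \<^bold>*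
          (Arr 5 (Reg 10 \<^bold>* Reg 0 \<^bold>+ Reg 12) \<^bold>< Reg 24))]"

text \<open>Register 14 holds the best gain plus one, so that 0 means that no candidate has been
  seen; for this reason \<open>gain_prog\<close> starts counting at 1.\<close>

definition pick_prog :: "instr list" where
  "pick_prog =
     SetReg 14 (Const 0) # SetReg 13 (Const 0) #
     for_loop 10 (Reg 0)
       [Cond (Arr 7 (Reg 10)) []
          (gain_prog @ [Cond (Reg 14 \<^bold>< Reg 15) [SetReg 14 (Reg 15), SetReg 13 (Reg 10)] []])]"

text \<open>The inequality in \<open>wide\<close> is not strict, whereas the language compares
  strictly. Its negation is tested, and marking happens in the else branch.\<close>

definition mark_prog :: "instr list" where
  "mark_prog =
     SetArr 1 (Reg 11) (Reg 13) # SetArr 7 (Reg 13) (Const 1) #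
     for_loop 12 (Reg 0)
       [Cond (Const 3 \<^bold>* (Const 16 \<^bold>* Reg 4 \<^bold>+ Const 1) \<^bold>* (Reg 24 \<^bold>- Const 1) \<^bold><
              Arr 5 (Reg 13 \<^bold>* Reg 0 \<^bold>+ Reg 12) \<^bold>* (Const 16 \<^bold>* Reg 4 \<^bold>- Const 1))
          [] [SetArr 6 (Reg 12) (Const 1)]]"

definition greedy_prog :: "instr list" where
  "greedy_prog =
     for_loop 10 (Reg 0) [SetArr 6 (Reg 10) (Const 0), SetArr 7 (Reg 10) (Const 0)] @
     for_loop 11 (Reg 2) (pick_prog @ mark_prog) @
     SetReg 15 (Const 0) # for_loop 10 (Reg 0) [SetReg 15 (Reg 15 \<^bold>+ Arr 6 (Reg 10))]"

context ram begin

lemma w_pos [simp]: "0 < w"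
  using word by (cases w) auto

lemma n_less: "n < 2 ^ w"
  using bounds(3) pos by (cases n) auto

lemma wp_dist:
  assumes "params s" "sketched s"
  shows "wp w dist_prog (2 + n * n * ((2 + R * (4 + m * 6 + 2)) + ((3 + R * (8 + R * 3)) + 1) + 2))
    (\<lambda>s. params s \<and> (\<forall>p<n. \<forall>q<n. arrs s 5 (p * n + q) = dist p q)) s"
proof -
  have R: "R < 2 ^ w" using bounds(6) by linarith
  define I where "I = (\<lambda>e s. params s \<and> sketched s \<and>
    (\<forall>e'<e. arrs s 5 e' = dist (e' div n) (e' mod n)))"
  show ?thesis unfolding dist_prog_def
  proof (rule wp_mono, rule wp_for)
    show "I 0 (set_reg 10 0 s)" using assms by (simp add: I_def)
  next
    fix e s assume e: "e < n * n" and I: "I e s" and r10: "regs s 10 = e"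
    define J where "J = (\<lambda>j s'. params s' \<and> sketched s' \<and> regs s' 10 = e \<and> arrs s' 5 = arrs s 5 \<and>
      (\<forall>j'<j. arrs s' 4 j' = est m j' (e div n) (e mod n)))"
    define M where "M = (\<lambda>s'. params s' \<and> sketched s' \<and> regs s' 10 = e \<and> arrs s' 5 = arrs s 5 \<and>
      regs s' 16 = dist (e div n) (e mod n))"
    show "wp w (for_loop 11 (Reg 7) est_prog @ median_prog @ [SetArr 5 (Reg 10) (Reg 16)])
        ((2 + R * (4 + m * 6 + 2)) + ((3 + R * (8 + R * 3)) + 1))
        (\<lambda>s'. regs s' 10 = e \<and> I (Suc e) (set_reg 10 (Suc e) s')) s"
    proof (rule wp_seq[OF wp_for])
      show "J 0 (set_reg 11 0 s)" using I r10 by (simp add: I_def J_def)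
    next
      fix j s' assume j: "j < R" and J: "J j s'" and r11: "regs s' 11 = j"
      show "wp w est_prog (4 + m * 6) (\<lambda>s'. regs s' 11 = j \<and> J (Suc j) (set_reg 11 (Suc j) s')) s'"
        by (rule wp_mono[OF wp_est[where e = e and j = j]])
          (use J r11 e j in \<open>auto simp: J_def less_Suc_eq\<close>)
    next
      fix s1 assume J: "J R s1"
      show "wp w (median_prog @ [SetArr 5 (Reg 10) (Reg 16)]) ((3 + R * (8 + R * 3)) + 1)
        (\<lambda>s'. regs s' 10 = e \<and> I (Suc e) (set_reg 10 (Suc e) s')) s1"
      proof (rule wp_seq[where ?Q1.0 = M])
        have "low_median (arrs s1 4) (d * d) R = dist (e div n) (e mod n)"
          unfolding dist_def using J by (intro low_median_cong) (auto simp: J_def)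
        then show "wp w median_prog (3 + R * (8 + R * 3)) M s1"
          using J by (intro wp_mono[OF wp_median[where e = e]]) (auto simp: J_def M_def)
      next
        fix s2 assume "M s2"
        then show "wp w [SetArr 5 (Reg 10) (Reg 16)] 1
          (\<lambda>s'. regs s' 10 = e \<and> I (Suc e) (set_reg 10 (Suc e) s')) s2"
          using I by (intro wp_time[OF wp_SetArr[OF wp_Nil]]) (auto simp: M_def I_def less_Suc_eq)
      qed
    qed (use R in \<open>auto simp: J_def\<close>)
  next
    fix s assume I: "I (n * n) s"
    show "params s \<and> (\<forall>p<n. \<forall>q<n. arrs s 5 (p * n + q) = dist p q)"
    proof (intro conjI allI impI)
      fix p q assume "p < n" "q < n"
      then show "arrs s 5 (p * n + q) = dist p q"
        using I index_less[of p n q n] by (auto simp: I_def)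
    qed (use I in \<open>simp add: I_def\<close>)
  qed (use bounds in \<open>auto simp: I_def\<close>)
qed

text \<open>\<open>lo\<close> and \<open>gap\<close> belong to the surrounding search; they are
  carried along to show that a greedy run leaves its registers alone.\<close>

context
  fixes E :: "nat \<Rightarrow> nat \<Rightarrow> nat" and lo gap \<rho> :: nat
  assumes E_le: "\<And>p q. E p q \<le> d * d"
    and \<rho>_le: "\<rho> \<le> G"
begin

abbreviation "Near \<equiv> near n E \<rho>"
abbreviation "Wide \<equiv> wide n k E \<rho>"

definition loaded :: "memory \<Rightarrow> bool" where
  "loaded s \<longleftrightarrow> params s \<and> regs s 22 = lo \<and> regs s 23 = gap \<and> regs s 24 = \<rho> \<and>
     (\<forall>p<n. \<forall>q<n. arrs s 5 (p * n + q) = E p q)"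

lemma loaded_regs [simp]:
  assumes "loaded s"
  shows "params s" "regs s 22 = lo" "regs s 23 = gap" "regs s 24 = \<rho>"
    "p < n \<Longrightarrow> q < n \<Longrightarrow> arrs s 5 (p * n + q) = E p q"
  using assms by (simp_all add: loaded_def)

lemma loaded_set [simp]:
  "8 < x \<Longrightarrow> x \<notin> {22, 23, 24} \<Longrightarrow> loaded (set_reg x v s) = loaded s"
  "a \<noteq> 5 \<Longrightarrow> loaded (set_arr a i v s) = loaded s"
  unfolding loaded_def by simp_all

definition marked :: "nat set \<Rightarrow> memory \<Rightarrow> bool" where
  "marked C s \<longleftrightarrow> loaded s \<and>
     (\<forall>q<n. arrs s 7 q = of_bool (q \<in> C) \<and> arrs s 6 q = of_bool (q \<in> covers Wide C))"

lemma marked_set [simp]: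
  "8 < x \<Longrightarrow> x \<notin> {22, 23, 24} \<Longrightarrow> marked C (set_reg x v s) = marked C s"
  "a \<notin> {5, 6, 7} \<Longrightarrow> marked C (set_arr a i v s) = marked C s"
  unfolding marked_def by auto

lemma marked_simps [simp]:
  assumes "marked C s"
  shows "loaded s" "params s"
  using assms unfolding marked_def by auto

lemma marked_arrs:
  assumes "marked C s" "q < n"
  shows "arrs s 7 q = of_bool (q \<in> C)" "arrs s 6 q = of_bool (q \<in> covers Wide C)"
  using assms unfolding marked_def by auto

lemma wp_gain:
  assumes "marked C s" "regs s 10 = c" "c < n" "regs s 11 = t" "regs s 13 = x" "regs s 14 = y" "arrs s 1 = a"
  shows "wp w gain_prog (3 + n * 3) (\<lambda>s. marked C s \<and> regs s 10 = c \<and> regs s 11 = t \<and> regs s 13 = x \<and>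
    regs s 14 = y \<and> arrs s 1 = a \<and> regs s 15 = Suc (card (Near c - covers Wide C))) s"
proof -
  define gain where "gain = (\<lambda>q. card {q'. q' < q \<and> E c q' < \<rho> \<and> q' \<notin> covers Wide C})"
  define I where "I = (\<lambda>q s. marked C s \<and> regs s 10 = c \<and> regs s 11 = t \<and> regs s 13 = x \<and>
    regs s 14 = y \<and> arrs s 1 = a \<and> regs s 15 = Suc (gain q))"
  have gain_Suc: "gain (Suc q) = gain q + (Suc 0 - of_bool (q \<in> covers Wide C)) * of_bool (E c q < \<rho>)" for q
  proof -
    have "{q'. q' < Suc q \<and> E c q' < \<rho> \<and> q' \<notin> covers Wide C} =
      (if E c q < \<rho> \<and> q \<notin> covers Wide C then {q} else {}) \<union> {q'. q' < q \<and> E c q' < \<rho> \<and> q' \<notin> covers Wide C}"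
      by (auto simp: less_Suc_eq)
    then show ?thesis by (auto simp: gain_def)
  qed
  have gain_le: "gain q \<le> q" for q
  proof -
    have "gain q \<le> card {..<q}" unfolding gain_def by (intro card_mono) auto
    then show ?thesis by simp
  qed
  \<comment> \<open>The gain register can reach \<open>n + 1\<close>. The bound on
    \<open>n * n\<close> covers this for \<open>n \<ge> 2\<close>, and \<open>16 < 2 ^ w\<close>
    covers \<open>n = 1\<close>.\<close>
  have nn: "Suc n < 2 ^ w \<or> n = 1"
  proof (cases "n \<le> 1")
    case False
    then have "n * 2 \<le> n * n" by (intro mult_le_mono2) simp
    then have "Suc n < 2 ^ w" using bounds(3) False by linarith
    then show ?thesis by simp
  qed (use pos in auto)
  then have nn: "Suc n < 2 ^ w" using word by auto
  show ?thesis unfolding gain_prog_def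
  proof (rule wp_mono, rule wp_SetReg, rule wp_for)
    show "I 0 (set_reg 12 0 (set_reg 15 (value_of w s (Const 1)) s))"
      using assms by (simp add: I_def gain_def)
  next
    fix q s assume q: "q < n" and I: "I q s" and r12: "regs s 12 = q"
    have a: "c * n + q < 2 ^ w" using index_less[OF assms(3) q] bounds(3) by linarith
    have "Suc (gain (Suc q)) < 2 ^ w" using gain_le[of "Suc q"] q nn by linarith
    moreover have "((Suc 0 - of_bool (q \<in> covers Wide C)) * of_bool (E c q < \<rho>)) mod 2 ^ w
       = (Suc 0 - of_bool (q \<in> covers Wide C)) * of_bool (E c q < \<rho>)"
       "(Suc 0 - of_bool (q \<in> covers Wide C)) mod 2 ^ w = Suc 0 - of_bool (q \<in> covers Wide C)"
      by (auto simp: of_bool_def)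
    moreover have "arrs s 6 q = of_bool (q \<in> covers Wide C)" using I q unfolding I_def by (auto dest: marked_arrs)
    moreover have "loaded s" "params s" using I marked_simps unfolding I_def by blast+
    ultimately show "wp w [SetReg 15 (Reg 15 \<^bold>+ (Const 1 \<^bold>- Arr 6 (Reg 12)) \<^bold>*
          (Arr 5 (Reg 10 \<^bold>* Reg 0 \<^bold>+ Reg 12) \<^bold>< Reg 24))] 1
        (\<lambda>s'. regs s' 12 = q \<and> I (Suc q) (set_reg 12 (Suc q) s')) s"
      using I r12 assms(3) q a
      by (intro wp_time[OF wp_SetReg[OF wp_Nil]]) (simp_all add: I_def gain_Suc)
  next
    fix s assume "I n s"
    moreover have "Near c - covers Wide C = {q'. q' < n \<and> E c q' < \<rho> \<and> q' \<notin> covers Wide C}"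
      by (auto simp: near_def)
    ultimately show "marked C s \<and> regs s 10 = c \<and> regs s 11 = t \<and> regs s 13 = x \<and>
      regs s 14 = y \<and> arrs s 1 = a \<and> regs s 15 = Suc (card (Near c - covers Wide C))"
      by (simp add: I_def gain_def)
  qed (use n_less in \<open>auto simp: I_def\<close>)
qed

lemma wp_pick:
  assumes "marked C s" "regs s 11 = t" "arrs s 1 = a" "C \<subseteq> {..<n}" "card C < n"
  shows "wp w pick_prog (4 + n * (9 + n * 3)) (\<lambda>s. marked C s \<and> regs s 11 = t \<and> arrs s 1 = a \<and>
    regs s 13 = greedy_pick n Near Wide C) s"
proof -
  let ?f = "\<lambda>c. card (Near c - covers Wide C)"
  \<comment> \<open>Either only chosen points were seen, or register 13 holds a maximizer among the
    unchosen ones. The strict inequality below register 13 later identifies it as the least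
    maximizer.\<close>
  define I where "I = (\<lambda>c s. marked C s \<and> regs s 11 = t \<and> arrs s 1 = a \<and>
    (regs s 14 = 0 \<and> (\<forall>c'<c. c' \<in> C) \<or>
     regs s 13 < c \<and> regs s 13 \<notin> C \<and> regs s 14 = Suc (?f (regs s 13)) \<and>
     (\<forall>c'<c. c' \<notin> C \<longrightarrow> ?f c' \<le> ?f (regs s 13)) \<and>
     (\<forall>c'<regs s 13. c' \<notin> C \<longrightarrow> ?f c' < ?f (regs s 13))))"
  show ?thesis unfolding pick_prog_def
  proof (rule wp_mono, rule wp_SetReg, rule wp_SetReg, rule wp_for)
    show "I 0 (set_reg 10 0 (set_reg 13 (value_of w (set_reg 14 (value_of w s (Const 0)) s) (Const 0))
        (set_reg 14 (value_of w s (Const 0)) s)))"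
      using assms by (simp add: I_def)
  next
    fix c s assume c: "c < n" and I: "I c s" and r10: "regs s 10 = c"
    have a7: "arrs s 7 c = of_bool (c \<in> C)" using I c unfolding I_def by (auto dest: marked_arrs)
    show "wp w [Cond (Arr 7 (Reg 10)) []
          (gain_prog @ [Cond (Reg 14 \<^bold>< Reg 15) [SetReg 14 (Reg 15), SetReg 13 (Reg 10)] []])]
        (Suc ((3 + n * 3) + 3)) (\<lambda>s'. regs s' 10 = c \<and> I (Suc c) (set_reg 10 (Suc c) s')) s"
    proof (rule wp_Cond, unfold append_Nil append_Nil2)
      assume "value_of w s (Arr 7 (Reg 10)) \<noteq> 0"
      then have "c \<in> C" using r10 a7 by simp
      then show "wp w [] (3 + n * 3 + 3) (\<lambda>s'. regs s' 10 = c \<and> I (Suc c) (set_reg 10 (Suc c) s')) s"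
        using I r10 by (intro wp_time[OF wp_Nil]) (auto simp: I_def less_Suc_eq)
    next
      assume "value_of w s (Arr 7 (Reg 10)) = 0"
      then have cC: "c \<notin> C" using r10 a7 by simp
      show "wp w (gain_prog @ [Cond (Reg 14 \<^bold>< Reg 15) [SetReg 14 (Reg 15), SetReg 13 (Reg 10)] []])
        (3 + n * 3 + 3) (\<lambda>s'. regs s' 10 = c \<and> I (Suc c) (set_reg 10 (Suc c) s')) s"
      proof (rule wp_seq[OF wp_gain])
        show "marked C s" "regs s 10 = c" "c < n" using I r10 c by (auto simp: I_def)
      next
        fix s1 assume s1: "marked C s1 \<and> regs s1 10 = c \<and> regs s1 11 = regs s 11 \<and> regs s1 13 = regs s 13 \<and>
            regs s1 14 = regs s 14 \<and> arrs s1 1 = arrs s 1 \<and> regs s1 15 = Suc (?f c)"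
        have "wp w [Cond (Reg 14 \<^bold>< Reg 15) [SetReg 14 (Reg 15), SetReg 13 (Reg 10)] []] (Suc (Suc (Suc 0)))
          (\<lambda>s'. regs s' 10 = c \<and> I (Suc c) (set_reg 10 (Suc c) s')) s1"
        proof (rule wp_Cond, unfold append_Nil append_Nil2)
          assume "value_of w s1 (Reg 14 \<^bold>< Reg 15) \<noteq> 0"
          then have less: "regs s 14 < Suc (?f c)" using s1 by (auto simp: of_bool_def split: if_splits)
          have "?f c' < ?f c" if "c' < c" "c' \<notin> C" for c'
            using I less that by (fastforce simp: I_def)
          then show "wp w [SetReg 14 (Reg 15), SetReg 13 (Reg 10)] (Suc (Suc 0))
            (\<lambda>s'. regs s' 10 = c \<and> I (Suc c) (set_reg 10 (Suc c) s')) s1"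
            using s1 I cC by (intro wp_SetReg wp_Nil) (auto simp: I_def less_Suc_eq intro: less_imp_le)
        next
          assume "value_of w s1 (Reg 14 \<^bold>< Reg 15) = 0"
          then have le: "Suc (?f c) \<le> regs s 14" using s1 by (auto simp: of_bool_def split: if_splits)
          then have "?f c \<le> ?f (regs s 13)" using I by (auto simp: I_def)
          then show "wp w [] (Suc (Suc 0)) (\<lambda>s'. regs s' 10 = c \<and> I (Suc c) (set_reg 10 (Suc c) s')) s1"
            using s1 I le by (intro wp_time[OF wp_Nil]) (auto simp: I_def less_Suc_eq)
        qed
        then show "wp w [Cond (Reg 14 \<^bold>< Reg 15) [SetReg 14 (Reg 15), SetReg 13 (Reg 10)] []] 3
          (\<lambda>s'. regs s' 10 = c \<and> I (Suc c) (set_reg 10 (Suc c) s')) s1"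
          by (simp add: numeral_3_eq_3)
      qed (rule refl)+
    qed
  next
    fix s assume I: "I n s"
    have "\<not> (\<forall>c'<n. c' \<in> C)"
    proof
      assume "\<forall>c'<n. c' \<in> C"
      then have "C = {..<n}" using assms(4) by auto
      then show False using assms(5) by simp
    qed
    then have b: "regs s 13 < n" "regs s 13 \<notin> C" "\<forall>c'<n. c' \<notin> C \<longrightarrow> ?f c' \<le> ?f (regs s 13)"
      "\<forall>c'<regs s 13. c' \<notin> C \<longrightarrow> ?f c' < ?f (regs s 13)"
      using I by (auto simp: I_def)
    have "greedy_pick n Near Wide C = regs s 13"
      unfolding greedy_pick_def
    proof (rule Least_equality)
      fix y assume y: "y < n \<and> y \<notin> C \<and> (\<forall>c'<n. c' \<notin> C \<longrightarrow> ?f c' \<le> ?f y)"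
      then show "regs s 13 \<le> y" using b by (meson leD not_le_imp_less)
    qed (use b in auto)
    then show "marked C s \<and> regs s 11 = t \<and> arrs s 1 = a \<and> regs s 13 = greedy_pick n Near Wide C"
      using I by (simp add: I_def)
  qed (use n_less in \<open>auto simp: I_def\<close>)
qed

lemma wp_mark:
  assumes "marked C s" "regs s 11 = t" "regs s 13 = c" "c < n"
  shows "wp w mark_prog (4 + n * 4) (\<lambda>s'. marked (insert c C) s' \<and> regs s' 11 = t \<and>
    arrs s' 1 = (arrs s 1)(t := c)) s"
proof -
  define I where "I = (\<lambda>q s'. loaded s' \<and> regs s' 11 = t \<and> regs s' 13 = c \<and> arrs s' 1 = (arrs s 1)(t := c) \<and>
    (\<forall>q'<n. arrs s' 7 q' = of_bool (q' \<in> insert c C) \<and>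
      arrs s' 6 q' = of_bool (q' \<in> covers Wide C \<or> q' < q \<and> q' \<in> Wide c)))"
  have k: "16 * k < 2 ^ w" "16 * k + 1 < 2 ^ w" "3 * (16 * k + 1) < 2 ^ w"
    "3 * (16 * k + 1) * (\<rho> - 1) < 2 ^ w"
  proof -
    have "G > 0" using pos by simp
    then show 3: "3 * (16 * k + 1) < 2 ^ w"
      by (intro le_less_trans[OF _ bounds(8)]) simp
    show "16 * k < 2 ^ w" by (rule le_less_trans[OF _ 3]) simp
    show "16 * k + 1 < 2 ^ w" by (rule le_less_trans[OF _ 3]) simp
    show "3 * (16 * k + 1) * (\<rho> - 1) < 2 ^ w"
      by (rule le_less_trans[OF mult_le_mono2 bounds(8)]) (use \<rho>_le in simp)
  qed
  have E: "E p q * (16 * k - 1) < 2 ^ w" "E p q < 2 ^ w" for p q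
  proof -
    have "E p q * (16 * k - 1) \<le> (d * d) * (16 * k)" by (intro mult_le_mono E_le) simp
    then show "E p q * (16 * k - 1) < 2 ^ w" using bounds(9) by (simp add: mult.commute)
    have "d * d < 2 ^ w" by (rule le_less_trans[OF _ bounds(5)]) (use pos in simp)
    then show "E p q < 2 ^ w" using E_le[of p q] by linarith
  qed
  have wide_iff: "q \<in> Wide c \<longleftrightarrow> \<not> 3 * (16 * k + 1) * (\<rho> - 1) < E c q * (16 * k - 1)" if "q < n" for q
    using that by (auto simp: wide_def)
  show ?thesis unfolding mark_prog_def
  proof (rule wp_mono, rule wp_SetArr, rule wp_SetArr, rule wp_for)
    show "I 0 (set_reg 12 0 (set_arr 7 (value_of w (set_arr 1 (value_of w s (Reg 11)) (value_of w s (Reg 13)) s) (Reg 13))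
       (value_of w (set_arr 1 (value_of w s (Reg 11)) (value_of w s (Reg 13)) s) (Const 1))
       (set_arr 1 (value_of w s (Reg 11)) (value_of w s (Reg 13)) s)))"
      using assms marked_arrs[OF assms(1)] by (auto simp: I_def)
  next
    fix q s' assume q: "q < n" and I: "I q s'" and r12: "regs s' 12 = q"
    have a: "c * n + q < 2 ^ w" using index_less[OF assms(4) q] bounds(3) by linarith
    have v: "value_of w s' (Const 3 \<^bold>* (Const 16 \<^bold>* Reg 4 \<^bold>+ Const 1) \<^bold>* (Reg 24 \<^bold>- Const 1) \<^bold><
              Arr 5 (Reg 13 \<^bold>* Reg 0 \<^bold>+ Reg 12) \<^bold>* (Const 16 \<^bold>* Reg 4 \<^bold>- Const 1)) =
       of_bool (3 * (16 * k + 1) * (\<rho> - 1) < E c q * (16 * k - 1))"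
    proof -
      have v1: "value_of w s' (Arr 5 (Reg 13 \<^bold>* Reg 0 \<^bold>+ Reg 12)) = E c q"
        using I r12 q assms(4) a by (simp add: I_def)
      have v2: "value_of w s' (Const 16 \<^bold>* Reg 4) = 16 * k"
        using I k by (simp add: I_def)
      then have v3: "value_of w s' (Const 16 \<^bold>* Reg 4 \<^bold>- Const 1) = 16 * k - 1"
        using k by (subst value_of.simps(4)) simp
      have v4: "value_of w s' (Const 16 \<^bold>* Reg 4 \<^bold>+ Const 1) = 16 * k + 1"
        using k v2 by (subst value_of.simps(4)) simp
      then have v5: "value_of w s' (Const 3 \<^bold>* (Const 16 \<^bold>* Reg 4 \<^bold>+ Const 1)) = 3 * (16 * k + 1)"
        using k by (subst value_of.simps(4)) simp
      have v6: "value_of w s' (Reg 24 \<^bold>- Const 1) = \<rho> - 1"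
      proof -
        have "\<rho> - 1 \<le> 3 * (16 * k + 1) * (\<rho> - 1)" by simp
        then have "\<rho> - 1 < 2 ^ w" using k(4) by linarith
        then show ?thesis using I by (simp add: I_def)
      qed
      have v7: "value_of w s' (Const 3 \<^bold>* (Const 16 \<^bold>* Reg 4 \<^bold>+ Const 1) \<^bold>* (Reg 24 \<^bold>- Const 1)) =
          3 * (16 * k + 1) * (\<rho> - 1)"
        using k(4) v5 v6 by (subst value_of.simps(4)) (simp del: value_of.simps)
      have v8: "value_of w s' (Arr 5 (Reg 13 \<^bold>* Reg 0 \<^bold>+ Reg 12) \<^bold>* (Const 16 \<^bold>* Reg 4 \<^bold>- Const 1)) =
          E c q * (16 * k - 1)"
        using E v1 v3 by (subst value_of.simps(4)) (simp del: value_of.simps)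
      show ?thesis
        by (subst value_of.simps(4)) (simp only: v7 v8 apply_binop.simps literal_mod)
    qed
    have "wp w [Cond (Const 3 \<^bold>* (Const 16 \<^bold>* Reg 4 \<^bold>+ Const 1) \<^bold>* (Reg 24 \<^bold>- Const 1) \<^bold><
              Arr 5 (Reg 13 \<^bold>* Reg 0 \<^bold>+ Reg 12) \<^bold>* (Const 16 \<^bold>* Reg 4 \<^bold>- Const 1))
          [] [SetArr 6 (Reg 12) (Const 1)]] (Suc (Suc 0))
        (\<lambda>s'. regs s' 12 = q \<and> I (Suc q) (set_reg 12 (Suc q) s')) s'"
      by (rule wp_Cond; unfold append_Nil append_Nil2 v; intro wp_SetArr wp_Nil wp_time[OF wp_Nil])
        (use I r12 wide_iff[OF q] in \<open>auto simp: I_def less_Suc_eq simp del: mult_Suc_right\<close>)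
    then show "wp w [Cond (Const 3 \<^bold>* (Const 16 \<^bold>* Reg 4 \<^bold>+ Const 1) \<^bold>* (Reg 24 \<^bold>- Const 1) \<^bold><
              Arr 5 (Reg 13 \<^bold>* Reg 0 \<^bold>+ Reg 12) \<^bold>* (Const 16 \<^bold>* Reg 4 \<^bold>- Const 1))
          [] [SetArr 6 (Reg 12) (Const 1)]] 2
        (\<lambda>s'. regs s' 12 = q \<and> I (Suc q) (set_reg 12 (Suc q) s')) s'"
      by (simp add: numeral_2_eq_2)
  next
    fix s' assume "I n s'"
    then show "marked (insert c C) s' \<and> regs s' 11 = t \<and> arrs s' 1 = (arrs s 1)(t := c)"
      unfolding I_def marked_def by (auto simp: covers_def)
  qed (use n_less in \<open>auto simp: I_def\<close>)
qed

end

end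

section \<open>Greedy search for a radius\<close>

text \<open>The upper end is the sum of registers 22 and 23. The last radius tried may have failed,
  so a final run at the upper end leaves the right centers in array 1.\<close>

definition search_prog :: "instr list" where
  "search_prog =
     SetReg 22 (Const 0) # SetReg 23 (Reg 8) #
     [Loop (Const 1 \<^bold>< Reg 23)
       (SetReg 23 (Reg 23 \<^bold>div Const 2) # SetReg 24 (Reg 22 \<^bold>+ Reg 23) #
        greedy_prog @
        [Cond (Reg 15 \<^bold>< Reg 0 \<^bold>- Reg 3) [SetReg 22 (Reg 22 \<^bold>+ Reg 23)] []])] @
     SetReg 24 (Reg 22 \<^bold>+ Const 1) # greedy_prog"

definition greedy_time :: "nat \<Rightarrow> nat \<Rightarrow> nat" where
  "greedy_time n l = (2 + n * 4) + ((2 + l * ((4 + n * (9 + n * 3)) + (4 + n * 4) + 2)) + (3 + n * 3))"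

context ram begin

definition has_dist :: "(nat \<Rightarrow> nat \<Rightarrow> nat) \<Rightarrow> memory \<Rightarrow> bool" where
  "has_dist E s \<longleftrightarrow> (\<forall>p<n. \<forall>q<n. arrs s 5 (p * n + q) = E p q)"

lemma has_dist_set [simp]: "has_dist E (set_reg x v s) = has_dist E s"
  unfolding has_dist_def by simp

lemma wp_greedy:
  assumes E_le: "\<And>p q. E p q \<le> d * d" and \<rho>: "\<rho> \<le> G"
    and s: "params s" "regs s 22 = lo" "regs s 23 = gap" "regs s 24 = \<rho>" "has_dist E s"
  shows "wp w greedy_prog (greedy_time n l)
    (\<lambda>s. params s \<and> regs s 22 = lo \<and> regs s 23 = gap \<and> has_dist E s \<and>
      arrs s 1 ` {..<l} = chosen n k E \<rho> l \<and> regs s 15 = covered_num n k E l \<rho>) s"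
proof -
  let ?W = "wide n k E \<rho>"
  let ?C = "chosen n k E \<rho>"
  let ?loaded = "loaded E lo gap \<rho>"
  let ?marked = "marked E lo gap \<rho>"
  note set_simps = loaded_set[where E = E, OF E_le \<rho>] marked_set[where E = E, OF E_le \<rho>]
  note loaded_simps = loaded_regs[where E = E, OF E_le \<rho>]
  note marked_simps = marked_simps[where E = E, OF E_le \<rho>]
  have C: "?C t \<subseteq> {..<n}" "card (?C t) = t" if "t \<le> l" for t
    using greedy_subset_card[of t n] that pos by auto
  have l: "l < 2 ^ w" using n_less pos by linarith
  have ld: "?loaded s"
    unfolding loaded_def[where E = E, OF E_le \<rho>] using s(5)[unfolded has_dist_def] s(1-4) by auto
  define I0 where "I0 = (\<lambda>p s. ?loaded s \<and> (\<forall>q<p. arrs s 6 q = 0 \<and> arrs s 7 q = 0))"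
  define I where "I = (\<lambda>t s. ?marked (?C t) s \<and> arrs s 1 ` {..<t} = ?C t)"
  define J where "J = (\<lambda>p s. ?marked (?C l) s \<and> arrs s 1 ` {..<l} = ?C l \<and>
     regs s 15 = card {q. q < p \<and> q \<in> covers ?W (?C l)})"
  have init: "wp w (for_loop 10 (Reg 0) [SetArr 6 (Reg 10) (Const 0), SetArr 7 (Reg 10) (Const 0)])
     (2 + n * (2 + 2)) (I0 n) s"
  proof (rule wp_for)
    fix p s assume "p < n" "I0 p s" "regs s 10 = p"
    then show "wp w [SetArr 6 (Reg 10) (Const 0), SetArr 7 (Reg 10) (Const 0)] 2
       (\<lambda>s'. regs s' 10 = p \<and> I0 (Suc p) (set_reg 10 (Suc p) s')) s"
      by (intro wp_time[OF wp_SetArr[OF wp_SetArr[OF wp_Nil]]])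
        (auto simp: I0_def set_simps less_Suc_eq)
  qed (use ld n_less in \<open>auto simp: I0_def set_simps loaded_simps\<close>)
  have main: "wp w (for_loop 11 (Reg 2) (pick_prog @ mark_prog))
     (2 + l * (((4 + n * (9 + n * 3)) + (4 + n * 4)) + 2)) (I l) s1" if "I0 n s1" for s1
  proof (rule wp_for)
    show "I 0 (set_reg 11 0 s1)"
      using that unfolding I_def I0_def marked_def[where E = E, OF E_le \<rho>] by (simp add: covers_def set_simps)
  next
    fix t s2 assume t: "t < l" and I: "I t s2" and r11: "regs s2 11 = t"
    show "wp w (pick_prog @ mark_prog) ((4 + n * (9 + n * 3)) + (4 + n * 4))
      (\<lambda>s'. regs s' 11 = t \<and> I (Suc t) (set_reg 11 (Suc t) s')) s2"
    proof (rule wp_seq)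
      show "wp w pick_prog (4 + n * (9 + n * 3)) (\<lambda>s. ?marked (?C t) s \<and> regs s 11 = t \<and> arrs s 1 = arrs s2 1 \<and>
         regs s 13 = greedy_pick n (near n E \<rho>) ?W (?C t)) s2"
        using I r11 C[of t] t pos by (intro wp_pick[OF E_le \<rho>]) (auto simp: I_def)
    next
      fix s3 assume s3: "?marked (?C t) s3 \<and> regs s3 11 = t \<and> arrs s3 1 = arrs s2 1 \<and>
         regs s3 13 = greedy_pick n (near n E \<rho>) ?W (?C t)"
      have "greedy_pick n (near n E \<rho>) ?W (?C t) < n"
        using C[of t] t pos by (intro greedy_pick) auto
      then show "wp w mark_prog (4 + n * 4) (\<lambda>s'. regs s' 11 = t \<and> I (Suc t) (set_reg 11 (Suc t) s')) s3"
        using s3 I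
        by (intro wp_mono[OF wp_mark[OF E_le \<rho>, where C = "?C t" and t = t]])
          (auto simp: I_def set_simps lessThan_Suc)
    qed
  next
    fix t s2 assume "I t s2"
    then have "params s2" using marked_simps(2) unfolding I_def by blast
    then show "value_of w s2 (Reg 2) = l" by simp
  qed (use l in \<open>auto simp: I_def marked_simps\<close>)
  have count: "wp w (SetReg 15 (Const 0) # for_loop 10 (Reg 0) [SetReg 15 (Reg 15 \<^bold>+ Arr 6 (Reg 10))])
     (Suc (2 + n * (1 + 2))) (J n) s1" if "I l s1" for s1
  proof (rule wp_SetReg, rule wp_for)
    show "J 0 (set_reg 10 0 (set_reg 15 (value_of w s1 (Const 0)) s1))"
      using that by (simp add: I_def J_def set_simps)
  next
    fix p s2 assume p: "p < n" and J: "J p s2" and r10: "regs s2 10 = p"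
    have a6: "arrs s2 6 p = of_bool (p \<in> covers ?W (?C l))"
      using marked_arrs(2)[where E = E, OF E_le \<rho>] J p unfolding J_def by blast
    have "{q. q < Suc p \<and> q \<in> covers ?W (?C l)} =
      (if p \<in> covers ?W (?C l) then {p} else {}) \<union> {q. q < p \<and> q \<in> covers ?W (?C l)}"
      by (auto simp: less_Suc_eq)
    then have S: "card {q. q < Suc p \<and> q \<in> covers ?W (?C l)} =
       card {q. q < p \<and> q \<in> covers ?W (?C l)} + of_bool (p \<in> covers ?W (?C l))"
      by auto
    have "card {q. q < Suc p \<and> q \<in> covers ?W (?C l)} \<le> card {..<Suc p}"
      by (intro card_mono) auto
    then have "card {q. q < Suc p \<and> q \<in> covers ?W (?C l)} < 2 ^ w" using p n_less by simp
    then show "wp w [SetReg 15 (Reg 15 \<^bold>+ Arr 6 (Reg 10))] 1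
       (\<lambda>s'. regs s' 10 = p \<and> J (Suc p) (set_reg 10 (Suc p) s')) s2"
      using J r10 a6 S by (intro wp_time[OF wp_SetReg[OF wp_Nil]]) (auto simp: J_def set_simps)
  qed (use n_less in \<open>auto simp: J_def marked_simps\<close>)
  have "wp w greedy_prog ((2 + n * (2 + 2)) + ((2 + l * (((4 + n * (9 + n * 3)) + (4 + n * 4)) + 2)) +
      Suc (2 + n * (1 + 2)))) (J n) s"
    unfolding greedy_prog_def by (rule wp_seq[OF init], rule wp_seq[OF main], assumption, rule count)
  then show ?thesis
  proof (rule wp_mono)
    fix s1 assume J: "J n s1"
    have "{q. q < n \<and> q \<in> covers ?W (?C l)} = covers ?W (?C l)"
      by (auto simp: covers_def wide_def)
    moreover have "?loaded s1" using J marked_simps(1) unfolding J_def by blast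
    ultimately show "params s1 \<and> regs s1 22 = lo \<and> regs s1 23 = gap \<and> has_dist E s1 \<and>
      arrs s1 1 ` {..<l} = ?C l \<and> regs s1 15 = covered_num n k E l \<rho>"
      using J unfolding loaded_def[where E = E, OF E_le \<rho>] J_def has_dist_def covered_num_def by simp
  qed (simp add: greedy_time_def)
qed

text \<open>The invariant is failure at the lower end and success at the upper end, and either
  outcome of a test preserves it. The two initial ends are not tested themselves, whence the
  alternatives \<open>lo = 0\<close> and \<open>Suc lo = G\<close>.\<close>

lemma wp_search:
  assumes E_le: "\<And>p q. E p q \<le> d * d" and G: "G = 2 ^ K" and z: "z < n"
    and s: "params s" "has_dist E s"
  shows "wp w search_prog (4 + K * (5 + greedy_time n l) + greedy_time n l)
    (\<lambda>s. \<exists>lo. lo < G \<and> arrs s 1 ` {..<l} = chosen n k E (Suc lo) l \<and>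
      (lo = 0 \<or> covered_num n k E l lo < n - z) \<and>
      (Suc lo = G \<or> n - z \<le> covered_num n k E l (Suc lo))) s"
proof -
  let ?c = "covered_num n k E l"
  have G_less: "G < 2 ^ w"
    by (rule le_less_trans[OF _ bounds(8)]) simp
  define I where "I = (\<lambda>i s. i \<le> K \<and> params s \<and> has_dist E s \<and> regs s 23 = 2 ^ (K - i) \<and>
    regs s 22 + 2 ^ (K - i) \<le> G \<and> (regs s 22 = 0 \<or> ?c (regs s 22) < n - z) \<and>
    (regs s 22 + 2 ^ (K - i) = G \<or> n - z \<le> ?c (regs s 22 + 2 ^ (K - i))))"
  have zw: "n - z < 2 ^ w" using n_less by linarith
  let ?L = "[Loop (Const 1 \<^bold>< Reg 23)
       (SetReg 23 (Reg 23 \<^bold>div Const 2) # SetReg 24 (Reg 22 \<^bold>+ Reg 23) #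
        greedy_prog @
        [Cond (Reg 15 \<^bold>< Reg 0 \<^bold>- Reg 3) [SetReg 22 (Reg 22 \<^bold>+ Reg 23)] []])]"
  have loop: "wp w ?L (1 + K * ((Suc (Suc (greedy_time n l + 2))) + 1)) (I K) s1" if "I 0 s1" for s1
  proof (rule wp_Loop)
    show "I 0 s1" by fact
  next
    fix i s assume I: "I i s" and "value_of w s (Const 1 \<^bold>< Reg 23) \<noteq> 0"
    then have "1 < regs s 23" by (auto simp: of_bool_def split: if_splits)
    then have i: "i < K" using I by (cases "i = K") (auto simp: I_def)
    define lo where "lo = regs s 22"
    define h :: nat where "h = 2 ^ (K - Suc i)"
    have h: "2 ^ (K - i) = 2 * h" using i by (simp add: h_def flip: power_Suc add: Suc_diff_Suc)
    have I': "params s" "has_dist E s" "regs s 23 = 2 * h" "lo + 2 * h \<le> G" "lo = 0 \<or> ?c lo < n - z"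
      "lo + 2 * h = G \<or> n - z \<le> ?c (lo + 2 * h)"
      using I unfolding I_def h lo_def by auto
    show "i < K \<and> wp w (SetReg 23 (Reg 23 \<^bold>div Const 2) # SetReg 24 (Reg 22 \<^bold>+ Reg 23) #
        greedy_prog @
        [Cond (Reg 15 \<^bold>< Reg 0 \<^bold>- Reg 3) [SetReg 22 (Reg 22 \<^bold>+ Reg 23)] []])
        (Suc (Suc (greedy_time n l + 2))) (I (Suc i)) s"
    proof (intro conjI i wp_SetReg)
      let ?s = "set_reg 23 (value_of w s (Reg 23 \<^bold>div Const 2)) s"
      have v1: "value_of w s (Reg 23 \<^bold>div Const 2) = h" using I' G_less by simp
      have v2: "value_of w ?s (Reg 22 \<^bold>+ Reg 23) = lo + h"
        unfolding v1 using I' G_less by (simp add: lo_def)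
      show "wp w (greedy_prog @ [Cond (Reg 15 \<^bold>< Reg 0 \<^bold>- Reg 3) [SetReg 22 (Reg 22 \<^bold>+ Reg 23)] []])
         (greedy_time n l + 2) (I (Suc i)) (set_reg 24 (value_of w ?s (Reg 22 \<^bold>+ Reg 23)) ?s)"
        unfolding v2 unfolding v1
      proof (rule wp_seq[OF wp_greedy[OF E_le, where \<rho> = "lo + h" and lo = lo and gap = h]])
        fix s1
        assume s1: "params s1 \<and> regs s1 22 = lo \<and> regs s1 23 = h \<and> has_dist E s1 \<and>
          arrs s1 1 ` {..<l} = chosen n k E (lo + h) l \<and> regs s1 15 = ?c (lo + h)"
        have v: "(lo + h) mod 2 ^ w = lo + h" "(n - z) mod 2 ^ w = n - z" using I' G_less zw by auto
        have "wp w [Cond (Reg 15 \<^bold>< Reg 0 \<^bold>- Reg 3) [SetReg 22 (Reg 22 \<^bold>+ Reg 23)] []] (Suc (Suc 0)) (I (Suc i)) s1"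
          by (rule wp_Cond; unfold append_Nil append_Nil2; intro wp_SetReg wp_Nil wp_time[OF wp_Nil])
            (use s1 I' i v in \<open>auto simp: I_def h_def[symmetric] not_less add.assoc mult_2\<close>)
        then show "wp w [Cond (Reg 15 \<^bold>< Reg 0 \<^bold>- Reg 3) [SetReg 22 (Reg 22 \<^bold>+ Reg 23)] []] 2 (I (Suc i)) s1"
          by (simp add: numeral_2_eq_2)
      qed (use I' in \<open>auto simp: lo_def\<close>)
    qed
  next
    fix i s assume i: "i \<le> K" and I: "I i s" and "value_of w s (Const 1 \<^bold>< Reg 23) = 0"
    then have "regs s 23 \<le> 1" by (auto simp: of_bool_def split: if_splits)
    then have "2 ^ (K - i) \<le> (2::nat) ^ 0" using I by (simp add: I_def)
    then have "i = K" using i by (subst (asm) power_increasing_iff) auto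
    then show "I K s" using I by simp
  qed
  have final: "wp w (SetReg 24 (Reg 22 \<^bold>+ Const 1) # greedy_prog) (Suc (greedy_time n l))
    (\<lambda>s. \<exists>lo. lo < G \<and> arrs s 1 ` {..<l} = chosen n k E (Suc lo) l \<and>
      (lo = 0 \<or> ?c lo < n - z) \<and> (Suc lo = G \<or> n - z \<le> ?c (Suc lo))) s1" if I: "I K s1" for s1
  proof (rule wp_SetReg)
    define lo where "lo = regs s1 22"
    have I': "params s1" "has_dist E s1" "Suc lo \<le> G" "lo = 0 \<or> ?c lo < n - z"
      "Suc lo = G \<or> n - z \<le> ?c (Suc lo)"
      using I unfolding I_def lo_def by auto
    have v: "value_of w s1 (Reg 22 \<^bold>+ Const 1) = Suc lo" using I' G_less by (simp add: lo_def)
    show "wp w greedy_prog (greedy_time n l)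
      (\<lambda>s. \<exists>lo. lo < G \<and> arrs s 1 ` {..<l} = chosen n k E (Suc lo) l \<and>
      (lo = 0 \<or> ?c lo < n - z) \<and> (Suc lo = G \<or> n - z \<le> ?c (Suc lo))) (set_reg 24 (value_of w s1 (Reg 22 \<^bold>+ Const 1)) s1)"
      unfolding v
      by (rule wp_mono[OF wp_greedy[OF E_le, where \<rho> = "Suc lo"]])
        (use I' in \<open>auto intro!: exI[of _ lo]\<close>)
  qed
  have "wp w (SetReg 22 (Const 0) # SetReg 23 (Reg 8) # ?L @ SetReg 24 (Reg 22 \<^bold>+ Const 1) # greedy_prog)
    (Suc (Suc ((1 + K * ((Suc (Suc (greedy_time n l + 2))) + 1)) + Suc (greedy_time n l))))
    (\<lambda>s. \<exists>lo. lo < G \<and> arrs s 1 ` {..<l} = chosen n k E (Suc lo) l \<and>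
      (lo = 0 \<or> ?c lo < n - z) \<and> (Suc lo = G \<or> n - z \<le> ?c (Suc lo))) s"
    by (rule wp_SetReg, rule wp_SetReg, rule wp_seq[OF loop final]) (use s G[symmetric] in \<open>auto simp: I_def\<close>)
  then show ?thesis
    unfolding search_prog_def by (rule wp_mono) (auto simp: algebra_simps)
qed

end

section \<open>Parameters and random words\<close>

definition clog :: "nat \<Rightarrow> nat" where
  "clog N = (LEAST e. N \<le> 2 ^ e)"

lemma clog_ge: "N \<le> 2 ^ clog N"
  unfolding clog_def by (rule LeastI[of _ N]) (simp add: less_imp_le)

lemma less_clog: "i < clog N \<Longrightarrow> 2 ^ i < N"
  unfolding clog_def using not_less_Least not_le by blast

lemma clog_less_double: "N > 0 \<Longrightarrow> 2 ^ clog N < 2 * N"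
  using less_clog[of "clog N - 1" N] by (cases "clog N") auto

lemma set_reg_twice [simp]: "set_reg x u (set_reg x v s) = set_reg x u s"
  by (simp add: set_reg_def)

lemma set_reg_swap: "x \<noteq> y \<Longrightarrow> set_reg x u (set_reg y v s) = set_reg y v (set_reg x u s)"
  by (simp add: set_reg_def fun_upd_twist)

definition double_prog :: "nat \<Rightarrow> nat \<Rightarrow> expr \<Rightarrow> instr list" where
  "double_prog x y e =
     [SetReg x (Const 1), SetReg y (Const 0),
      Loop (Reg x \<^bold>< e) [SetReg x (Reg x \<^bold>+ Reg x), SetReg y (Reg y \<^bold>+ Const 1)]]"

lemma wp_double:
  assumes e: "\<And>u v. value_of w (set_reg y v (set_reg x u s)) e = N"
    and N: "N > 0" "2 * N < 2 ^ w" and xy: "x \<noteq> y"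
    and Q: "Q (set_reg y (clog N) (set_reg x (2 ^ clog N) s))"
  shows "wp w (double_prog x y e) (3 + clog N * 3) Q s"
proof -
  define I where "I = (\<lambda>i s'. i \<le> clog N \<and> s' = set_reg y i (set_reg x (2 ^ i) s))"
  have w: "w \<noteq> 0" using N by (cases w) auto
  then have w1: "Suc 0 mod 2 ^ w = Suc 0" "(2::nat) ^ w \<noteq> Suc 0" by auto
  have "wp w [Loop (Reg x \<^bold>< e) [SetReg x (Reg x \<^bold>+ Reg x), SetReg y (Reg y \<^bold>+ Const 1)]]
     (1 + clog N * (2 + 1)) Q (set_reg y 0 (set_reg x 1 s))"
  proof (rule wp_Loop)
    show "I 0 (set_reg y 0 (set_reg x 1 s))" by (simp add: I_def)
  next
    fix i s' assume I: "I i s'" and "value_of w s' (Reg x \<^bold>< e) \<noteq> 0"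
    then have less: "2 ^ i < N" using e xy by (auto simp: I_def of_bool_def split: if_splits)
    then have i: "i < clog N" using I clog_ge[of N] by (cases "i = clog N") (auto simp: I_def)
    have "Suc i < 2 ^ Suc i" by (rule less_exp)
    then have b: "(2::nat) * 2 ^ i < 2 ^ w" "Suc i < 2 ^ w" using less N by auto
    show "i < clog N \<and> wp w [SetReg x (Reg x \<^bold>+ Reg x), SetReg y (Reg y \<^bold>+ Const 1)] 2 (I (Suc i)) s'"
      by (intro conjI i wp_time[OF wp_SetReg[OF wp_SetReg[OF wp_Nil]]])
        (use I i b w1 xy in \<open>auto simp: I_def set_reg_swap[of x y] mult_2\<close>)
  next
    fix i s' assume i: "I i s'" and "value_of w s' (Reg x \<^bold>< e) = 0"
    then have "N \<le> 2 ^ i" using e xy w by (auto simp: I_def of_bool_def split: if_splits)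
    then have "i = clog N" using i less_clog[of i N] unfolding I_def by linarith
    then show "Q s'" using Q i by (simp add: I_def)
  qed
  then have "wp w (double_prog x y e) (Suc (Suc (1 + clog N * (2 + 1)))) Q s"
    unfolding double_prog_def using w1 by (intro wp_SetReg) simp
  then show ?thesis by (rule wp_time) simp
qed

text \<open>\<open>2 * m\<close> is the least power of two that is at least
  \<open>16384 k^2\<close>, so \<open>m \<ge> 8192 k^2\<close>, which meets the requirement
  \<open>7680 k^2\<close>. \<open>R = (clog n + 1) * b\<close> makes \<open>2 ^ R\<close> at least
  \<open>n ^ b\<close>, and register 8 receives a power of two above the cap
  \<open>d * d\<close>.\<close>

definition setup_prog :: "nat \<Rightarrow> instr list" where
  "setup_prog b =
     double_prog 5 9 (Const 16384 \<^bold>* (Reg 4 \<^bold>* Reg 4)) @ SetReg 6 (Reg 5 \<^bold>div Const 2) #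
     double_prog 9 7 (Reg 0) @ SetReg 7 ((Reg 7 \<^bold>+ Const 1) \<^bold>* Const b) #
     double_prog 8 9 (Reg 1 \<^bold>* Reg 1 \<^bold>+ Const 1)"

lemma wp_setup:
  assumes n: "regs s 0 = n" "n > 0" "2 * n < 2 ^ w" and d: "regs s 1 = d" "2 * (d * d + 1) < 2 ^ w"
    and k: "regs s 4 = k" "k > 0" "2 * (16384 * (k * k)) < 2 ^ w"
    and b: "b < 2 ^ w" "(clog n + 1) * b < 2 ^ w"
  shows "wp w (setup_prog b) (11 + 3 * clog (16384 * (k * k)) + 3 * clog n + 3 * clog (d * d + 1))
    (\<lambda>s'. arrs s' = arrs s \<and> regs s' 0 = n \<and> regs s' 1 = d \<and> regs s' 2 = regs s 2 \<and>
      regs s' 3 = regs s 3 \<and> regs s' 4 = k \<and>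
      regs s' 5 = 2 ^ clog (16384 * (k * k)) \<and> regs s' 6 = 2 ^ clog (16384 * (k * k)) div 2 \<and>
      regs s' 7 = (clog n + 1) * b \<and> regs s' 8 = 2 ^ clog (d * d + 1)) s"
proof -
  have "1 * 1 \<le> k * k" using k by (intro mult_le_mono) auto
  then have c: "2 ^ w > (16384 :: nat)" "k * k < 2 ^ w" using k by linarith+
  then have "w \<noteq> 0" by (cases w) auto
  then have c2: "2 mod 2 ^ w = (2::nat)" "Suc 0 mod 2 ^ w = Suc 0" "16384 mod 2 ^ w = (16384::nat)"
    using c by auto
  have dd: "d * d < 2 ^ w" "Suc (d * d) < 2 ^ w" using d by auto
  have cn: "Suc (clog n) < 2 ^ w"
  proof -
    have "clog n < 2 ^ clog n" by (rule less_exp)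
    then show ?thesis using clog_less_double[of n] n by linarith
  qed
  have p: "(2::nat) ^ clog (16384 * (k * k)) < 2 ^ w"
    by (rule less_trans[OF clog_less_double]) (use k in simp_all)
  have p2: "2 ^ clog (16384 * (k * k)) div 2 < (2::nat) ^ w"
    using p by linarith
  show ?thesis unfolding setup_prog_def
    apply (rule wp_time)
     apply (rule wp_append)
     apply (rule wp_double[where N = "16384 * (k * k)"])
         apply (use k c c2 in simp)
        apply (use k in simp)
       apply (use k in simp)
      apply simp
     apply (rule wp_SetReg)
     apply (rule wp_append)
     apply (rule wp_double[where N = n])
         apply (use n in simp)
        apply (use n in simp)
       apply (use n in simp)
      apply simp
     apply (rule wp_SetReg)
     apply (rule wp_double[where N = "d * d + 1"])
         apply (use d c2 dd in simp)
        apply simp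
       apply (use d in simp)
      apply simp
     apply (use assms c2 cn p p2 in \<open>simp add: mult.commute\<close>)
    apply simp
    done
qed

text \<open>Register 27 is cleared after each draw, so that the memory depends on the random words
  through array 2 alone.\<close>

definition fill_prog :: "instr list" where
  "fill_prog =
     [SetReg 27 (Const 0), SetReg 26 (Const 0),
      Loop (Reg 26 \<^bold>< Reg 7 \<^bold>* Reg 1)
        [Random 27, SetArr 2 (Reg 26) (Reg 27), SetReg 27 (Const 0), SetReg 26 (Reg 26 \<^bold>+ Const 1)]]"

definition filled :: "memory \<Rightarrow> nat \<Rightarrow> (nat \<Rightarrow> nat) \<Rightarrow> memory" where
  "filled s a g = s\<lparr>regs := (regs s)(27 := 0, 26 := a), arrs := (arrs s)(2 := g)\<rparr>"

lemma fill_Suc_left: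
  "fill w a (Suc j) f = bind_pmf (pmf_of_set {..<2 ^ w}) (\<lambda>v. fill w (Suc a) j (f(a := v)))"
  using fill_add[of w a 1 j f] by (simp add: bind_return_pmf bind_map_pmf)

text \<open>Each pass takes five steps whatever word is drawn, so all branches finish simultaneously
  and the law of the configuration is an image of \<open>fill\<close>. The induction peels off the
  first cell, as the loop does.\<close>

lemma steps_fill_loop:
  assumes N: "regs s 7 * regs s 1 = N" "N < 2 ^ w" and a: "a + j = N"
  shows "steps w (5 * j + 1)
     (Loop (Reg 26 \<^bold>< Reg 7 \<^bold>* Reg 1)
        [Random 27, SetArr 2 (Reg 26) (Reg 27), SetReg 27 (Const 0), SetReg 26 (Reg 26 \<^bold>+ Const 1)] # rest,
      filled s a f) =
    map_pmf (\<lambda>g. (rest, filled s N g)) (fill w a j f)"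
  using a
proof (induction j arbitrary: a f)
  case 0
  then show ?case using N by (simp add: filled_def bind_return_pmf)
next
  case (Suc j)
  have w: "w \<noteq> 0" using N(2) Suc.prems by (cases w) auto
  have vals: "regs s 7 * regs s (Suc 0) = N" "N mod 2 ^ w = N" "Suc a mod 2 ^ w = Suc a"
    "Suc 0 mod 2 ^ w = Suc 0" "a < N"
    using N Suc.prems w by auto
  have eq: "set_reg 26 (Suc a) (set_reg 27 0 (set_arr 2 a v (set_reg 27 v (filled s a f)))) =
     filled s (Suc a) (f(a := v))" for v
    by (simp add: filled_def set_reg_def set_arr_def fun_upd_twist)
  have t: "5 * Suc j + 1 = Suc (Suc (Suc (Suc (Suc (5 * j + 1)))))" by simp
  have val: "value_of w (filled s a f) (Reg 26 \<^bold>< Reg 7 \<^bold>* Reg 1) \<noteq> 0"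
    using vals w by (simp add: filled_def)
  have inc: "value_of w (set_reg 27 0 (set_arr 2 a v (set_reg 27 v (filled s a f)))) (Reg 26 \<^bold>+ Const (Suc 0)) = Suc a" for v
    using vals by (simp add: filled_def)
  have r26: "regs (filled s a f) 26 = a" by (simp add: filled_def)
  have IH: "a' + j = N \<Longrightarrow> steps w (Suc (5 * j))
     (Loop (Reg 26 \<^bold>< Reg 7 \<^bold>* Reg (Suc 0))
        [Random 27, SetArr 2 (Reg 26) (Reg 27), SetReg 27 (Const 0), SetReg 26 (Reg 26 \<^bold>+ Const (Suc 0))] # rest,
      filled s a' f') = map_pmf (\<lambda>g. (rest, filled s N g)) (fill w a' j f')" for a' f'
    using Suc.IH[of a' f'] by simp
  show ?case
    unfolding t fill_Suc_left
    using val Suc.prems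
    by (simp add: bind_return_pmf bind_map_pmf map_bind_pmf inc r26 eq IH del: value_of.simps(4) fill.simps(2) steps.simps(2)
        add: steps.simps(2)[of w "Suc _"])
qed

section \<open>Quality of the centers\<close>

text \<open>More than half of the estimates are good. If a qualifying value lay below the good
  range, all good estimates would exceed it, which is too many. The largest good estimate qualifies,
  since only bad ones exceed it. The cap is at least \<open>h\<close> and so not below the
  range.\<close>

lemma low_median_approx:
  fixes h K :: real
  assumes bad: "2 * card {j. j < R \<and> \<not> \<bar>real (f j) - h\<bar> * K \<le> h} < R"
    and K: "K > 0" and h: "0 \<le> h" "h \<le> D"
  shows "\<bar>real (low_median f D R) - h\<bar> * K \<le> h"
proof -
  define ok where "ok = (\<lambda>j. \<bar>real (f j) - h\<bar> * K \<le> h)"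
  have ok_iff: "\<bar>y - h\<bar> * K \<le> h \<longleftrightarrow> h - h / K \<le> y \<and> y \<le> h + h / K" for y
  proof -
    have "\<bar>y - h\<bar> * K \<le> h \<longleftrightarrow> \<bar>y - h\<bar> \<le> h / K" using K by (simp add: field_simps)
    then show ?thesis by (auto simp: abs_le_iff)
  qed
  let ?S = "insert D {f j | j. j < R \<and> 2 * card {i. i < R \<and> f j < f i} < R}"
  have fin: "finite ?S" by auto
  have "card {j. j < R \<and> ok j} + card {j. j < R \<and> \<not> ok j} = card ({j. j < R \<and> ok j} \<union> {j. j < R \<and> \<not> ok j})"
    by (rule card_Un_disjoint[symmetric]) auto
  also have "{j. j < R \<and> ok j} \<union> {j. j < R \<and> \<not> ok j} = {..<R}" by auto
  finally have good: "R < 2 * card {j. j < R \<and> ok j}" using bad by (simp add: ok_def)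
  have low: "h - h / K \<le> real y" if "y \<in> ?S" for y
  proof (rule ccontr)
    assume neg: "\<not> h - h / K \<le> real y"
    have "h / K \<ge> 0" using h K by simp
    then have "y \<noteq> D" using neg h by auto
    with that obtain j where j: "y = f j" "2 * card {i. i < R \<and> f j < f i} < R" by auto
    have "{i. i < R \<and> ok i} \<subseteq> {i. i < R \<and> f j < f i}"
      using neg j(1) by (auto simp: ok_def ok_iff)
    then have "card {i. i < R \<and> ok i} \<le> card {i. i < R \<and> f j < f i}" by (intro card_mono) auto
    then show False using j(2) good by linarith
  qed
  have up: "\<exists>y\<in>?S. real y \<le> h + h / K"
  proof -
    have ne: "{j. j < R \<and> ok j} \<noteq> {}" using good by (metis card.empty mult_0_right not_less_zero)
    then have "Max (f ` {j. j < R \<and> ok j}) \<in> f ` {j. j < R \<and> ok j}" by (intro Max_in) auto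
    then obtain j where j: "j < R" "ok j" "f j = Max (f ` {j. j < R \<and> ok j})" by auto
    have "f i \<le> f j" if "i < R" "ok i" for i
      unfolding j(3) using that by (intro Max_ge) auto
    then have "{i. i < R \<and> f j < f i} \<subseteq> {j. j < R \<and> \<not> ok j}"
      by (auto simp: not_le[symmetric])
    then have "card {i. i < R \<and> f j < f i} \<le> card {j. j < R \<and> \<not> ok j}" by (intro card_mono) auto
    then have "2 * card {i. i < R \<and> f j < f i} < R" using bad unfolding ok_def by linarith
    then have "f j \<in> ?S" using j(1) by blast
    moreover have "real (f j) \<le> h + h / K" using j(2) by (simp add: ok_def ok_iff)
    ultimately show ?thesis by blast
  qed
  from up obtain y where y: "y \<in> ?S" "real y \<le> h + h / K" by blast
  have "low_median f D R \<le> y" unfolding low_median_def using fin y by (intro Min_le) auto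
  moreover have "low_median f D R \<in> ?S" unfolding low_median_def using fin by (intro Min_in) auto
  then have "h - h / K \<le> real (low_median f D R)" by (rule low)
  ultimately show ?thesis unfolding ok_iff using y by linarith
qed

context ram begin

text \<open>Both points use the same hash values, so by linearity the differences of their counts
  form the sketch of the difference vector.\<close>

lemma est_eq_sketch:
  assumes "p < n" "q < n"
  shows "real (est m j p q) =
    sketch_sq m (\<lambda>i. real (A (p * d + i)) - real (A (q * d + i))) g (j * d) d"
  unfolding est_def sketch_sq_def of_nat_sum
proof (rule sum.cong[OF refl])
  fix b
  let ?x = "\<lambda>i. real (A (p * d + i)) - real (A (q * d + i))"
  have row: "real (cell (j * n + p) d u) =
      (\<Sum>i<d. real (A (p * d + i)) * of_bool (g (j * d + i) mod (2 * m) = u))" if "p < n" for p u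
    using that unfolding cell_def of_nat_sum by (intro sum.cong) auto
  let ?X = "cell (j * n + p) d b + cell (j * n + q) d (b + m)"
  let ?Y = "cell (j * n + q) d b + cell (j * n + p) d (b + m)"
  have "real ?X - real ?Y = bucket_sum m ?x g (j * d) d b"
    unfolding of_nat_add row[OF assms(1)] row[OF assms(2)] bucket_sum_def
      sum.distrib[symmetric] sum_subtractf[symmetric]
    by (intro sum.cong) (auto simp: bucket_sign_def)
  moreover have "real (deviation j p q b) = \<bar>real ?X - real ?Y\<bar>"
    unfolding deviation_def by linarith
  ultimately show "real (deviation j p q b * deviation j p q b) = (bucket_sum m ?x g (j * d) d b)\<^sup>2"
    by (simp add: power2_eq_square)
qed

lemma dist_approx:
  assumes pq: "p < n" "q < n"
    and x: "x = (\<lambda>i. real (A (p * d + i)) - real (A (q * d + i)))" "h = (\<Sum>i<d. (x i)\<^sup>2)"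
    and fails: "2 * card {j. j < R \<and> sketch_fails k m x g (j * d) d} < R"
  shows "\<bar>real (dist p q) - h\<bar> * (16 * real k) \<le> h"
  unfolding dist_def
proof (rule low_median_approx)
  have x_le: "(x i)\<^sup>2 \<le> 1" for i
    using A_le[of "p * d + i"] A_le[of "q * d + i"] by (auto simp: x(1) le_Suc_eq)
  then have "h \<le> (\<Sum>i<d. 1)" unfolding x(2) by (intro sum_mono)
  also have "\<dots> \<le> real (d * d)" by (cases d) auto
  finally show "h \<le> real (d * d)" .
  show "0 \<le> h" unfolding x(2) by (intro sum_nonneg) auto
  show "2 * card {j. j < R \<and> \<not> \<bar>real (est m j p q) - h\<bar> * (16 * real k) \<le> h} < R"
    using fails by (simp add: est_eq_sketch[OF pq] sketch_fails_def x)
qed (use pos in simp)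

end

lemma center_dist_le: "finite T \<Longrightarrow> t \<in> T \<Longrightarrow> center_dist T p \<le> ham t p"
  unfolding center_dist_def by (intro Min_le) auto

lemma center_dist_attained:
  assumes "finite T" "T \<noteq> {}"
  obtains t where "t \<in> T" "center_dist T p = ham t p"
proof -
  have "center_dist T p \<in> (\<lambda>t. ham t p) ` T"
    unfolding center_dist_def using assms by (intro Min_in) auto
  then show thesis using that by blast
qed

text \<open>The greedy algorithm succeeds at any radius above the estimates of all pairs at distance
  at most \<open>r\<close>, because the near balls of \<open>Opt\<close> then contain all points
  covered by \<open>T\<close>. So a failure at \<open>lo\<close> bounds \<open>lo\<close> by about
  \<open>r\<close>, and success at \<open>Suc lo\<close> provides the centers.\<close>

lemma covered_chosen:
  fixes E :: "nat \<Rightarrow> nat \<Rightarrow> nat" and r eps :: real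
  assumes P: "distinct ps" "length ps = n" "\<And>p. p \<in> set ps \<Longrightarrow> length p = d"
    and z: "z < n" and T: "T \<subseteq> set ps" "card T = l" "l > 0" "n - z \<le> card (covered (set ps) T r)"
    and k: "k \<ge> 2" "1 / real k \<le> eps"
    and approx: "\<And>p q. p < n \<Longrightarrow> q < n \<Longrightarrow>
      \<bar>real (E p q) - ham (ps ! p) (ps ! q)\<bar> * (16 * real k) \<le> ham (ps ! p) (ps ! q)"
    and lo: "lo = 0 \<or> covered_num n k E l lo < n - z"
      "n - z \<le> covered_num n k E l (Suc lo) \<or> (\<forall>p<n. \<forall>q<n. E p q < Suc lo)"
  shows "n - z \<le> card (covered (set ps) ((!) ps ` chosen n k E (Suc lo) l) ((3 + eps) * r))"
proof -
  \<comment> \<open>The value 0 outside the index range makes \<open>H\<close> symmetric without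
    side conditions, as \<open>chosen_success\<close> requires.\<close>
  define H where "H = (\<lambda>p q. if p < n \<and> q < n then real (ham (ps ! p) (ps ! q)) else 0)"
  have len: "length (ps ! p) = d" if "p < n" for p using that P by simp
  have sym: "H p q = H q p" for p q
    using ham_sym[of "ps ! p" "ps ! q"] len by (auto simp: H_def)
  have tri: "H p s \<le> H p q + H q s" if "p < n" "q < n" "s < n" for p q s
    using ham_triangle[of "ps ! p" "ps ! q" "ps ! s"] len that by (simp add: H_def)
  have appr: "\<bar>real (E p q) - H p q\<bar> * (16 * real k) \<le> H p q" if "p < n" "q < n" for p q
    using approx[OF that] that by (simp add: H_def)
  have finT: "finite T" "T \<noteq> {}" using T by (auto intro: card_ge_0_finite)
  \<comment> \<open>A covered point exists because \<open>z < n\<close>, and its nonnegative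
    distance forces \<open>0 \<le> r\<close>.\<close>
  have "covered (set ps) T r \<noteq> {}" using T(4) z by auto
  then obtain p0 where "real (center_dist T p0) \<le> r" by (auto simp: covered_def)
  then have r: "0 \<le> r" by linarith
  define Opt where "Opt = {i. i < n \<and> ps ! i \<in> T}"
  have bij: "bij_betw ((!) ps) {..<n} (set ps)" using P by (intro bij_betw_nth) auto
  have inj: "inj_on ((!) ps) {..<n}" using bij by (rule bij_betw_imp_inj_on)
  have im: "(!) ps ` Opt = T"
    using T(1) P(2) by (auto simp: Opt_def in_set_conv_nth image_iff) (metis in_set_conv_nth subsetD)
  have Opt1: "Opt \<subseteq> {..<n}" by (auto simp: Opt_def)
  have "card Opt = l"
    using card_image[OF inj_on_subset[OF inj Opt1]] im T(2) by simp
  note Opt = Opt1 this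
  have success: "n - z \<le> covered_num n k E l \<rho>"
    if \<rho>: "\<And>p q. p < n \<Longrightarrow> q < n \<Longrightarrow> H p q \<le> r \<Longrightarrow> E p q < \<rho>" for \<rho>
  proof -
    have "covered (set ps) T r \<subseteq> (!) ps ` covers (near n E \<rho>) Opt"
    proof
      fix p assume "p \<in> covered (set ps) T r"
      then have p: "p \<in> set ps" "real (center_dist T p) \<le> r" by (auto simp: covered_def)
      obtain t where t: "t \<in> T" "center_dist T p = ham t p" using center_dist_attained[OF finT] .
      obtain i where i: "i < n" "p = ps ! i" using p(1) P(2) by (auto simp: in_set_conv_nth)
      obtain c where c: "c \<in> Opt" "t = ps ! c" using t(1) im by auto
      have "E c i < \<rho>" using \<rho>[of c i] p t c i by (auto simp: H_def Opt_def)
      then have "i \<in> covers (near n E \<rho>) Opt" using c i by (auto simp: covers_def near_def)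
      then show "p \<in> (!) ps ` covers (near n E \<rho>) Opt" using i by blast
    qed
    moreover have fin: "finite (covers (near n E \<rho>) Opt)"
      by (rule finite_subset[of _ "{..<n}"]) (auto simp: covers_def near_def)
    ultimately have "card (covered (set ps) T r) \<le> card (covers (near n E \<rho>) Opt)"
      by (meson card_image_le card_mono finite_imageI le_trans)
    also have "\<dots> \<le> covered_num n k E (card Opt) \<rho>"
      by (rule chosen_success[where H = H]) (use appr sym tri Opt k in auto)
    finally show ?thesis using T(4) Opt by simp
  qed
  have E_le: "real (E p q) * (16 * real k) \<le> (16 * real k + 1) * r" if "p < n" "q < n" "H p q \<le> r" for p q
  proof -
    have "(real (E p q) - H p q) * (16 * real k) \<le> \<bar>real (E p q) - H p q\<bar> * (16 * real k)"
      by (intro mult_right_mono) auto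
    also have "\<dots> \<le> H p q" by (rule appr[OF that(1,2)])
    finally have "real (E p q) * (16 * real k) \<le> (16 * real k + 1) * H p q" by (simp add: algebra_simps)
    also have "\<dots> \<le> (16 * real k + 1) * r" using that(3) by (intro mult_left_mono) auto
    finally show ?thesis .
  qed
  have lo_le: "real lo * (16 * real k) \<le> (16 * real k + 1) * r"
  proof (cases "lo = 0")
    case False
    \<comment> \<open>The failure yields a pair at distance at most \<open>r\<close> whose estimate
      is at least \<open>lo\<close>.\<close>
    then have "\<not> n - z \<le> covered_num n k E l lo" using lo by auto
    then obtain p q where pq: "p < n" "q < n" "H p q \<le> r" "\<not> E p q < lo" using success by blast
    then have "real lo * (16 * real k) \<le> real (E p q) * (16 * real k)"
      by (intro mult_right_mono) auto
    then show ?thesis using E_le[OF pq(1-3)] by linarith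
  qed (use r in auto)
  have suc: "n - z \<le> covered_num n k E l (Suc lo)" using lo(2) success by blast
  let ?C = "chosen n k E (Suc lo) l" and ?W = "wide n k E (Suc lo)"
  have "l \<le> n" using card_mono[OF _ Opt(1)] Opt(2) by simp
  then have C: "?C \<subseteq> {..<n}" using greedy_subset_card by blast
  have finC: "finite ?C" by (rule finite_subset[OF C]) simp
  have "(!) ps ` covers ?W ?C \<subseteq> covered (set ps) ((!) ps ` ?C) ((3 + eps) * r)"
  proof
    fix p assume "p \<in> (!) ps ` covers ?W ?C"
    then obtain c q where c: "c \<in> ?C" "q \<in> ?W c" "p = ps ! q" by (auto simp: covers_def)
    \<comment> \<open>\<open>wide\<close> at \<open>Suc lo\<close> compares with \<open>lo\<close>
      itself, so the bound on the failed radius applies without loss.\<close>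
    then have cq: "c < n" "q < n" "E c q * (16 * k - 1) \<le> 3 * (16 * k + 1) * lo"
      using C by (auto simp: wide_def)
    have "H c q \<le> (3 + eps) * r"
      by (rule wide_radius[OF appr[OF cq(1,2)] _ cq(3) lo_le k r]) (simp add: H_def)
    moreover have "center_dist ((!) ps ` ?C) p \<le> ham (ps ! c) (ps ! q)"
      unfolding c(3) using finC c(1) by (intro center_dist_le) auto
    ultimately have "real (center_dist ((!) ps ` ?C) p) \<le> (3 + eps) * r"
      using cq by (simp add: H_def)
    then show "p \<in> covered (set ps) ((!) ps ` ?C) ((3 + eps) * r)"
      using cq c P by (simp add: covered_def)
  qed
  then have "card ((!) ps ` covers ?W ?C) \<le> card (covered (set ps) ((!) ps ` ?C) ((3 + eps) * r))"
    by (intro card_mono) (auto simp: covered_def)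
  moreover have "card ((!) ps ` covers ?W ?C) = covered_num n k E l (Suc lo)"
    unfolding covered_num_def
    by (intro card_image inj_on_subset[OF inj]) (auto simp: covers_def wide_def)
  ultimately show ?thesis using suc by linarith
qed

text \<open>The Hamming distance is the squared Euclidean norm of the difference of the bit vectors,
  the quantity that the sketches estimate.\<close>

lemma ham_eq_sum:
  assumes "length p = d" "length q = d"
  shows "real (ham p q) = (\<Sum>i<d. (of_bool (p ! i) - of_bool (q ! i))\<^sup>2)"
proof -
  have "real (ham p q) = (\<Sum>i\<in>{i. i < d \<and> p ! i \<noteq> q ! i}. 1)"
    using assms by (simp add: ham_def)
  also have "\<dots> = (\<Sum>i<d. if p ! i \<noteq> q ! i then 1 else 0)"
    by (subst sum.inter_filter[symmetric]) (auto intro!: sum.cong)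
  also have "\<dots> = (\<Sum>i<d. (of_bool (p ! i) - of_bool (q ! i))\<^sup>2)"
    by (intro sum.cong) auto
  finally show ?thesis .
qed

section \<open>Running time\<close>

definition total_time :: "nat \<Rightarrow> nat \<Rightarrow> nat \<Rightarrow> nat \<Rightarrow> nat \<Rightarrow> nat \<Rightarrow> nat \<Rightarrow> nat \<Rightarrow> nat" where
  "total_time n d l e L K m R =
     (11 + 3 * e + 3 * L + 3 * K) + (3 + 5 * (R * d)) + (2 + R * n * (2 + d * 4 + 2)) +
     (2 + n * n * ((2 + R * (4 + m * 6 + 2)) + ((3 + R * (8 + R * 3)) + 1) + 2)) +
     (4 + K * (5 + greedy_time n l) + greedy_time n l)"

lemma greedy_time_le:
  assumes "n > 0" "l > 0"
  shows "greedy_time n l \<le> 40 * (n * n * l)"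
proof -
  have n: "n \<le> n * n" "1 \<le> n * n" using assms by auto
  have "greedy_time n l = 7 + 7 * n + l * (10 + 13 * n + 3 * (n * n))"
    unfolding greedy_time_def by (simp add: algebra_simps)
  also have "\<dots> \<le> 14 * (n * n) * l + l * (26 * (n * n))"
  proof (intro add_mono mult_le_mono2)
    have "7 + 7 * n \<le> 14 * (n * n)" using n by linarith
    also have "\<dots> \<le> 14 * (n * n) * l" using assms by simp
    finally show "7 + 7 * n \<le> 14 * (n * n) * l" .
  qed (use n in linarith)
  finally show ?thesis by (simp add: algebra_simps)
qed

text \<open>The binary search takes \<open>O(log d)\<close> rounds, and the time bound has no factor \<open>log d\<close>. If \<open>d\<close> is
  polynomial in \<open>n\<close> this is \<open>O(log n)\<close>, and otherwise the term \<open>n d\<close> of the bound dominates.\<close>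

lemma search_rounds_le:
  assumes n: "n > 0" and l: "0 < l" "l \<le> n" and eps: "0 < eps"
  shows "real (clog (d * d + 1) * (n * n * l)) \<le> 9 * log 2 (real n + 1) * time_bound n d l eps"
proof -
  let ?K = "clog (d * d + 1)" and ?lg = "log 2 (real n + 1)"
  have lg: "1 \<le> ?lg" using n by (simp add: le_log_iff)
  have tb1: "real (n * n * l) \<le> time_bound n d l eps"
  proof -
    have "real (n * n * l) \<le> (real n)\<^sup>2 * (1 / eps\<^sup>2 + real l)"
      using eps by (simp add: power2_eq_square algebra_simps)
    then show ?thesis by (simp add: time_bound_def)
  qed
  have tb2: "real (n * d) \<le> time_bound n d l eps" by (simp add: time_bound_def)
  have tb0: "0 \<le> time_bound n d l eps" using tb1 of_nat_0_le_iff[of "n * n * l", where 'a = real] by linarith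
  show ?thesis
  \<comment> \<open>Beyond this threshold \<open>n^2\<close> is at most the square root of
    \<open>d\<close>, and so is \<open>?K\<close> up to a constant; hence \<open>?K * n^2\<close> is
    of order at most \<open>d\<close>.\<close>
  proof (cases "d \<le> n ^ 4")
    case True
    have "d * d + 1 \<le> (n + 1) ^ 8"
    proof -
      have "d * d \<le> n ^ 4 * n ^ 4" using True by (intro mult_le_mono)
      also have "\<dots> = n ^ 8" by (simp flip: power_add)
      also have "\<dots> < (n + 1) ^ 8" by (intro power_strict_mono) auto
      finally show ?thesis by simp
    qed
    have "real ?K \<le> 9 * ?lg"
    proof (cases "?K = 0")
      case False
      then have "2 ^ (?K - 1) < d * d + 1" by (intro less_clog) simp
      also have "\<dots> \<le> (n + 1) ^ 8" by fact
      finally have "real (2 ^ (?K - 1)) \<le> real ((n + 1) ^ 8)" by (simp only: of_nat_le_iff)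
      then have "2 ^ (?K - 1) \<le> (real n + 1) ^ 8" by (simp add: add.commute)
      then have "log 2 (2 ^ (?K - 1)) \<le> log 2 ((real n + 1) ^ 8)" by (subst log_le_cancel_iff) auto
      then have "real (?K - 1) \<le> 8 * ?lg" by (simp add: log_nat_power)
      then show ?thesis using lg False by linarith
    qed (use lg in simp)
    then have "real ?K * real (n * n * l) \<le> (9 * ?lg) * time_bound n d l eps"
      using tb1 lg by (intro mult_mono) auto
    then show ?thesis by simp
  next
    case False
    then have dn: "n ^ 4 \<le> d" "d > 0" by auto
    \<comment> \<open>Applying \<open>x < 2 ^ x\<close> to a quarter of \<open>?K\<close> gives
      \<open>?K ^ 4 \<le> 256 * 2 ^ ?K\<close>, hence \<open>?K^2 \<le> 32 d\<close>.\<close>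
    define h where "h = ?K div 4"
    have "?K \<le> 4 * h + 3" unfolding h_def by presburger
    moreover have "h < 2 ^ h" by (rule less_exp)
    ultimately have "?K \<le> 4 * 2 ^ h" by linarith
    then have "?K ^ 4 \<le> (4 * 2 ^ h) ^ 4" by (rule power_mono) simp
    also have "\<dots> = 256 * 2 ^ (4 * h)" by (simp add: power_mult_distrib power_mult[symmetric] mult.commute)
    also have "\<dots> \<le> 256 * 2 ^ ?K" unfolding h_def by (intro mult_le_mono2 power_increasing) auto
    also have "\<dots> \<le> 256 * (4 * (d * d))"
    proof (rule mult_le_mono2)
      have "2 ^ ?K < 2 * (d * d + 1)" by (rule clog_less_double) simp
      also have "2 * (d * d + 1) \<le> 4 * (d * d)"
      proof -
        have "2 * (x + 1) \<le> 4 * x" if "1 \<le> x" for x :: nat using that by simp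
        then show ?thesis using dn(2) by (simp only: Suc_le_eq One_nat_def) simp
      qed
      finally show "2 ^ ?K \<le> 4 * (d * d)" by simp
    qed
    finally have "(?K\<^sup>2)\<^sup>2 \<le> (32 * d)\<^sup>2" by (simp add: power2_eq_square power4_eq_xxxx)
    then have K2: "?K\<^sup>2 \<le> 32 * d" by (rule power2_le_imp_le) simp
    have "(?K * (n * n))\<^sup>2 = ?K\<^sup>2 * n ^ 4" by (simp add: power2_eq_square power4_eq_xxxx)
    also have "\<dots> \<le> (32 * d) * d" using K2 dn by (intro mult_le_mono)
    also have "\<dots> \<le> (6 * d)\<^sup>2" by (simp add: power2_eq_square)
    finally have "?K * (n * n) \<le> 6 * d" by (rule power2_le_imp_le) simp
    then have "?K * (n * n) * l \<le> 6 * d * n" using l(2) by (rule mult_le_mono)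
    then have "?K * (n * n * l) \<le> 6 * (n * d)" by (simp add: mult_ac)
    then have "real (?K * (n * n * l)) \<le> real (6 * (n * d))" by (simp only: of_nat_le_iff)
    also have "\<dots> \<le> 6 * time_bound n d l eps" using tb2 by simp
    also have "\<dots> \<le> (9 * ?lg) * time_bound n d l eps" using lg tb0 by (intro mult_right_mono) linarith+
    finally show ?thesis .
  qed
qed

text \<open>The squares of the logarithm and of \<open>b\<close> come from the counting median, with
  \<open>R^2\<close> comparisons per pair and \<open>R \<le> 3 b lg\<close>. The largest constant,
  about \<open>6 * 65536 * 3\<close>, comes from comparing sketches; the sum of all constants stays
  below \<open>2 ^ 21\<close>.\<close>

lemma total_time_le:
  assumes n: "n > 0" and l: "0 < l" "l \<le> n" and eps: "0 < eps" "eps < 1 / 2" and b: "b > 0"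
    and k: "k = nat \<lceil>1 / eps\<rceil>"
    and m: "2 * m = 2 ^ clog (16384 * (k * k))" and R: "R = (clog n + 1) * b"
  shows "real (total_time n d l (clog (16384 * (k * k))) (clog n) (clog (d * d + 1)) m R)
    \<le> (2 ^ 21 * (real b)\<^sup>2) * (log 2 (real n + 1)) ^ 2 * time_bound n d l eps"
proof -
  let ?K = "clog (d * d + 1)" and ?e = "clog (16384 * (k * k))" and ?tb = "time_bound n d l eps"
  define lg where "lg = log 2 (real n + 1)"
  define Z where "Z = lg\<^sup>2 * ?tb"
  have lg: "1 \<le> lg" unfolding lg_def using n by (simp add: le_log_iff)
  have eps2: "1 / eps\<^sup>2 \<ge> 1" using eps by (simp add: power_le_one)
  have tb: "real (n * n) * (1 / eps\<^sup>2 + real l) \<le> ?tb" "real (n * d) \<le> ?tb"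
    by (auto simp: time_bound_def power2_eq_square)
  have n1: "real n \<ge> 1" "real (n * n) \<ge> 1" "real n \<le> real (n * n)"
  proof -
    have a: "1 \<le> n * n" "n \<le> n * n" using n by auto
    show "real n \<ge> 1" using n by simp
    show "real (n * n) \<ge> 1" using of_nat_mono[OF a(1), where 'a = real] by simp
    show "real n \<le> real (n * n)" by (rule of_nat_mono[OF a(2)])
  qed
  have tbl: "real (n * n * l) \<le> ?tb"
  proof -
    have "real (n * n) * real l \<le> real (n * n) * (1 / eps\<^sup>2 + real l)"
      using eps2 by (intro mult_left_mono) auto
    with tb(1) show ?thesis by simp
  qed
  have tbe: "real (n * n) * (1 / eps\<^sup>2) \<le> ?tb"
  proof -
    have "real (n * n) * (1 / eps\<^sup>2) \<le> real (n * n) * (1 / eps\<^sup>2 + real l)"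
      by (intro mult_left_mono) auto
    with tb(1) show ?thesis by simp
  qed
  have tbn: "real (n * n) \<le> ?tb"
  proof -
    have "n * n \<le> n * n * l" using l by simp
    then have "real (n * n) \<le> real (n * n * l)" by (rule of_nat_mono)
    then show ?thesis using tbl by linarith
  qed
  have tb1: "1 \<le> ?tb" "real n \<le> ?tb" using tbn n1 by linarith+
  have lg2: "1 \<le> lg\<^sup>2" "lg \<le> lg\<^sup>2"
    using lg one_le_power[of lg 2] by (auto simp: power2_eq_square mult_le_cancel_left1)
  have Zt: "?tb \<le> Z" unfolding Z_def using mult_right_mono[of 1 "lg\<^sup>2" ?tb] lg2 tb1 by simp
  have Zl: "lg * ?tb \<le> Z" unfolding Z_def using lg2 tb1 by (intro mult_right_mono) auto
  have Z1: "1 \<le> Z" using Zt tb1 by simp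
  have L: "real (clog n) + 1 \<le> 3 * lg"
  proof (cases "clog n = 0")
    case False
    then have "2 ^ (clog n - 1) < n" by (intro less_clog) simp
    then have "real (2 ^ (clog n - 1)) \<le> real (n + 1)" unfolding of_nat_le_iff by simp
    then have "log 2 (2 ^ (clog n - 1)) \<le> lg" unfolding lg_def by (subst log_le_cancel_iff) auto
    then have "real (clog n - 1) \<le> lg" by (simp add: log_nat_power)
    then show ?thesis using lg False by linarith
  qed (use lg in simp)
  have R_le: "real R \<le> 3 * real b * lg"
    using mult_right_mono[OF L, of "real b"] by (simp add: R algebra_simps)
  have b1: "real b \<ge> 1" using b by simp
  have bb: "real b \<le> (real b)\<^sup>2" "1 \<le> (real b)\<^sup>2" using b1 one_le_power[of "real b" 2] by (auto simp: power2_eq_square mult_le_cancel_left1)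
  have R2: "real R * real R \<le> 9 * (real b)\<^sup>2 * lg\<^sup>2"
    using mult_mono[OF R_le R_le] b1 lg by (simp add: power2_eq_square algebra_simps)
  have k_le: "real k \<le> 2 / eps"
  proof -
    have "real k \<le> 1 / eps + 1" unfolding k using eps by (simp add: of_nat_nat)
    moreover have "1 \<le> 1 / eps" using eps by simp
    moreover have "2 / eps = 1 / eps + 1 / eps" by simp
    ultimately show ?thesis by linarith
  qed
  have k_pos: "k > 0" unfolding k using eps by simp
  have k2: "real (k * k) \<le> 4 / eps\<^sup>2"
    using mult_mono[OF k_le k_le] eps by (simp add: power2_eq_square)
  \<comment> \<open>Rounding up to a power of two less than doubles, so
    \<open>m < 16384 k^2\<close>, and \<open>k \<le> 2 / eps\<close>.\<close>
  have "2 * m < 2 * (16384 * (k * k))" unfolding m using k_pos by (intro clog_less_double) simp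
  then have "real m \<le> real (16384 * (k * k))" unfolding of_nat_le_iff by linarith
  then have m_le: "real m \<le> 65536 * (1 / eps\<^sup>2)" using k2 by simp
  have "real ?e \<le> real (2 * m)" unfolding m of_nat_le_iff using less_exp[of ?e] by linarith
  then have e_le: "real ?e \<le> 131072 * Z"
  proof -
    have "1 / eps\<^sup>2 \<le> real (n * n) * (1 / eps\<^sup>2)" using n1(2) eps2 mult_right_mono[of 1 "real (n * n)" "1 / eps\<^sup>2"] by simp
    then have "1 / eps\<^sup>2 \<le> Z" using tbe Zt by linarith
    then show ?thesis using \<open>real ?e \<le> real (2 * m)\<close> m_le by simp
  qed
  have KZ: "real ?K * real (n * n * l) \<le> 9 * Z"
    using search_rounds_le[OF n l eps(1), of d] Zl unfolding lg_def by simp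
  have K_le: "real ?K \<le> 9 * Z"
  proof -
    have "1 \<le> n * n * l" using n l by simp
    then have "real ?K * 1 \<le> real ?K * real (n * n * l)" by (intro mult_left_mono) (use of_nat_mono[of 1 "n * n * l", where 'a = real] in auto)
    then show ?thesis using KZ by simp
  qed
  have RX: "real R * x \<le> 3 * ((real b)\<^sup>2 * Z)" if "0 \<le> x" "x \<le> ?tb" for x
  proof -
    have "real R * x \<le> (3 * real b * lg) * ?tb" using R_le that b1 lg by (intro mult_mono) auto
    also have "\<dots> = 3 * (real b * (lg * ?tb))" by simp
    also have "real b * (lg * ?tb) \<le> (real b)\<^sup>2 * Z" using lg tb1 by (intro mult_mono bb Zl) auto
    finally have "real R * x \<le> 3 * ((real b)\<^sup>2 * Z)" by simp
    then show ?thesis .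
  qed
  have t1: "real (11 + 3 * ?e + 3 * clog n + 3 * ?K) \<le> 393300 * Z"
  proof -
    have "lg \<le> lg * ?tb" using lg tb1 by simp
    then have "real (clog n) \<le> 3 * Z" using L Zl by linarith
    then show ?thesis using e_le K_le Z1 by simp
  qed
  have t2: "real (3 + 5 * (R * d)) \<le> 18 * ((real b)\<^sup>2 * Z)"
  proof -
    have "real d \<le> real (n * d)" by (rule of_nat_mono) (use n in simp)
    then have "real R * real d \<le> 3 * ((real b)\<^sup>2 * Z)" using tb(2) by (intro RX) linarith+
    moreover have "Z \<le> (real b)\<^sup>2 * Z" using bb Z1 by simp
    moreover have "real (3 + 5 * (R * d)) = 3 + 5 * (real R * real d)" by simp
    ultimately show ?thesis using Z1 by linarith
  qed
  have t3: "real (2 + R * n * (2 + d * 4 + 2)) \<le> 26 * ((real b)\<^sup>2 * Z)"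
  proof -
    have "real (2 + R * n * (2 + d * 4 + 2)) = 2 + 4 * (real R * real n) + 4 * (real R * real (n * d))"
      by (simp add: algebra_simps)
    moreover have "Z \<le> (real b)\<^sup>2 * Z" using bb Z1 by simp
    ultimately show ?thesis using RX[of "real n"] RX[of "real (n * d)"] tb tb1 Z1 by linarith
  qed
  have t4: "real (2 + n * n * ((2 + R * (4 + m * 6 + 2)) + ((3 + R * (8 + R * 3)) + 1) + 2))
      \<le> 1180000 * ((real b)\<^sup>2 * Z)"
  proof -
    have "real (2 + n * n * ((2 + R * (4 + m * 6 + 2)) + ((3 + R * (8 + R * 3)) + 1) + 2)) =
      2 + 8 * real (n * n) + 14 * (real R * real (n * n)) + 6 * (real R * (real (n * n) * real m))
        + 3 * ((real R * real R) * real (n * n))"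
      by (simp add: algebra_simps)
    moreover have "real R * (real (n * n) * real m) \<le> 65536 * (3 * ((real b)\<^sup>2 * Z))"
    proof -
      have "real (n * n) * real m \<le> real (n * n) * (65536 * (1 / eps\<^sup>2))"
        using m_le by (intro mult_left_mono) auto
      also have "\<dots> = 65536 * (real (n * n) * (1 / eps\<^sup>2))" by simp
      also have "\<dots> \<le> 65536 * ?tb" using tbe by simp
      finally have "real (n * n) * real m / 65536 \<le> ?tb" by simp
      then have "real R * (real (n * n) * real m / 65536) \<le> 3 * ((real b)\<^sup>2 * Z)" by (intro RX) auto
      then show ?thesis by simp
    qed
    moreover have "(real R * real R) * real (n * n) \<le> 9 * ((real b)\<^sup>2 * Z)"
    proof -
      have "(real R * real R) * real (n * n) \<le> (9 * (real b)\<^sup>2 * lg\<^sup>2) * ?tb"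
        by (rule mult_mono[OF R2 tbn]) auto
      then show ?thesis by (simp add: Z_def mult.assoc)
    qed
    moreover have "Z \<le> (real b)\<^sup>2 * Z" using bb Z1 by simp
    ultimately show ?thesis using RX[of "real (n * n)"] tbn Zt Z1 by linarith
  qed
  have t5: "real (4 + ?K * (5 + greedy_time n l) + greedy_time n l) \<le> 449 * Z"
  proof -
    have nl: "1 \<le> n * n * l" using n l by simp
    have g: "greedy_time n l \<le> 40 * (n * n * l)" using n l by (intro greedy_time_le)
    then have "?K * (5 + greedy_time n l) \<le> ?K * (45 * (n * n * l))"
      using nl by (intro mult_le_mono2) linarith
    then have "4 + ?K * (5 + greedy_time n l) + greedy_time n l \<le>
        4 + 45 * (?K * (n * n * l)) + 40 * (n * n * l)"
      unfolding mult.left_commute[of ?K 45] using g by (intro add_mono order.refl)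
    then have "real (4 + ?K * (5 + greedy_time n l) + greedy_time n l) \<le>
        real (4 + 45 * (?K * (n * n * l)) + 40 * (n * n * l))" unfolding of_nat_le_iff .
    also have "\<dots> = 4 + 45 * (real ?K * real (n * n * l)) + 40 * real (n * n * l)" by simp
    also have "\<dots> \<le> 449 * Z" using KZ tbl Zt Z1 by linarith
    finally show ?thesis .
  qed
  have "real (total_time n d l ?e (clog n) ?K m R) \<le> 2097152 * ((real b)\<^sup>2 * Z)"
  proof -
    have "Z \<le> (real b)\<^sup>2 * Z" using bb Z1 by simp
    moreover have "real (total_time n d l ?e (clog n) ?K m R) \<le>
      393300 * Z + 18 * ((real b)\<^sup>2 * Z) + 26 * ((real b)\<^sup>2 * Z) + 1180000 * ((real b)\<^sup>2 * Z) + 449 * Z"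
      using t1 t2 t3 t4 t5 unfolding total_time_def of_nat_add[where 'a = real] by linarith
    ultimately show ?thesis using Z1 by linarith
  qed
  then show ?thesis by (simp add: Z_def lg_def mult.assoc)
qed

section \<open>Assembling the program\<close>

lemma wp_halts:
  assumes "wp w is T Q s" "T \<le> u"
  shows "\<exists>s'. steps w u (is, s) = return_pmf ([], s') \<and> Q s'"
proof -
  from assms(1) obtain t s' where t: "t \<le> T" "runs w is s t s'" "Q s'" unfolding wp_def by blast
  have "steps w (t + (u - t)) (is, s) = return_pmf ([], s')"
    using t(2) unfolding runs_def steps_add by (metis append_Nil2 bind_return_pmf steps_halted)
  then show ?thesis using t assms(2) by auto
qed

definition main_prog :: "nat \<Rightarrow> instr list" where
  "main_prog b = setup_prog b @ fill_prog @ sketch_prog @ dist_prog @ search_prog"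

text \<open>Asserted for every table \<open>g\<close>, good or bad, since each outcome must have the
  right form. Whether \<open>E\<close> approximates the distances is settled separately.\<close>

definition post_ok :: "bool list list \<Rightarrow> nat \<Rightarrow> nat \<Rightarrow> nat \<Rightarrow> nat \<Rightarrow> nat \<Rightarrow> nat \<Rightarrow> nat \<Rightarrow> (nat \<Rightarrow> nat) \<Rightarrow> memory \<Rightarrow> bool" where
  "post_ok ps d l z k m R G g s \<longleftrightarrow> (\<exists>lo. let n = length ps;
       E = ram.dist n d m R (\<lambda>a. of_bool (a < n * d \<and> ps ! (a div d) ! (a mod d))) g in
     arrs s 1 ` {..<l} = chosen n k E (Suc lo) l \<and>
     (lo = 0 \<or> covered_num n k E l lo < n - z) \<and>
     (Suc lo = G \<or> n - z \<le> covered_num n k E l (Suc lo)))"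

text \<open>The setup and the drawing loop take the same number of steps on all branches, and what
  follows is deterministic. So the final memory is a function \<open>F\<close> of the table.\<close>

lemma main_prog_steps:
  fixes ps :: "bool list list" and d l z k b w :: nat
  defines "n \<equiv> length ps"
  defines "e \<equiv> clog (16384 * (k * k))" and "K \<equiv> clog (d * d + 1)"
    and "R \<equiv> (clog n + 1) * b" and "m \<equiv> 2 ^ clog (16384 * (k * k)) div 2"
  assumes ram: "\<And>g. ram w n d l k m R (2 ^ K) (\<lambda>a. of_bool (a < n * d \<and> ps ! (a div d) ! (a mod d)))"
    and small: "2 * n < 2 ^ w" "2 * (d * d + 1) < 2 ^ w" "2 * (16384 * (k * k)) < 2 ^ w"
      "b < 2 ^ w" "R < 2 ^ w"
    and m: "2 * m = 2 ^ e" and z: "z < n"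
    and u: "total_time n d l e (clog n) K m R \<le> u"
  shows "\<exists>F. steps w u (main_prog b, input_memory ps d l z k) =
      map_pmf (\<lambda>g. ([], F g)) (fill w 0 (R * d) (\<lambda>_. 0)) \<and>
    (\<forall>g. post_ok ps d l z k m R (2 ^ K) g (F g))"
proof -
  let ?A = "\<lambda>a. of_bool (a < n * d \<and> ps ! (a div d) ! (a mod d)) :: nat"
  let ?s = "input_memory ps d l z k"
  let ?rest = "sketch_prog @ dist_prog @ search_prog"
  interpret R: ram w n d l z k m R "2 ^ K" ?A g for g using ram .
  let ?T1 = "11 + 3 * e + 3 * clog n + 3 * K"
  have "wp w (setup_prog b) ?T1
    (\<lambda>s'. arrs s' = arrs ?s \<and> regs s' 0 = n \<and> regs s' 1 = d \<and> regs s' 2 = regs ?s 2 \<and>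
      regs s' 3 = regs ?s 3 \<and> regs s' 4 = k \<and> regs s' 5 = 2 ^ e \<and> regs s' 6 = 2 ^ e div 2 \<and>
      regs s' 7 = R \<and> regs s' 8 = 2 ^ K) ?s"
    unfolding e_def K_def R_def
    using R.pos small by (intro wp_setup) (auto simp: input_memory_def n_def R_def)
  then obtain t1 s1 where t1: "t1 \<le> ?T1" "runs w (setup_prog b) ?s t1 s1" and
    s1: "arrs s1 = arrs ?s \<and> regs s1 0 = n \<and> regs s1 1 = d \<and> regs s1 2 = regs ?s 2 \<and>
      regs s1 3 = regs ?s 3 \<and> regs s1 4 = k \<and> regs s1 5 = 2 ^ e \<and> regs s1 6 = 2 ^ e div 2 \<and>
      regs s1 7 = R \<and> regs s1 8 = 2 ^ K"
    unfolding wp_def by blast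
  define s2 where "s2 = (\<lambda>g. filled s1 (R * d) g)"
  define T3 where "T3 = (2 + R * n * (2 + d * 4 + 2)) +
     ((2 + n * n * ((2 + R * (4 + m * 6 + 2)) + ((3 + R * (8 + R * 3)) + 1) + 2)) +
     (4 + K * (5 + greedy_time n l) + greedy_time n l))"
  have post: "wp w ?rest T3 (post_ok ps d l z k m R (2 ^ K) g) (s2 g)" for g
    unfolding T3_def
  proof (rule wp_seq[OF R.wp_sketch[where g = g]])
    show "R.params (s2 g)"
      using s1 m unfolding R.params_def s2_def filled_def
      by (simp add: input_memory_def m_def e_def)
    show "arrs (s2 g) 0 = ?A" "arrs (s2 g) 2 = g" "arrs (s2 g) 3 a = 0" for a
      using s1 by (auto simp: s2_def filled_def input_memory_def n_def)
  next
    fix s assume "R.params s \<and> (\<forall>e<R * n. \<forall>u<2 * m. arrs s 3 (e * (2 * m) + u) = R.cell g e d u)"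
    then have "R.params s" "R.sketched g s" unfolding R.sketched_def by auto
    then show "wp w (dist_prog @ search_prog)
      ((2 + n * n * ((2 + R * (4 + m * 6 + 2)) + ((3 + R * (8 + R * 3)) + 1) + 2)) +
       (4 + K * (5 + greedy_time n l) + greedy_time n l)) (post_ok ps d l z k m R (2 ^ K) g) s"
    proof (rule wp_seq[OF R.wp_dist])
      fix s' assume s': "R.params s' \<and> (\<forall>p<n. \<forall>q<n. arrs s' 5 (p * n + q) = R.dist g p q)"
      show "wp w search_prog (4 + K * (5 + greedy_time n l) + greedy_time n l)
         (post_ok ps d l z k m R (2 ^ K) g) s'"
      proof (rule wp_mono[OF R.wp_search[where E = "R.dist g"]])
        show "R.dist g p q \<le> d * d" for p q unfolding R.dist_def by (rule low_median_le)
        show "R.has_dist (R.dist g) s'" using s' unfolding R.has_dist_def by blast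
      qed (use s' z in \<open>auto simp: post_ok_def Let_def n_def\<close>)
    qed
  qed
  \<comment> \<open>The budget left after the draws. It may exceed what is needed, since a halted
    configuration stays put.\<close>
  define v where "v = u - t1 - (2 + (5 * (R * d) + 1))"
  have u_eq: "u = t1 + (2 + ((5 * (R * d) + 1) + v))" and v: "T3 \<le> v"
    using u t1(1) unfolding v_def T3_def total_time_def by linarith+
  have "\<exists>s'. steps w v (?rest, s2 g) = return_pmf ([], s') \<and> post_ok ps d l z k m R (2 ^ K) g s'" for g
    by (rule wp_halts[OF post v])
  then obtain F where F: "\<And>g. steps w v (?rest, s2 g) = return_pmf ([], F g)"
    "\<And>g. post_ok ps d l z k m R (2 ^ K) g (F g)" by metis
  have "steps w u (main_prog b, ?s) = steps w (2 + ((5 * (R * d) + 1) + v)) (fill_prog @ ?rest, s1)"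
    using t1(2) unfolding u_eq runs_def main_prog_def steps_add[of w t1] by (simp add: bind_return_pmf)
  also have "\<dots> = steps w ((5 * (R * d) + 1) + v)
     (Loop (Reg 26 \<^bold>< Reg 7 \<^bold>* Reg 1)
        [Random 27, SetArr 2 (Reg 26) (Reg 27), SetReg 27 (Const 0), SetReg 26 (Reg 26 \<^bold>+ Const 1)] # ?rest,
      filled s1 0 (\<lambda>_. 0))"
  proof -
    have "set_reg 26 0 (set_reg 27 0 s1) = filled s1 0 (\<lambda>_. 0)"
      using s1 by (simp add: set_reg_def filled_def input_memory_def fun_upd_idem)
    then show ?thesis unfolding steps_add[of w 2] fill_prog_def
      by (simp add: numeral_2_eq_2 bind_return_pmf)
  qed
  also have "\<dots> = bind_pmf (map_pmf (\<lambda>g. (?rest, s2 g)) (fill w 0 (R * d) (\<lambda>_. 0))) (steps w v)"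
    unfolding steps_add[of w "5 * (R * d) + 1"] s2_def
    using s1 R.bounds(2) by (subst steps_fill_loop) auto
  also have "\<dots> = map_pmf (\<lambda>g. ([], F g)) (fill w 0 (R * d) (\<lambda>_. 0))"
    unfolding map_pmf_def bind_assoc_pmf bind_return_pmf F(1) ..
  finally show ?thesis using F(2) by blast
qed

text \<open>With \<open>Y = n + d + k + b\<close>, all quantities are at most \<open>c Y^j\<close>
  with \<open>c < 2 ^ 17\<close> and \<open>j \<le> 5\<close>. The extreme case is the number of
  sketch cells, \<open>R * n * (2 * m) \<le> 65536 Y^5\<close>.\<close>

lemma ram_parameters:
  fixes n d l k b w :: nat
  assumes pos: "n > 0" "l > 0" "l \<le> n" "k > 0" "b > 0"
    and word: "2 ^ 17 * (n + d + k + b) ^ 5 \<le> 2 ^ w"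
    and m: "2 * m = 2 ^ clog (16384 * (k * k))" and R: "R = (clog n + 1) * b"
    and A: "\<And>a. A a \<le> 1"
  shows "ram w n d l k m R (2 ^ clog (d * d + 1)) A"
    and "2 * n < 2 ^ w" "2 * (d * d + 1) < 2 ^ w" "2 * (16384 * (k * k)) < 2 ^ w"
      "b < 2 ^ w" "R < 2 ^ w"
proof -
  define Y where "Y = n + d + k + b"
  define G :: nat where "G = 2 ^ clog (d * d + 1)"
  have Y: "n \<le> Y" "d \<le> Y" "k \<le> Y" "b \<le> Y" "1 \<le> Y" using pos by (auto simp: Y_def)
  have le: "x < 2 ^ w" if "x \<le> c * Y ^ j" "c < 2 ^ 17" "j \<le> 5" for x c j
  proof -
    have "c * Y ^ j \<le> c * Y ^ 5" using Y(5) that(3) by (intro mult_le_mono2 power_increasing) auto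
    also have "\<dots> < 2 ^ 17 * Y ^ 5" using Y(5) that(2) by (intro mult_strict_right_mono) auto
    finally show ?thesis using word that(1) by (simp add: Y_def)
  qed
  have sq: "x * y \<le> Y ^ 2" if "x \<le> Y" "y \<le> Y" for x y
    using mult_le_mono[OF that] by (simp add: power2_eq_square)
  have Y1: "1 \<le> Y ^ j" for j using Y(5) by simp
  have "clog n + 1 \<le> 2 * n"
    using less_exp[of "clog n"] clog_less_double[of n] pos(1) by linarith
  then have "clog n + 1 \<le> 2 * Y" using Y(1) by linarith
  then have R_le: "R \<le> 2 * Y ^ 2" unfolding R using mult_le_mono[OF _ Y(4)] by (fastforce simp: power2_eq_square)
  have m_le: "2 * m \<le> 32768 * Y ^ 2"
  proof -
    have "2 * m < 2 * (16384 * (k * k))" unfolding m using pos by (intro clog_less_double) simp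
    then show ?thesis using sq[OF Y(3) Y(3)] by linarith
  qed
  have dd: "d * d \<le> Y ^ 2" by (rule sq[OF Y(2) Y(2)])
  have G_le: "G \<le> 4 * Y ^ 2"
  proof -
    have "G < 2 * (d * d + 1)" unfolding G_def by (intro clog_less_double) simp
    then have "G < 2 * (d * d) + 2" by simp
    then show ?thesis using dd Y1[of 2] by linarith
  qed
  have dG: "d * d < G" using clog_ge[of "d * d + 1"] by (simp add: G_def)
  have m_pos: "m > 0" using m by (metis neq0_conv mult_0_right power_not_zero zero_neq_numeral)
  show "2 * n < 2 ^ w" by (rule le[of _ 2 1]) (use Y in auto)
  have "2 * (d * d) + 2 \<le> 4 * Y ^ 2" using dd Y1[of 2] by linarith
  then show "2 * (d * d + 1) < 2 ^ w" by (intro le[of _ 4 2]) auto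
  show "2 * (16384 * (k * k)) < 2 ^ w"
    by (rule le[of _ 32768 2]) (use sq[OF Y(3) Y(3)] in linarith, auto)
  show "b < 2 ^ w" by (rule le[of _ 1 1]) (use Y in auto)
  show Rw: "R < 2 ^ w" by (rule le[of _ 2 2]) (use R_le in auto)
  show "ram w n d l k m R (2 ^ clog (d * d + 1)) A"
  proof (unfold_locales, goal_cases)
    case (2)
    show ?case by (rule le[of _ 16 0]) auto
  next
    case 3
    have "R * n * (2 * m) \<le> (2 * Y ^ 2) * Y * (32768 * Y ^ 2)"
      by (rule mult_le_mono[OF mult_le_mono[OF R_le Y(1)] m_le])
    then show ?case by (intro le[of _ 65536 5]) (auto simp: power_numeral_even power_numeral_odd Let_def)
  next
    case 4
    have "R * d \<le> (2 * Y ^ 2) * Y" using R_le Y(2) by (intro mult_le_mono)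
    then show ?case by (intro le[of _ 2 3]) (auto simp: power2_eq_square power3_eq_cube)
  next
    case 5
    show ?case by (rule le[of _ 1 2]) (use sq[OF Y(1) Y(1)] in auto)
  next
    case 6
    show ?case by (rule le[of _ 1 2]) (use sq[OF Y(1) Y(2)] in auto)
  next
    case 7
    have "(2 * m) * (2 * (d * d)) \<le> (32768 * Y ^ 2) * (2 * Y ^ 2)"
      by (rule mult_le_mono[OF m_le]) (use dd in simp)
    then show ?case by (intro le[of _ 65536 4]) (auto simp: power2_eq_square power4_eq_xxxx)
  next
    case 8
    show ?case by (rule le[of _ 4 2]) (use R_le in linarith, auto)
  next
    case 9
    show ?case by (rule le[of _ 2 1]) (use Y in auto)
  next
    case 10
    have "3 * (16 * k + 1) * G \<le> (51 * Y) * (4 * Y ^ 2)"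
      by (rule mult_le_mono[OF _ G_le]) (use Y(3,5) in simp)
    then show ?case unfolding G_def by (intro le[of _ 204 3]) (auto simp: power2_eq_square power3_eq_cube)
  next
    case 11
    have "16 * k * (d * d) \<le> (16 * Y) * Y ^ 2" by (rule mult_le_mono[OF _ dd]) (use Y in simp)
    then show ?case by (intro le[of _ 16 3]) (auto simp: power2_eq_square power3_eq_cube)
  qed (use pos A m_pos dG R in \<open>auto simp: G_def\<close>)
qed

text \<open>The argument \<open>X\<close> of the logarithm is at least 2, so its powers absorb
  constants: \<open>2 ^ 17 \<le> X ^ 17\<close> and
  \<open>n + d + k + b \<le> (b + 2) X \<le> X ^ (b + 3)\<close>. The exponents add up to
  \<open>17 + 5 (b + 3) = 5 b + 32\<close>.\<close>

lemma word_length: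
  fixes eps :: real
  assumes n: "n > 0" and eps: "0 < eps" "eps < 1 / 2" and k: "k = nat \<lceil>1 / eps\<rceil>"
    and w: "real w \<ge> real (5 * b + 32) * log 2 (real n + real d + 1 / eps)"
  shows "2 ^ 17 * (n + d + k + b) ^ 5 \<le> (2 :: nat) ^ w"
proof -
  define X where "X = real n + real d + 1 / eps"
  have inv: "2 \<le> 1 / eps" using eps by (simp add: field_simps)
  have X: "2 \<le> X" "1 \<le> X" using inv n by (auto simp: X_def)
  have "real k \<le> 1 / eps + 1" unfolding k using eps by (simp add: of_nat_nat)
  then have "real (n + d + k + b) \<le> X + 1 + real b" by (simp add: X_def)
  also have "\<dots> \<le> X + X + real b * X"
    using X mult_left_mono[of 1 X "real b"] by (intro add_mono) auto
  also have "\<dots> = real (b + 2) * X" by (simp add: algebra_simps)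
  also have "\<dots> \<le> X ^ (b + 2) * X"
  proof (intro mult_right_mono)
    have "b + 2 \<le> 2 ^ (b + 2)" using less_exp[of "b + 2"] by simp
    then have "real (b + 2) \<le> real (2 ^ (b + 2))" by (rule of_nat_mono)
    also have "\<dots> = 2 ^ (b + 2)" by simp
    also have "\<dots> \<le> X ^ (b + 2)" using X by (intro power_mono) auto
    finally show "real (b + 2) \<le> X ^ (b + 2)" .
  qed (use X in auto)
  also have "\<dots> = X ^ (b + 3)" by (simp add: eval_nat_numeral)
  finally have Y: "real (n + d + k + b) \<le> X ^ (b + 3)" .
  have "real (2 ^ 17 * (n + d + k + b) ^ 5) = 2 ^ 17 * real (n + d + k + b) ^ 5" by simp
  also have "\<dots> \<le> X ^ 17 * (X ^ (b + 3)) ^ 5"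
    using X Y by (intro mult_mono power_mono) auto
  also have "\<dots> = X ^ (5 * b + 32)"
    unfolding power_mult[symmetric] power_add[symmetric] by (simp add: algebra_simps)
  also have "\<dots> = X powr real (5 * b + 32)" using X by (subst powr_realpow) auto
  also have "\<dots> = 2 powr (real (5 * b + 32) * log 2 X)"
    using X by (simp add: powr_powr[symmetric] mult.commute powr_def log_def)
  also have "\<dots> \<le> 2 powr real w" using w by (intro powr_mono) (auto simp: X_def)
  also have "\<dots> = real (2 ^ w)" by (simp add: powr_realpow)
  finally show ?thesis by (simp only: of_nat_le_iff)
qed

text \<open>\<open>2 ^ R \<ge> n ^ b\<close>: two of the \<open>b\<close> factors \<open>n\<close>
  pay for the union bound over pairs, the others for the required probability.\<close>

lemma failure_probability:
  assumes n: "n > 0" and b: "b = nat \<lceil>\<beta>\<rceil> + 2" and R: "R = (clog n + 1) * b" and \<beta>: "\<beta> \<ge> (1 :: real)"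
  shows "real (n * n) * (1 / 2 ^ R) \<le> 1 / real n powr \<beta>"
proof -
  have "n ^ b \<le> (2 ^ clog n) ^ b" using clog_ge by (rule power_mono) simp
  also have "\<dots> \<le> 2 ^ R" unfolding R power_mult[symmetric] by (intro power_increasing) auto
  finally have "real (n ^ b) \<le> real (2 ^ R)" by (rule of_nat_mono)
  then have "real n ^ nat \<lceil>\<beta>\<rceil> * real (n * n) \<le> 2 ^ R" by (simp add: b power_add power2_eq_square mult_ac)
  moreover have "real n powr \<beta> \<le> real n ^ nat \<lceil>\<beta>\<rceil>"
  proof -
    have "real n powr \<beta> \<le> real n powr real (nat \<lceil>\<beta>\<rceil>)"
      using n \<beta> by (intro powr_mono) (auto simp: of_nat_nat)
    then show ?thesis using n by (simp add: powr_realpow)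
  qed
  ultimately have "real n powr \<beta> * real (n * n) \<le> 2 ^ R"
    by (meson mult_right_mono of_nat_0_le_iff order_trans)
  then show ?thesis using n by (simp add: field_simps)
qed

theorem theorem5:
  fixes \<beta> :: real
  assumes "\<beta> \<ge> 1"
  shows "\<exists>(prog :: instr list) (C :: real) (c :: nat) (\<kappa> :: real).
    \<forall>(n :: nat) (d :: nat) (l :: nat) (z :: nat) (eps :: real) (P :: bool list set)
      (ps :: bool list list) (T :: bool list set) (r :: real) (w :: nat) (time :: nat)
      (result :: config pmf).
      P \<subseteq> hamming_space d \<and> finite P \<and> card P = n \<and> l > 0 \<and> z < n \<and>
      T \<subseteq> P \<and> card T = l \<and> card (covered P T r) \<ge> n - z \<and>
      0 < eps \<and> eps < 1 / 2 \<and>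
      distinct ps \<and> set ps = P \<and>
      real w \<ge> \<kappa> * log 2 (real n + real d + 1 / eps) \<and>
      time = nat \<lfloor>C * (log 2 (real n + 1)) ^ c * time_bound n d l eps\<rfloor> \<and>
      result = steps w time (prog, input_memory ps d l z (nat \<lceil>1 / eps\<rceil>))
      \<longrightarrow>
      (\<forall>x \<in> set_pmf result.
         halted_with_output ps l x \<and>
         output_centers ps l x \<subseteq> P \<and> card (output_centers ps l x) = l) \<and>
      measure_pmf.prob result
        {x. card (covered P (output_centers ps l x) ((3 + eps) * r)) \<ge> n - z}
        \<ge> 1 - 1 / real n powr \<beta>"
proof -
  define b where "b = nat \<lceil>\<beta>\<rceil> + 2"
  have "b > 0" by (simp add: b_def)
  show ?thesis
  proof (rule exI[of _ "main_prog b"], rule exI[of _ "2 ^ 21 * (real b)\<^sup>2"], rule exI[of _ 2],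
      rule exI[of _ "real (5 * b + 32)"], intro allI impI, elim conjE)
    fix n d l z :: nat and eps :: real and P :: "bool list set" and ps T r and w time :: nat and result
    assume P: "P \<subseteq> hamming_space d" "finite P" "card P = n" and l: "l > 0" and z: "z < n"
      and T: "T \<subseteq> P" "card T = l" "card (covered P T r) \<ge> n - z"
      and eps: "0 < eps" "eps < 1 / 2" and ps: "distinct ps" "set ps = P"
      and w: "real w \<ge> real (5 * b + 32) * log 2 (real n + real d + 1 / eps)"
      and time: "time = nat \<lfloor>2 ^ 21 * (real b)\<^sup>2 * (log 2 (real n + 1)) ^ 2 * time_bound n d l eps\<rfloor>"
      and result: "result = steps w time (main_prog b, input_memory ps d l z (nat \<lceil>1 / eps\<rceil>))"
    define k where "k = nat \<lceil>1 / eps\<rceil>"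
    define e where "e = clog (16384 * (k * k))"
    define K where "K = clog (d * d + 1)"
    define R where "R = (clog n + 1) * b"
    define m :: nat where "m = 2 ^ e div 2"
    define A :: "nat \<Rightarrow> nat" where "A = (\<lambda>a. of_bool (a < n * d \<and> ps ! (a div d) ! (a mod d)))"
    have n: "n > 0" using z by simp
    have len: "length ps = n" using ps P by (metis distinct_card)
    have ln: "l \<le> n" using T P by (metis card_mono)
    have inv: "2 < 1 / eps" using eps by (simp add: field_simps)
    then have "real k \<ge> 1 / eps" unfolding k_def by (simp add: of_nat_nat)
    then have k: "k \<ge> 2" "1 / real k \<le> eps"
    proof -
      assume "1 / eps \<le> real k"
      moreover from this inv have "2 < real k" by linarith
      ultimately show "k \<ge> 2" "1 / real k \<le> eps" using eps by (auto simp: field_simps)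
    qed
    have k0: "k > 0" using k by simp
    have ge: "16384 * (k * k) \<le> 2 ^ e" unfolding e_def by (rule clog_ge)
    have "e \<noteq> 0"
    proof
      assume "e = 0"
      then have "16384 * (k * k) \<le> 1" using ge by simp
      moreover have "0 < k * k" using k0 by simp
      ultimately show False by linarith
    qed
    then have m2: "2 * m = 2 ^ e" by (cases e) (auto simp: m_def)
    note word = word_length[OF n eps k_def w]
    have A_le: "A a \<le> 1" for a by (simp add: A_def)
    note params = ram_parameters[OF n l ln k0 \<open>b > 0\<close> word m2[unfolded e_def] R_def A_le]
    have ram: "ram w n d l k m R (2 ^ K) A"
      unfolding K_def by (rule params(1))
    have tt: "total_time n d l e (clog n) K m R \<le> time"
      unfolding time e_def K_def
      by (intro le_nat_floor total_time_le n l ln eps \<open>b > 0\<close> k_def m2[unfolded e_def] R_def)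
    have "\<exists>F. steps w time (main_prog b, input_memory ps d l z k) =
        map_pmf (\<lambda>g. ([], F g)) (fill w 0 (R * d) (\<lambda>_. 0)) \<and>
      (\<forall>g. post_ok ps d l z k m R (2 ^ K) g (F g))"
      unfolding K_def R_def m_def e_def len[symmetric]
      by (rule main_prog_steps)
        (use ram params(2-6) m2 z tt in \<open>simp_all add: len R_def m_def e_def K_def A_def\<close>)
    then obtain F where F: "result = map_pmf (\<lambda>g. ([], F g)) (fill w 0 (R * d) (\<lambda>_. 0))"
      "\<And>g. post_ok ps d l z k m R (2 ^ K) g (F g)"
      unfolding result k_def[symmetric] by blast
    define E where "E = ram.dist n d m R A"
    have out: "\<exists>lo. output_indices l ([], F g) = chosen n k (E g) (Suc lo) l \<and>
       (lo = 0 \<or> covered_num n k (E g) l lo < n - z) \<and>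
       (Suc lo = 2 ^ K \<or> n - z \<le> covered_num n k (E g) l (Suc lo))" for g
      using F(2)[of g] unfolding post_ok_def Let_def output_indices_def len E_def A_def by simp
    have inj: "inj_on ((!) ps) {..<n}"
      using ps len by (auto simp: inj_on_def nth_eq_iff_index_eq)
    have chosen: "chosen n k (E g) \<rho> l \<subseteq> {..<n}" "card (chosen n k (E g) \<rho> l) = l" for g \<rho>
      using greedy_subset_card[OF ln] by auto
    \<comment> \<open>This uses only that the greedy algorithm returns \<open>l\<close> distinct
      indices, whatever the estimates are.\<close>
    have det: "halted_with_output ps l x \<and> output_centers ps l x \<subseteq> P \<and> card (output_centers ps l x) = l"
      if x: "x \<in> set_pmf result" for x
    proof -
      obtain g where g: "x = ([], F g)" using x F(1) by auto
      obtain lo where "output_indices l x = chosen n k (E g) (Suc lo) l" using out[of g] g by auto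
      then have "output_indices l x \<subseteq> {..<n}" "card (output_indices l x) = l" using chosen by auto
      then show ?thesis
        using g len ps card_image[OF inj_on_subset[OF inj]]
        by (auto simp: halted_with_output_def output_centers_def)
    qed
    define fails where "fails = (\<lambda>p q g. R \<le> 2 * card {j. j < R \<and>
       sketch_fails k m (\<lambda>i. real (A (p * d + i)) - real (A (q * d + i))) g (j * d) d})"
    define Good where "Good = {g. \<forall>p<n. \<forall>q<n. \<not> fails p q g}"
    have good: "n - z \<le> card (covered P (output_centers ps l ([], F g)) ((3 + eps) * r))" if g: "g \<in> Good" for g
    proof -
      interpret ram w n d l z k m R "2 ^ K" A g by (rule ram)
      obtain lo where lo: "output_indices l ([], F g) = chosen n k (E g) (Suc lo) l"
       "lo = 0 \<or> covered_num n k (E g) l lo < n - z"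
       "Suc lo = 2 ^ K \<or> n - z \<le> covered_num n k (E g) l (Suc lo)" using out[of g] by blast
      have "n - z \<le> card (covered (set ps) ((!) ps ` chosen n k (E g) (Suc lo) l) ((3 + eps) * r))"
      proof (rule covered_chosen)
        show "length p = d" if "p \<in> set ps" for p
          using that ps P by (auto simp: hamming_space_def)
        then have lenp: "length (ps ! p) = d" if "p < n" for p using that len by simp
        have bit: "A (p * d + i) = of_bool (ps ! p ! i)" if "p < n" "i < d" for p i
          using that index_less[of p n i d] by (simp add: A_def)
        show "\<bar>real (E g p q) - ham (ps ! p) (ps ! q)\<bar> * (16 * real k) \<le> ham (ps ! p) (ps ! q)"
          if "p < n" "q < n" for p q
          unfolding E_def
        proof (rule dist_approx[OF that refl])
          show "real (ham (ps ! p) (ps ! q)) = (\<Sum>i<d. (real (A (p * d + i)) - real (A (q * d + i)))\<^sup>2)"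
            using that by (simp add: ham_eq_sum[OF lenp lenp] bit)
          show "2 * card {j. j < R \<and> sketch_fails k m (\<lambda>i. real (A (p * d + i)) - real (A (q * d + i))) g (j * d) d} < R"
            using g that by (auto simp: Good_def fails_def not_le)
        qed
        \<comment> \<open>The top radius exceeds the cap on estimates, so it succeeds without having
          been tested.\<close>
        have "E g p q < Suc lo" if "Suc lo = 2 ^ K" for p q
          unfolding that E_def dist_def using low_median_le pos(7) by (rule le_less_trans)
        then show "n - z \<le> covered_num n k (E g) l (Suc lo) \<or> (\<forall>p<n. \<forall>q<n. E g p q < Suc lo)"
          using lo(3) by blast
      qed (use ps len z T l k lo in auto)
      then show ?thesis using ps lo(1) by (simp add: output_centers_def)
    qed
    let ?F = "fill w 0 (R * d) (\<lambda>_. 0)"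
    \<comment> \<open>Both numbers are powers of two, so the word bound on \<open>2 * m\<close>
      already gives divisibility.\<close>
    have dvd: "2 * m dvd 2 ^ w"
    proof -
      have "2 ^ e < 2 * (16384 * (k * k))"
        unfolding e_def by (rule clog_less_double) (use k0 in simp)
      also note params(4)
      finally have "(2::nat) ^ e < 2 ^ w" .
      then have "e \<le> w" by simp
      then show ?thesis unfolding m2 by (rule le_imp_power_dvd)
    qed
    have mk: "m > 0" "7680 * k\<^sup>2 \<le> m"
    proof -
      show "m > 0" using m2 by (cases "m = 0") auto
      have "7680 * (k * k) \<le> m" using ge m2 by linarith
      then show "7680 * k\<^sup>2 \<le> m" by (simp add: power2_eq_square)
    qed
    have fail: "measure_pmf.prob ?F {g. fails p q g} \<le> 1 / 2 ^ R" for p q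
      unfolding fails_def by (rule sketch_fails_majority[OF mk(1) dvd mk(2)]) (auto simp: A_def)
    \<comment> \<open>Union bound over the \<open>n * n\<close> ordered pairs.\<close>
    have "- Good = (\<Union>(p, q)\<in>{..<n} \<times> {..<n}. {g. fails p q g})"
      by (auto simp: Good_def)
    then have "measure_pmf.prob ?F (- Good) \<le>
        (\<Sum>x\<in>{..<n} \<times> {..<n}. measure_pmf.prob ?F (case x of (p, q) \<Rightarrow> {g. fails p q g}))"
      by (simp only:) (rule measure_pmf.finite_measure_subadditive_finite, auto)
    also have "\<dots> \<le> (\<Sum>x\<in>{..<n} \<times> {..<n}. 1 / 2 ^ R)"
      using fail by (intro sum_mono) auto
    also have "\<dots> = real (n * n) * (1 / 2 ^ R)" by (simp add: card_cartesian_product)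
    also have "\<dots> \<le> 1 / real n powr \<beta>"
      by (rule failure_probability[OF n b_def R_def assms])
    finally have "1 - 1 / real n powr \<beta> \<le> measure_pmf.prob ?F Good"
      using measure_pmf.prob_compl[of Good ?F] by (simp add: Compl_eq_Diff_UNIV)
    also have "\<dots> \<le> measure_pmf.prob result
        {x. card (covered P (output_centers ps l x) ((3 + eps) * r)) \<ge> n - z}"
      unfolding F(1) measure_map_pmf using good by (intro measure_pmf.finite_measure_mono) auto
    finally show "(\<forall>x \<in> set_pmf result.
         halted_with_output ps l x \<and>
         output_centers ps l x \<subseteq> P \<and> card (output_centers ps l x) = l) \<and>
      measure_pmf.prob result
        {x. card (covered P (output_centers ps l x) ((3 + eps) * r)) \<ge> n - z}
        \<ge> 1 - 1 / real n powr \<beta>"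
      using det by blast
  qed
qed

end
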